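(* Let $p$ be a prime, $k$ a field of characteristic $p$, $G$ a nilpotent-by-finite compact $p$-adic analytic group with $\Delta^+(G)=1$ such that $H=\mathbf{FN}_p(G)$ is non-abelian, and $P$ a faithful $G$-stable prime ideal of $kH$. With the notation of the context ($L$, $l$, $Q*F$, $\hat f$, $v_1,\dots,v_s$, $Y_1,\dots,Y_l$), take an automorphism $\sigma$ of $H$ with $\sigma(P)=P$. Suppose that the induced automorphism on $\mathrm{gr}_{\hat f}(Q*F)$ fixes each of the valuations $v_1,\dots,v_s$ and fixes each of the elements $Y_1,\dots,Y_l$. Then the induced automorphism on $H/L$ (which can be seen as a matrix $M_\sigma\in GL_l(\mathbb{Z}_p)$ with respect to the basis $y_1L,\dots,y_lL$) lies in the first congruence subgroup of $GL_l(\mathbb{Z}_p)$, i.e. it takes the form $M_\sigma\in 1+pX$ (that is, $M_\sigma=1+pX$) for some $X\in M_l(\mathbb{Z}_p)$. In particular, when $p>2$, $\sigma$ has finite order if and only if it is the identity automorphism.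
   Context: Groups. A $p$-valuation on a group $G$ is a function $\omega:G\to\mathbb{R}\cup\{\infty\}$ with, for all $x,y\in G$: $\omega(xy^{-1})\ge\min\{\omega(x),\omega(y)\}$; $\omega([x,y])\ge\omega(x)+\omega(y)$; $\omega(x)=\infty$ iff $x=1$; $\omega(x)>\frac1{p-1}$; $\omega(x^p)=\omega(x)+1$. A group is $p$-valuable if it has a $p$-valuation with respect to which it is complete and of finite rank (Lazard). $\Delta^+(G)$ is the set of torsion elements of $G$ with finitely many conjugates (the largest finite normal subgroup). $\mathbf{FN}_p(G)$ is the unique largest closed normal subgroup $H$ of $G$ containing $\Delta^+$ with $H/\Delta^+$ nilpotent and $p$-valuable; it is open and characteristic. A closed normal subgroup $N$ of $H$ is isolated if $H/N$ is torsion-free. An ordered basis of $(H,\omega)$ is a finite set $\{y_1,\dots,y_d\}$ such that every $x\in H$ is uniquely $x=y_1^{\lambda_1}\cdots y_d^{\lambda_d}$ with $\lambda_i\in\mathbb{Z}_p$, and $\omega(x)=\inf_i\{\omega(y_i)+v_p(\lambda_i)\}$. Rings. $kG$ is the completed group ring. A filtration on a ring $R$ is $v:R\to\mathbb{R}\cup\{\infty\}$ with $v(x+y)\ge\min\{v(x),v(y)\}$, $v(xy)\ge v(x)+v(y)$, $v(0)=\infty$, $v(1)=0$; it is a valuation if $v(xy)=v(x)+v(y)$ always. $\mathrm{gr}_vR=\bigoplus_{\lambda}R_{v,\lambda}/R_{v,\lambda^+}$, where $R_{v,\lambda}=\{x:v(x)\ge\lambda\}$, $R_{v,\lambda^+}=\{x:v(x)>\lambda\}$.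 An ideal $P$ of $kH$ is faithful if $x\in H$, $x-1\in P$ imply $x=1$, and $G$-stable if $g^{-1}Pg=P$ for all $g\in G$. Setup. $F=G/H$. $Z$ is the centre of $H$, $H'$ its isolated derived subgroup (the smallest closed isolated normal subgroup containing $[H,H]$), and $L$ the smallest closed isolated normal subgroup of $H$ containing $H'$ and $Z$; $L$ is a proper subgroup of $H$. Let $\omega$ be a $G$-invariant $p$-valuation on $H$ ($\omega(g^{-1}xg)=\omega(x)$ for $g\in G$, $x\in H$). Choose an ordered basis of $(Z,\omega|_Z)$, extended to one of $(L,\omega|_L)$, extended to one of $(H,\omega)$, numbered so that $\{y_{e+1},\dots,y_d\}\subseteq\{y_{l+1},\dots,y_d\}\subseteq\{y_1,\dots,y_d\}$ are these bases of $Z$, $L$, $H$ respectively ($0<l\le e<d$). $\omega$ is chosen so that $\omega(y_1)=\dots=\omega(y_l)=:t$ and $\omega(\ell)>t$ for all $\ell\in L$. The images $y_1L,\dots,y_lL$ form a $\mathbb{Z}_p$-module basis of $H/L$, and $L$ is characteristic in $H$, so $\sigma$ induces an automorphism of $H/L\cong\mathbb{Z}_p^l$. By a theorem of Ardakov, $P=\mathfrak pkH$ for a prime ideal $\mathfrak p$ of $kZ$. $Q'$ is the field of fractions of $kZ/\mathfrak p$ and $Q=Q'\otimes_{kZ}kH$, the localisation of $kH/P$ at $(kZ/\mathfrak p)\setminus\{0\}$. $w$ is the valuation on $kH$ given by $w(\sum_{\alpha\in\mathbb{N}^d}\lambda_\alpha\mathbf b^\alpha)=\inf\{\sum_i\alpha_i\omega(y_i):\lambda_\alpha\ne0\}$,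 where $\lambda_\alpha\in k$, $b_i=y_i-1$, $\mathbf b^\alpha=b_1^{\alpha_1}\cdots b_d^{\alpha_d}$. Write $c_j$ for the image of $b_j$ in $kH/P$ ($1\le j\le e$). Elements of $Q$ are uniquely $\sum_{\gamma\in\mathbb{N}^e}r_\gamma\mathbf c^\gamma$ with $r_\gamma\in Q'$, $\mathbf c^\gamma=c_1^{\gamma_1}\cdots c_e^{\gamma_e}$; put $w(\mathbf c^\gamma):=w(b_1^{\gamma_1}\cdots b_e^{\gamma_e})$. By Ardakov, there is a valuation $v_1$ on $Q'$ with $v_1(x+\mathfrak p)\ge w(x)$ for all $x\in kZ$, such that $f_1(\sum r_\gamma\mathbf c^\gamma)=\inf_\gamma\{v_1(r_\gamma)+w(\mathbf c^\gamma)\}$ is a valuation on $Q$ and $\mathrm{gr}_{f_1}(kH/P)\cong(\mathrm{gr}_{v_1}(kZ/\mathfrak p))[Y_1,\dots,Y_e]$ is a commutative domain; fix it. $\{v_1,\dots,v_s\}$ is the orbit of $v_1$ under the action $(g\cdot u)(x)=u(g^{-1}xg)$ of $F$ on valuations of $Q'$; $f_i(\sum r_\gamma\mathbf c^\gamma)=\inf_\gamma\{v_i(r_\gamma)+w(\mathbf c^\gamma)\}$, and $f=\inf_{1\le i\le s}f_i$. For a fixed crossed product decomposition $kG/PkG=(kH/P)*F$ extended to $Q*F$, the filtration $\hat f$ on $Q*F$ is $\hat f(\sum_{g\in F}\bar g x_g)=\inf_g f(x_g)$ ($x_g\in Q$, $\bar g$ the basis elements of the crossed product), so $\hat f|_Q=f$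 and $\mathrm{gr}_f(Q)\subseteq\mathrm{gr}_{\hat f}(Q*F)$. $Y_j$ denotes the principal symbol of $c_j$, so that $Y_j$ is fixed by the automorphism induced by $\sigma$ if and only if $f(\sigma(c_j)-c_j)>f(c_j)$.
   Formalization: The final clause is proved for the automorphism of H/L induced by σ (for p>2 it has finite order iff it is the identity on H/L), since for σ itself on H it is false: on Heis(Z_p)×⟨z⟩ with P=0, the map inverting z and fixing the Heisenberg factor has order 2. *)

theory Defs
  imports "HOL-Analysis.Function_Topology" "HOL-Analysis.T1_Spaces"
    "HOL-Library.Extended_Real" "HOL-Algebra.Algebra"
begin

section \<open>Multi-indices and polynomial rings\<close>

definition multi_idx :: "nat set \<Rightarrow> (nat \<Rightarrow> nat) set" where
  "multi_idx I = {\<alpha>. \<forall>i. i \<notin> I \<longrightarrow> \<alpha> i = 0}"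

text \<open>The product is taken in the order of the list, as the rings are not commutative.\<close>

definition monom_prod :: "('a, 'm) ring_scheme \<Rightarrow> (nat \<Rightarrow> 'a) \<Rightarrow> nat list \<Rightarrow> (nat \<Rightarrow> nat) \<Rightarrow> 'a" where
  "monom_prod R b xs \<alpha> = foldr (\<lambda>i m. (b i [^]\<^bsub>R\<^esub> \<alpha> i) \<otimes>\<^bsub>R\<^esub> m) xs \<one>\<^bsub>R\<^esub>"

definition mpoly_ring :: "('a, 'm) ring_scheme \<Rightarrow> nat set \<Rightarrow> ((nat \<Rightarrow> nat) \<Rightarrow> 'a) ring" where
  "mpoly_ring R I =
    \<lparr>carrier = {a. (\<forall>\<alpha>. a \<alpha> \<in> carrier R) \<and> (\<forall>\<alpha>. \<alpha> \<notin> multi_idx I \<longrightarrow> a \<alpha> = \<zero>\<^bsub>R\<^esub>)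
        \<and> finite {\<alpha>. a \<alpha> \<noteq> \<zero>\<^bsub>R\<^esub>}},
     monoid.mult = (\<lambda>a b \<alpha>. \<Oplus>\<^bsub>R\<^esub>\<beta>\<in>{\<beta> \<in> multi_idx I. \<forall>i. \<beta> i \<le> \<alpha> i}. a \<beta> \<otimes>\<^bsub>R\<^esub> b (\<lambda>i. \<alpha> i - \<beta> i)),
     one = (\<lambda>\<alpha>. if \<alpha> = (\<lambda>_. 0) then \<one>\<^bsub>R\<^esub> else \<zero>\<^bsub>R\<^esub>),
     ring.zero = (\<lambda>_. \<zero>\<^bsub>R\<^esub>),
     add = (\<lambda>a b \<alpha>. a \<alpha> \<oplus>\<^bsub>R\<^esub> b \<alpha>)\<rparr>"

definition mpoly_const :: "('a, 'm) ring_scheme \<Rightarrow> 'a \<Rightarrow> (nat \<Rightarrow> nat) \<Rightarrow> 'a" where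
  "mpoly_const R a = (\<lambda>\<alpha>. if \<alpha> = (\<lambda>_. 0) then a else \<zero>\<^bsub>R\<^esub>)"

definition mpoly_var :: "('a, 'm) ring_scheme \<Rightarrow> nat \<Rightarrow> (nat \<Rightarrow> nat) \<Rightarrow> 'a" where
  "mpoly_var R j = (\<lambda>\<alpha>. if \<alpha> = (\<lambda>_. 0)(j := 1) then \<one>\<^bsub>R\<^esub> else \<zero>\<^bsub>R\<^esub>)"


section \<open>The p-adic integers\<close>

text \<open>A $p$-adic integer is the compatible sequence of its residues modulo $p^n$,
  each represented in $\{0, \dots, p^n - 1\}$.\<close>

definition padic_ints :: "nat \<Rightarrow> (nat \<Rightarrow> nat) set" where
  "padic_ints p = {x. \<forall>n. x n < p ^ n \<and> x (Suc n) mod p ^ n = x n}"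

definition Zp :: "nat \<Rightarrow> (nat \<Rightarrow> nat) ring" where
  "Zp p =\<lparr>carrier = padic_ints p,
     monoid.mult = (\<lambda>x y n. (x n * y n) mod p ^ n),
     one = (\<lambda>n. 1 mod p ^ n),
     ring.zero = (\<lambda>_. 0),
     add = (\<lambda>x y n. (x n + y n) mod p ^ n)\<rparr>"

definition padic_val :: "(nat \<Rightarrow> nat) \<Rightarrow> ereal" where
  "padic_val x = (SUP n\<in>{n. x n = 0}. ereal (real n))"

definition Zp_top :: "nat \<Rightarrow> (nat \<Rightarrow> nat) topology" where
  "Zp_top p = subtopology (product_topology (\<lambda>_. discrete_topology UNIV) UNIV) (padic_ints p)"

definition Zp_mats :: "nat \<Rightarrow> nat \<Rightarrow> (nat \<Rightarrow> nat \<Rightarrow> nat \<Rightarrow> nat) set" where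
  "Zp_mats p l = {M. \<forall>i\<in>{1..l}. \<forall>j\<in>{1..l}. M i j \<in> carrier (Zp p)}"

definition Zp_GL :: "nat \<Rightarrow> nat \<Rightarrow> (nat \<Rightarrow> nat \<Rightarrow> nat \<Rightarrow> nat) set" where
  "Zp_GL p l = {M \<in> Zp_mats p l. \<exists>N\<in>Zp_mats p l. \<forall>i\<in>{1..l}. \<forall>j\<in>{1..l}.
     (\<Oplus>\<^bsub>Zp p\<^esub>k\<in>{1..l}. M i k \<otimes>\<^bsub>Zp p\<^esub> N k j) = (if i = j then \<one>\<^bsub>Zp p\<^esub> else \<zero>\<^bsub>Zp p\<^esub>) \<and>
     (\<Oplus>\<^bsub>Zp p\<^esub>k\<in>{1..l}. N i k \<otimes>\<^bsub>Zp p\<^esub> M k j) = (if i = j then \<one>\<^bsub>Zp p\<^esub> else \<zero>\<^bsub>Zp p\<^esub>)}"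


section \<open>Compact p-adic analytic groups\<close>

definition topological_group :: "('g, 'm) monoid_scheme \<Rightarrow> 'g topology \<Rightarrow> bool" where
  "topological_group G T \<longleftrightarrow> group G \<and> topspace T = carrier G
     \<and> continuous_map (prod_topology T T) T (\<lambda>(x, y). x \<otimes>\<^bsub>G\<^esub> y)
     \<and> continuous_map T T (\<lambda>x. inv\<^bsub>G\<^esub> x)"

definition Zpn :: "nat \<Rightarrow> nat \<Rightarrow> (nat \<Rightarrow> nat \<Rightarrow> nat) set" where
  "Zpn p n = {..<n} \<rightarrow>\<^sub>E padic_ints p"

definition Zpn_top :: "nat \<Rightarrow> nat \<Rightarrow> (nat \<Rightarrow> nat \<Rightarrow> nat) topology" where
  "Zpn_top p n = product_topology (\<lambda>_. Zp_top p) {..<n}"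

text \<open>A map from $V \subseteq \mathbb{Z}_p^n$ to $\mathbb{Z}_p^m$ is analytic if, for each $y \in V$
  and each coordinate $i$, there are $h$ and a power series $F$ over $\mathbb{Q}_p$, convergent on
  $\mathbb{Z}_p^n$, with $f_i(y + p^h x) = F(x)$ for all $x \in \mathbb{Z}_p^n$. The coefficients of
  $F$ tend to $0$, so $F = p^{-r} \sum_\alpha a_\alpha X^\alpha$ with
  $a_\alpha \in \mathbb{Z}_p$ tending to $0$; the identity is written out modulo every $p^N$.\<close>

definition padic_analytic_on ::
  "nat \<Rightarrow> nat \<Rightarrow> nat \<Rightarrow> (nat \<Rightarrow> nat \<Rightarrow> nat) set \<Rightarrow> ((nat \<Rightarrow> nat \<Rightarrow> nat) \<Rightarrow> nat \<Rightarrow> nat \<Rightarrow> nat) \<Rightarrow> bool" where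
  "padic_analytic_on p n m V f \<longleftrightarrow> (\<forall>y\<in>V. \<forall>i<m. \<exists>h r. \<exists>a :: (nat \<Rightarrow> nat) \<Rightarrow> nat \<Rightarrow> nat.
     (\<forall>\<alpha>\<in>multi_idx {..<n}. a \<alpha> \<in> padic_ints p)
     \<and> (\<forall>N. finite {\<alpha> \<in> multi_idx {..<n}. a \<alpha> N \<noteq> 0})
     \<and> (\<forall>x\<in>Zpn p n. let z = (\<lambda>j\<in>{..<n}. \<lambda>N. (y j N + p ^ h * x j N) mod p ^ N) in
          z \<in> V \<and> (\<forall>N. (p ^ r * f z i N) mod p ^ N =
            (\<Sum>\<alpha> | \<alpha> \<in> multi_idx {..<n} \<and> a \<alpha> N \<noteq> 0. a \<alpha> N * (\<Prod>j<n. x j N ^ \<alpha> j)) mod p ^ N)))"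

type_synonym 'g padic_chart = "nat \<times> 'g set \<times> ('g \<Rightarrow> nat \<Rightarrow> nat \<Rightarrow> nat)"

definition padic_atlas :: "nat \<Rightarrow> 'g topology \<Rightarrow> 'g padic_chart set \<Rightarrow> bool" where
  "padic_atlas p T A \<longleftrightarrow>
     (\<forall>(n, U, \<phi>)\<in>A. openin T U \<and> (\<exists>V. openin (Zpn_top p n) V \<and>
        homeomorphic_map (subtopology T U) (subtopology (Zpn_top p n) V) \<phi>))
     \<and> (\<forall>(n, U, \<phi>)\<in>A. \<forall>(m, V, \<psi>)\<in>A. padic_analytic_on p n m (\<phi> ` (U \<inter> V)) (\<psi> \<circ> inv_into U \<phi>))
     \<and> topspace T = (\<Union>(n, U, \<phi>)\<in>A. U)"

definition padic_analytic_group :: "nat \<Rightarrow> ('g, 'm) monoid_scheme \<Rightarrow> 'g topology \<Rightarrow> bool" where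
  "padic_analytic_group p G T \<longleftrightarrow> topological_group G T \<and> (\<exists>A. padic_atlas p T A
     \<and> (\<forall>(n1, U1, \<phi>1)\<in>A. \<forall>(n2, U2, \<phi>2)\<in>A. \<forall>(n3, U3, \<phi>3)\<in>A.
          let mul = (\<lambda>z. inv_into U1 \<phi>1 (restrict z {..<n1})
                        \<otimes>\<^bsub>G\<^esub> inv_into U2 \<phi>2 (\<lambda>i\<in>{..<n2}. z (n1 + i)))
          in padic_analytic_on p (n1 + n2) n3
               {z \<in> Zpn p (n1 + n2). restrict z {..<n1} \<in> \<phi>1 ` U1
                  \<and> (\<lambda>i\<in>{..<n2}. z (n1 + i)) \<in> \<phi>2 ` U2 \<and> mul z \<in> U3} (\<phi>3 \<circ> mul))
     \<and> (\<forall>(n1, U1, \<phi>1)\<in>A. \<forall>(n2, U2, \<phi>2)\<in>A.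
          padic_analytic_on p n1 n2 {z \<in> \<phi>1 ` U1. inv\<^bsub>G\<^esub> (inv_into U1 \<phi>1 z) \<in> U2}
            (\<lambda>z. \<phi>2 (inv\<^bsub>G\<^esub> (inv_into U1 \<phi>1 z)))))"

definition compact_padic_analytic_group :: "nat \<Rightarrow> ('g, 'm) monoid_scheme \<Rightarrow> 'g topology \<Rightarrow> bool" where
  "compact_padic_analytic_group p G T \<longleftrightarrow>
     padic_analytic_group p G T \<and> compact_space T \<and> Hausdorff_space T"


section \<open>Group theory\<close>

definition commutator :: "('g, 'm) monoid_scheme \<Rightarrow> 'g \<Rightarrow> 'g \<Rightarrow> 'g" where
  "commutator G x y = inv\<^bsub>G\<^esub> x \<otimes>\<^bsub>G\<^esub> inv\<^bsub>G\<^esub> y \<otimes>\<^bsub>G\<^esub> x \<otimes>\<^bsub>G\<^esub> y"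

primrec lower_central :: "('g, 'm) monoid_scheme \<Rightarrow> nat \<Rightarrow> 'g set" where
  "lower_central G 0 = carrier G"
| "lower_central G (Suc n) =
     generate G {commutator G x y | x y. x \<in> lower_central G n \<and> y \<in> carrier G}"

definition nilpotent_group :: "('g, 'm) monoid_scheme \<Rightarrow> bool" where
  "nilpotent_group G \<longleftrightarrow> group G \<and> (\<exists>n. lower_central G n = {\<one>\<^bsub>G\<^esub>})"

definition nilpotent_by_finite :: "('g, 'm) monoid_scheme \<Rightarrow> bool" where
  "nilpotent_by_finite G \<longleftrightarrow>
     (\<exists>N. N \<lhd> G \<and> nilpotent_group (G\<lparr>carrier := N\<rparr>) \<and> finite (carrier (G Mod N)))"

definition group_center :: "('g, 'm) monoid_scheme \<Rightarrow> 'g set" where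
  "group_center G = {z \<in> carrier G. \<forall>x\<in>carrier G. z \<otimes>\<^bsub>G\<^esub> x = x \<otimes>\<^bsub>G\<^esub> z}"

definition delta_plus :: "('g, 'm) monoid_scheme \<Rightarrow> 'g set" where
  "delta_plus G = {x \<in> carrier G. (\<exists>n::nat. n > 0 \<and> x [^]\<^bsub>G\<^esub> n = \<one>\<^bsub>G\<^esub>)
     \<and> finite {inv\<^bsub>G\<^esub> g \<otimes>\<^bsub>G\<^esub> x \<otimes>\<^bsub>G\<^esub> g | g. g \<in> carrier G}}"

definition p_valuation :: "nat \<Rightarrow> ('g, 'm) monoid_scheme \<Rightarrow> ('g \<Rightarrow> ereal) \<Rightarrow> bool" where
  "p_valuation p G \<omega> \<longleftrightarrow>
     (\<forall>x\<in>carrier G. \<forall>y\<in>carrier G. min (\<omega> x) (\<omega> y) \<le> \<omega> (x \<otimes>\<^bsub>G\<^esub> inv\<^bsub>G\<^esub> y)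
        \<and> \<omega> x + \<omega> y \<le> \<omega> (commutator G x y))
     \<and> (\<forall>x\<in>carrier G. (\<omega> x = \<infinity> \<longleftrightarrow> x = \<one>\<^bsub>G\<^esub>) \<and> ereal (1 / (real p - 1)) < \<omega> x
        \<and> \<omega> (x [^]\<^bsub>G\<^esub> p) = \<omega> x + 1)"

definition p_val_complete :: "('g, 'm) monoid_scheme \<Rightarrow> ('g \<Rightarrow> ereal) \<Rightarrow> bool" where
  "p_val_complete G \<omega> \<longleftrightarrow> (\<forall>x :: nat \<Rightarrow> 'g. (\<forall>n. x n \<in> carrier G) \<longrightarrow>
     (\<forall>r::real. \<exists>N. \<forall>m\<ge>N. \<forall>n\<ge>N. ereal r \<le> \<omega> (inv\<^bsub>G\<^esub> (x m) \<otimes>\<^bsub>G\<^esub> x n)) \<longrightarrow>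
     (\<exists>a\<in>carrier G. \<forall>r::real. \<exists>N. \<forall>n\<ge>N. ereal r \<le> \<omega> (inv\<^bsub>G\<^esub> a \<otimes>\<^bsub>G\<^esub> x n)))"

text \<open>The rank of $(G, \omega)$ is the rank of the free $\mathbb{F}_p[\pi]$-module
  $\mathrm{gr}\, G$, where $\pi$ is induced by $x \mapsto x^p$. It is finite iff $\mathrm{gr}\, G$ is
  generated by the symbols of a finite set $Y$: in degree $\omega(x)$ the submodule they generate is
  the image of the subgroup generated by those $y^{p^n}$ with $\omega(y) + n = \omega(x)$.\<close>

definition p_val_finite_rank :: "nat \<Rightarrow> ('g, 'm) monoid_scheme \<Rightarrow> ('g \<Rightarrow> ereal) \<Rightarrow> bool" where
  "p_val_finite_rank p G \<omega> \<longleftrightarrow> (\<exists>Y. finite Y \<and> Y \<subseteq> carrier G \<and>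
     (\<forall>x\<in>carrier G - {\<one>\<^bsub>G\<^esub>}.
        \<exists>h\<in>generate G {y [^]\<^bsub>G\<^esub> (p ^ n) | y n. y \<in> Y \<and> \<omega> y + ereal (real n) = \<omega> x}.
          \<omega> x < \<omega> (inv\<^bsub>G\<^esub> x \<otimes>\<^bsub>G\<^esub> h)))"

definition p_valuable :: "nat \<Rightarrow> ('g, 'm) monoid_scheme \<Rightarrow> bool" where
  "p_valuable p G \<longleftrightarrow> (\<exists>\<omega>. p_valuation p G \<omega> \<and> p_val_complete G \<omega> \<and> p_val_finite_rank p G \<omega>)"

definition FNp_class :: "nat \<Rightarrow> ('g, 'm) monoid_scheme \<Rightarrow> 'g topology \<Rightarrow> 'g set set" where
  "FNp_class p G T = {N. N \<lhd> G \<and> closedin T N \<and> delta_plus G \<subseteq> N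
     \<and> nilpotent_group (G\<lparr>carrier := N\<rparr> Mod delta_plus G)
     \<and> p_valuable p (G\<lparr>carrier := N\<rparr> Mod delta_plus G)}"

definition is_FNp :: "nat \<Rightarrow> ('g, 'm) monoid_scheme \<Rightarrow> 'g topology \<Rightarrow> 'g set \<Rightarrow> bool" where
  "is_FNp p G T H \<longleftrightarrow> H \<in> FNp_class p G T \<and> (\<forall>N\<in>FNp_class p G T. N \<subseteq> H)"

definition isolated_normal :: "('g, 'm) monoid_scheme \<Rightarrow> 'g topology \<Rightarrow> 'g set \<Rightarrow> bool" where
  "isolated_normal H T N \<longleftrightarrow> N \<lhd> H \<and> closedin T N
     \<and> (\<forall>C\<in>carrier (H Mod N). \<forall>n::nat. n > 0 \<longrightarrow> C [^]\<^bsub>H Mod N\<^esub> n = \<one>\<^bsub>H Mod N\<^esub> \<longrightarrow> C = \<one>\<^bsub>H Mod N\<^esub>)"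

text \<open>An intersection of closed isolated normal subgroups is again one, so this is the smallest
  one containing \<open>A\<close>.\<close>

definition isolated_hull :: "('g, 'm) monoid_scheme \<Rightarrow> 'g topology \<Rightarrow> 'g set \<Rightarrow> 'g set" where
  "isolated_hull H T A = \<Inter> {N. isolated_normal H T N \<and> A \<subseteq> N}"

definition induces_topology :: "('g, 'm) monoid_scheme \<Rightarrow> 'g topology \<Rightarrow> ('g \<Rightarrow> ereal) \<Rightarrow> bool" where
  "induces_topology H T \<omega> \<longleftrightarrow>
     (\<forall>r::real. openin T {x \<in> carrier H. ereal r \<le> \<omega> x})
     \<and> (\<forall>U. openin T U \<and> \<one>\<^bsub>H\<^esub> \<in> U \<longrightarrow> (\<exists>r::real. {x \<in> carrier H. ereal r \<le> \<omega> x} \<subseteq> U))"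

definition zp_pow :: "('g, 'm) monoid_scheme \<Rightarrow> 'g topology \<Rightarrow> 'g \<Rightarrow> (nat \<Rightarrow> nat) \<Rightarrow> 'g" where
  "zp_pow G T g a = (THE z. limitin T (\<lambda>n. g [^]\<^bsub>G\<^esub> a n) z sequentially)"

definition zp_prod ::
  "('g, 'm) monoid_scheme \<Rightarrow> 'g topology \<Rightarrow> (nat \<Rightarrow> 'g) \<Rightarrow> nat list \<Rightarrow> (nat \<Rightarrow> nat \<Rightarrow> nat) \<Rightarrow> 'g" where
  "zp_prod G T y xs a = foldr (\<lambda>i g. zp_pow G T (y i) (a i) \<otimes>\<^bsub>G\<^esub> g) xs \<one>\<^bsub>G\<^esub>"

definition ordered_basis ::
  "nat \<Rightarrow> ('g, 'm) monoid_scheme \<Rightarrow> 'g topology \<Rightarrow> ('g \<Rightarrow> ereal) \<Rightarrow> (nat \<Rightarrow> 'g) \<Rightarrow> nat list \<Rightarrow> bool" where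
  "ordered_basis p G T \<omega> y xs \<longleftrightarrow> y ` set xs \<subseteq> carrier G
     \<and> (\<forall>a\<in>set xs \<rightarrow>\<^sub>E padic_ints p. zp_prod G T y xs a \<in> carrier G
          \<and> \<omega> (zp_prod G T y xs a) = (INF i\<in>set xs. \<omega> (y i) + padic_val (a i)))
     \<and> (\<forall>x\<in>carrier G. \<exists>!a. a \<in> set xs \<rightarrow>\<^sub>E padic_ints p \<and> x = zp_prod G T y xs a)"


section \<open>Completed group rings\<close>

definition finite_group_algebra :: "('a, 'm) monoid_scheme \<Rightarrow> ('a \<Rightarrow> 'k::field) ring" where
  "finite_group_algebra A =
    \<lparr>carrier = {x. \<forall>a. a \<notin> carrier A \<longrightarrow> x a = 0},
     monoid.mult = (\<lambda>x y a. if a \<in> carrier A then \<Sum>b\<in>carrier A. x b * y (inv\<^bsub>A\<^esub> b \<otimes>\<^bsub>A\<^esub> a) else 0),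
     one = (\<lambda>a. if a = \<one>\<^bsub>A\<^esub> then 1 else 0),
     ring.zero = (\<lambda>_. 0),
     add = (\<lambda>x y a. x a + y a)\<rparr>"

definition open_normals :: "('g, 'm) monoid_scheme \<Rightarrow> 'g topology \<Rightarrow> 'g set set" where
  "open_normals G T = {N. N \<lhd> G \<and> openin T N}"

text \<open>$kG = \varprojlim k[G/N]$ over the open normal subgroups $N$: an element is the family of its
  images \<open>\<mu> N\<close> in $k[G/N]$, set to $0$ at all other sets \<open>N\<close>. It is meant for compact \<open>G\<close>,
  where all $G/N$ are finite.\<close>

type_synonym ('g, 'k) cgr = "'g set \<Rightarrow> 'g set \<Rightarrow> 'k"

definition completed_group_ring :: "('g, 'm) monoid_scheme \<Rightarrow> 'g topology \<Rightarrow> ('g, 'k::field) cgr ring" where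
  "completed_group_ring G T =
    \<lparr>carrier = {\<mu>. (\<forall>N. N \<notin> open_normals G T \<longrightarrow> \<mu> N = (\<lambda>_. 0))
        \<and> (\<forall>N\<in>open_normals G T. \<mu> N \<in> carrier (finite_group_algebra (G Mod N)))
        \<and> (\<forall>N\<in>open_normals G T. \<forall>M\<in>open_normals G T. N \<subseteq> M \<longrightarrow>
             (\<forall>C\<in>carrier (G Mod M). \<mu> M C = (\<Sum>D | D \<in> carrier (G Mod N) \<and> D \<subseteq> C. \<mu> N D)))},
     monoid.mult = (\<lambda>\<mu> \<nu> N. if N \<in> open_normals G T
        then \<mu> N \<otimes>\<^bsub>finite_group_algebra (G Mod N)\<^esub> \<nu> N else (\<lambda>_. 0)),
     one = (\<lambda>N. if N \<in> open_normals G T then \<one>\<^bsub>finite_group_algebra (G Mod N)\<^esub> else (\<lambda>_. 0)),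
     ring.zero = (\<lambda>_ _. 0),
     add = (\<lambda>\<mu> \<nu> N C. \<mu> N C + \<nu> N C)\<rparr>"

definition cgr_of :: "('g, 'm) monoid_scheme \<Rightarrow> 'g topology \<Rightarrow> 'g \<Rightarrow> ('g, 'k::field) cgr" where
  "cgr_of G T g = (\<lambda>N C. if N \<in> open_normals G T \<and> C = N #>\<^bsub>G\<^esub> g then 1 else 0)"

text \<open>The ring homomorphism $kA \to kB$ induced by a continuous homomorphism $\phi : A \to B$.\<close>

definition cgr_map ::
  "('a, 'm) monoid_scheme \<Rightarrow> ('b, 'n) monoid_scheme \<Rightarrow> 'b topology \<Rightarrow> ('a \<Rightarrow> 'b)
     \<Rightarrow> ('a, 'k::field) cgr \<Rightarrow> ('b, 'k) cgr" where
  "cgr_map A B TB \<phi> \<mu> = (\<lambda>N C. if N \<in> open_normals B TB \<and> C \<in> carrier (B Mod N)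
     then let K = {a \<in> carrier A. \<phi> a \<in> N}
          in \<Sum>D | D \<in> carrier (A Mod K) \<and> \<phi> ` D \<subseteq> C. \<mu> K D
     else 0)"

text \<open>\<open>s\<close> is the sum of the family \<open>x\<close> in the inverse limit topology, each $k[G/N]$ being discrete.\<close>

definition cgr_has_sum ::
  "('g, 'm) monoid_scheme \<Rightarrow> 'g topology \<Rightarrow> 'i set \<Rightarrow> ('i \<Rightarrow> ('g, 'k::field) cgr) \<Rightarrow> ('g, 'k) cgr \<Rightarrow> bool" where
  "cgr_has_sum G T I x s \<longleftrightarrow> s \<in> carrier (completed_group_ring G T) \<and> (\<forall>N\<in>open_normals G T.
     finite {i \<in> I. x i N \<noteq> (\<lambda>_. 0)} \<and>
     (\<forall>C. s N C = (\<Sum>i | i \<in> I \<and> x i N \<noteq> (\<lambda>_. 0). x i N C)))"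


section \<open>Ring theory\<close>

text \<open>The library's \<open>primeideal\<close> covers commutative rings only.\<close>

definition nc_prime_ideal :: "'a set \<Rightarrow> ('a, 'm) ring_scheme \<Rightarrow> bool" where
  "nc_prime_ideal P R \<longleftrightarrow> ideal P R \<and> P \<noteq> carrier R
     \<and> (\<forall>I J. ideal I R \<longrightarrow> ideal J R \<longrightarrow> I \<cdot>\<^bsub>R\<^esub> J \<subseteq> P \<longrightarrow> I \<subseteq> P \<or> J \<subseteq> P)"

text \<open>\<open>Q\<close> is the (right) localisation of \<open>R\<close> at \<open>M\<close>, by the ring homomorphism \<open>\<iota>\<close>.\<close>

definition is_localisation ::
  "('a, 'm) ring_scheme \<Rightarrow> 'a set \<Rightarrow> ('b, 'n) ring_scheme \<Rightarrow> ('a \<Rightarrow> 'b) \<Rightarrow> bool" where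
  "is_localisation R M Q \<iota> \<longleftrightarrow> ring R \<and> ring Q \<and> M \<subseteq> carrier R \<and> \<iota> \<in> ring_hom R Q
     \<and> (\<forall>m\<in>M. \<iota> m \<in> Units Q)
     \<and> (\<forall>q\<in>carrier Q. \<exists>r\<in>carrier R. \<exists>m\<in>M. q = \<iota> r \<otimes>\<^bsub>Q\<^esub> inv\<^bsub>Q\<^esub> (\<iota> m))
     \<and> (\<forall>r\<in>carrier R. \<iota> r = \<zero>\<^bsub>Q\<^esub> \<longleftrightarrow> (\<exists>m\<in>M. r \<otimes>\<^bsub>R\<^esub> m = \<zero>\<^bsub>R\<^esub>))"

text \<open>\<open>S\<close> is a crossed product of its subring \<open>R\<close> by the group \<open>F\<close>, with basis elements \<open>bar g\<close>.\<close>

definition crossed_product ::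
  "('s, 'm) ring_scheme \<Rightarrow> 's set \<Rightarrow> ('f, 'n) monoid_scheme \<Rightarrow> ('f \<Rightarrow> 's) \<Rightarrow> bool" where
  "crossed_product S R F bar \<longleftrightarrow> ring S \<and> subring R S \<and> group F
     \<and> (\<forall>g\<in>carrier F. bar g \<in> Units S) \<and> bar \<one>\<^bsub>F\<^esub> = \<one>\<^bsub>S\<^esub>
     \<and> (\<forall>s\<in>carrier S. \<exists>!x. x \<in> carrier F \<rightarrow>\<^sub>E R \<and> finite {g \<in> carrier F. x g \<noteq> \<zero>\<^bsub>S\<^esub>}
          \<and> s = (\<Oplus>\<^bsub>S\<^esub>g\<in>{g \<in> carrier F. x g \<noteq> \<zero>\<^bsub>S\<^esub>}. bar g \<otimes>\<^bsub>S\<^esub> x g))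
     \<and> (\<forall>g\<in>carrier F. bar g <#\<^bsub>S\<^esub> R = R #>\<^bsub>S\<^esub> bar g)
     \<and> (\<forall>g\<in>carrier F. \<forall>h\<in>carrier F.
          (bar g \<otimes>\<^bsub>S\<^esub> bar h) <#\<^bsub>S\<^esub> R = bar (g \<otimes>\<^bsub>F\<^esub> h) <#\<^bsub>S\<^esub> R)"

definition ring_filtration :: "('a, 'm) ring_scheme \<Rightarrow> ('a \<Rightarrow> ereal) \<Rightarrow> bool" where
  "ring_filtration R v \<longleftrightarrow> (\<forall>x\<in>carrier R. v x \<noteq> -\<infinity>)
     \<and> (\<forall>x\<in>carrier R. \<forall>y\<in>carrier R. min (v x) (v y) \<le> v (x \<oplus>\<^bsub>R\<^esub> y) \<and> v x + v y \<le> v (x \<otimes>\<^bsub>R\<^esub> y))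
     \<and> v \<zero>\<^bsub>R\<^esub> = \<infinity> \<and> v \<one>\<^bsub>R\<^esub> = 0"

definition ring_valuation :: "('a, 'm) ring_scheme \<Rightarrow> ('a \<Rightarrow> ereal) \<Rightarrow> bool" where
  "ring_valuation R v \<longleftrightarrow> ring_filtration R v
     \<and> (\<forall>x\<in>carrier R. \<forall>y\<in>carrier R. v (x \<otimes>\<^bsub>R\<^esub> y) = v x + v y)"

definition fil :: "('a, 'm) ring_scheme \<Rightarrow> ('a \<Rightarrow> ereal) \<Rightarrow> real \<Rightarrow> 'a set" where
  "fil R v r = {x \<in> carrier R. ereal r \<le> v x}"

definition fil_plus :: "('a, 'm) ring_scheme \<Rightarrow> ('a \<Rightarrow> ereal) \<Rightarrow> real \<Rightarrow> 'a set" where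
  "fil_plus R v r = {x \<in> carrier R. ereal r < v x}"

definition gr_piece :: "('a, 'm) ring_scheme \<Rightarrow> ('a \<Rightarrow> ereal) \<Rightarrow> real \<Rightarrow> 'a set monoid" where
  "gr_piece R v r = (add_monoid R)\<lparr>carrier := fil R v r\<rparr> Mod fil_plus R v r"

text \<open>The element of $\mathrm{gr}_v R$ concentrated in degree \<open>r\<close>, with value the class of \<open>x\<close>.\<close>

definition gr_class :: "('a, 'm) ring_scheme \<Rightarrow> ('a \<Rightarrow> ereal) \<Rightarrow> real \<Rightarrow> 'a \<Rightarrow> real \<Rightarrow> 'a set" where
  "gr_class R v r x = (\<lambda>\<mu>. if \<mu> = r then fil_plus R v r +>\<^bsub>R\<^esub> x else fil_plus R v \<mu>)"

definition gr :: "('a, 'm) ring_scheme \<Rightarrow> ('a \<Rightarrow> ereal) \<Rightarrow> (real \<Rightarrow> 'a set) ring" where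
  "gr R v =
    \<lparr>carrier = {a. (\<forall>r. a r \<in> carrier (gr_piece R v r)) \<and> finite {r. a r \<noteq> fil_plus R v r}},
     monoid.mult = (\<lambda>a b r. finprod (gr_piece R v r)
        (\<lambda>\<mu>. rcoset_mult R (fil_plus R v r) (a \<mu>) (b (r - \<mu>)))
        {\<mu>. a \<mu> \<noteq> fil_plus R v \<mu> \<and> b (r - \<mu>) \<noteq> fil_plus R v (r - \<mu>)}),
     one = gr_class R v 0 \<one>\<^bsub>R\<^esub>,
     ring.zero = fil_plus R v,
     add = (\<lambda>a b r. a r \<otimes>\<^bsub>gr_piece R v r\<^esub> b r)\<rparr>"

text \<open>If $v(x) = \infty$ this is the zero element of $\mathrm{gr}_v R$.\<close>

definition principal_symbol :: "('a, 'm) ring_scheme \<Rightarrow> ('a \<Rightarrow> ereal) \<Rightarrow> 'a \<Rightarrow> real \<Rightarrow> 'a set" where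
  "principal_symbol R v x = gr_class R v (real_of_ereal (v x)) x"

text \<open>The subring of $\mathrm{gr}_v S$ of the elements all of whose components are classes of elements
  of \<open>Q\<close>: the copy of $\mathrm{gr}_{v|_Q} Q$ inside $\mathrm{gr}_v S$.\<close>

definition gr_sub :: "('a, 'm) ring_scheme \<Rightarrow> ('a \<Rightarrow> ereal) \<Rightarrow> 'a set \<Rightarrow> (real \<Rightarrow> 'a set) ring" where
  "gr_sub S v Q = (gr S v)\<lparr>carrier := {a \<in> carrier (gr S v).
     \<forall>r. \<exists>q\<in>Q. ereal r \<le> v q \<and> a r = fil_plus S v r +>\<^bsub>S\<^esub> q}\<rparr>"

end

theory Submission
  imports Defs "HOL-Number_Theory.Cong" "HOL-Analysis.Abstract_Topological_Spaces"
begin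

text \<open>Since $Y_i$ is fixed, $\sigma(c_i) - c_i$ has value greater than $t = f(c_i)$. Write
  $\sigma(y_i) = y_1^{a_1} \cdots y_e^{a_e} z$ with $z \in Z$. The $p$-adic binomial series give
  $\sigma(y_i) - y_i = \sum_\gamma \bigl(\binom{a}{\gamma} z - \delta_{\gamma, 0} - \delta_{\gamma, \epsilon_i}\bigr)
  \mathbf b^\gamma$, and as $f \le f_1$ every term has $f_1$-value greater than $t$. The term $\gamma = 0$
  yields $v_1(z - 1) > 0$, the term $\gamma = \epsilon_m$ with $m \le l$ yields
  $v_1(a_m z - \delta_{mi}) > 0$. Hence $v_1(a_m - \delta_{mi}) > 0$ in the prime field, on which $v_1$
  is trivial, so $a_m \equiv \delta_{mi}$ modulo $p$.

  The group $H/L$ is abelian, torsion-free and has no nontrivial infinitely $p$-divisible elements, and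
  $\sigma$ acts on it as the identity modulo $p$; for odd $p$ such an automorphism of finite order is
  trivial.\<close>

section \<open>Matrices over the p-adic integers\<close>

text \<open>The obstacle is the central factor \<open>z\<close>. The coefficients read off from the
  expansion are not in the prime field, since each binomial coefficient comes multiplied by
  \<open>z\<close>; the term at \<open>\<gamma> = 0\<close> is what allows \<open>z\<close> to be
  replaced by 1. Leaving the coordinates beyond \<open>e\<close> unexpanded keeps \<open>z\<close> a
  single coefficient, and centrality moves it to the left of the ordered monomials, where the
  formula for \<open>fv\<close> expects it.

  The indices \<open>m \<le> l\<close> are singled out because there the monomial \<open>b m\<close>
  has \<open>w\<close>-value exactly \<open>t\<close>, so a total above \<open>t\<close> forces a
  positive value on the coefficient. For \<open>l < m \<le> e\<close> the element \<open>y m\<close>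
  lies in \<open>L\<close>, its value already exceeds \<open>t\<close>, and nothing follows; hence
  the conclusion concerns only the quotient by \<open>L\<close>.

  Infinite sums and p-adic exponents are handled one open normal subgroup \<open>N\<close> at a
  time: in \<open>k[H/N]\<close> only finitely many monomials survive, and characteristic
  \<open>p\<close> makes a binomial coefficient depend on its upper entry only through a residue
  modulo a power of \<open>p\<close>.\<close>

lemma Zp_simps [simp]:
  "carrier (Zp p) = padic_ints p"
  "\<one>\<^bsub>Zp p\<^esub> = (\<lambda>n. 1 mod p ^ n)"
  "\<zero>\<^bsub>Zp p\<^esub> = (\<lambda>_. 0)"
  "x \<otimes>\<^bsub>Zp p\<^esub> z = (\<lambda>n. (x n * z n) mod p ^ n)"
  "x \<oplus>\<^bsub>Zp p\<^esub> z = (\<lambda>n. (x n + z n) mod p ^ n)"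
  by (simp_all add: Zp_def)

lemma padic_ints_mod: "x \<in> padic_ints p \<Longrightarrow> x n mod p ^ n = x n"
  by (simp add: padic_ints_def)

lemma padic_ints_less: "x \<in> padic_ints p \<Longrightarrow> x n < p ^ n"
  by (simp add: padic_ints_def)

lemma padic_ints_Suc: "x \<in> padic_ints p \<Longrightarrow> x (Suc n) mod p ^ n = x n"
  by (simp add: padic_ints_def)

lemma padic_ints_le:
  assumes "x \<in> padic_ints p" "m \<le> n" shows "x n mod p ^ m = x m"
  using assms(2)
proof (induction n rule: dec_induct)
  case base then show ?case using assms by (simp add: padic_ints_mod)
next
  case (step n)
  have "x (Suc n) mod p ^ m = (x (Suc n) mod p ^ n) mod p ^ m"
    using step by (simp add: mod_mod_cancel le_imp_power_dvd)
  then show ?case using step assms by (simp add: padic_ints_Suc)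
qed

text \<open>For a sequence given by unreduced integers \<open>h n\<close>, compatibility has to be
  checked only up to congruence.\<close>

lemma padic_intsI:
  assumes "\<And>n. x n = h n mod p ^ n" "\<And>n. h (Suc n) mod p ^ n = h n mod p ^ n" "0 < p"
  shows "x \<in> padic_ints p"
  unfolding padic_ints_def
proof (intro CollectI allI conjI)
  fix n
  show "x n < p ^ n" using assms by simp
  have "x (Suc n) mod p ^ n = h (Suc n) mod p ^ n"
    unfolding assms(1)[of "Suc n"] by (rule mod_mod_cancel) (simp add: le_imp_power_dvd)
  then show "x (Suc n) mod p ^ n = x n" using assms by simp
qed

text \<open>The structure required by \<open>finsum_insert\<close>, by which the sums in
  \<open>Zp_GL\<close> are computed residue by residue.\<close>

lemma Zp_abelian_monoid:
  assumes "0 < p" shows "abelian_monoid (Zp p)"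
proof (rule abelian_monoidI)
  fix x z assume xz: "x \<in> carrier (Zp p)" "z \<in> carrier (Zp p)"
  show "x \<oplus>\<^bsub>Zp p\<^esub> z \<in> carrier (Zp p)"
    unfolding Zp_simps
    by (rule padic_intsI[OF refl _ assms]) (use xz in \<open>metis Zp_simps(1) mod_add_eq padic_ints_Suc\<close>)
next
  show "\<zero>\<^bsub>Zp p\<^esub> \<in> carrier (Zp p)" using assms by (auto simp: padic_ints_def)
qed (auto simp: fun_eq_iff mod_simps padic_ints_mod ac_simps)

lemma Zp_mult_closed:
  assumes "0 < p" "x \<in> padic_ints p" "z \<in> padic_ints p"
  shows "(\<lambda>n. (x n * z n) mod p ^ n) \<in> padic_ints p"
  by (rule padic_intsI[OF refl _ assms(1)]) (use assms in \<open>metis mod_mult_eq padic_ints_Suc\<close>)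

lemma Zp_finsum:
  assumes "0 < p" "finite I" "\<And>i. i \<in> I \<Longrightarrow> f i \<in> padic_ints p"
  shows "(\<Oplus>\<^bsub>Zp p\<^esub>i\<in>I. f i) = (\<lambda>n. (\<Sum>i\<in>I. f i n) mod p ^ n)"
  using assms(2,3)
proof (induction I rule: finite_induct)
  case empty
  interpret abelian_monoid "Zp p" by (rule Zp_abelian_monoid[OF assms(1)])
  show ?case using finsum_empty by simp
next
  case (insert i I)
  interpret abelian_monoid "Zp p" by (rule Zp_abelian_monoid[OF assms(1)])
  have "(\<Oplus>\<^bsub>Zp p\<^esub>j\<in>insert i I. f j) = f i \<oplus>\<^bsub>Zp p\<^esub> (\<Oplus>\<^bsub>Zp p\<^esub>j\<in>I. f j)"
    by (rule finsum_insert) (use insert in auto)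
  then show ?case using insert by (simp add: fun_eq_iff mod_add_right_eq)
qed

lemma Zp_add_pow:
  assumes "0 < p" "x \<in> padic_ints p"
  shows "[(k::nat)] \<cdot>\<^bsub>Zp p\<^esub> x = (\<lambda>n. (k * x n) mod p ^ n)"
proof (induction k)
  case 0 show ?case by (simp add: add_pow_def)
next
  case (Suc k)
  have "[Suc k] \<cdot>\<^bsub>Zp p\<^esub> x = ([k] \<cdot>\<^bsub>Zp p\<^esub> x) \<oplus>\<^bsub>Zp p\<^esub> x"
    by (simp add: add_pow_def nat_pow_def)
  then show ?case using Suc by (simp add: fun_eq_iff mod_simps ac_simps)
qed

text \<open>Truncated subtraction is harmless: the residues modulo $p^{n+1}$ of a $p$-adic integer are at
  least its residue modulo $p$.\<close>

definition padic_shift :: "nat \<Rightarrow> (nat \<Rightarrow> nat) \<Rightarrow> nat \<Rightarrow> nat" where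
  "padic_shift p a n = (a (Suc n) - a 1) div p"

text \<open>Division by \<open>p\<close> loses one digit: the quotient modulo \<open>p ^ n\<close>
  is determined by \<open>a\<close> modulo \<open>p ^ (n + 1)\<close>, whence the index
  \<open>Suc n\<close>.\<close>

lemma padic_shift_eq:
  assumes "0 < p" "a \<in> padic_ints p"
  shows "a (Suc n) = a 1 + p * padic_shift p a n"
proof -
  have m: "a (Suc n) mod p = a 1" using padic_ints_le[OF assms(2), of 1 "Suc n"] by simp
  then have "p dvd a (Suc n) - a 1" by (metis dvd_minus_mod)
  moreover have "a 1 \<le> a (Suc n)" using m by (metis mod_less_eq_dividend)
  ultimately show ?thesis unfolding padic_shift_def by simp
qed

lemma padic_shift_closed:
  assumes "0 < p" "a \<in> padic_ints p"
  shows "padic_shift p a \<in> padic_ints p"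
  unfolding padic_ints_def
proof (intro CollectI allI conjI)
  fix n
  let ?s = "padic_shift p a"
  have e: "a (Suc n) = a 1 + p * ?s n" "a (Suc (Suc n)) = a 1 + p * ?s (Suc n)"
    by (rule padic_shift_eq[OF assms])+
  have "p * ?s n < p * p ^ n" using padic_ints_less[OF assms(2), of "Suc n"] e(1) unfolding power_Suc by linarith
  then show lt: "?s n < p ^ n" by simp
  have "[a 1 + p * ?s (Suc n) = a 1 + p * ?s n] (mod p * p ^ n)"
    unfolding e[symmetric] cong_def using padic_ints_Suc[OF assms(2), of "Suc n"] padic_ints_mod[OF assms(2), of "Suc n"]
    by simp
  then have "[p * ?s (Suc n) = p * ?s n] (mod p * p ^ n)" by (simp add: cong_add_lcancel_nat)
  then have "[?s (Suc n) = ?s n] (mod p ^ n)"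
    using assms(1) by (simp add: cong_def mult_mod_right[symmetric])
  then show "?s (Suc n) mod p ^ n = ?s n" using lt by (simp add: cong_def)
qed

definition unit_entry :: "nat \<Rightarrow> nat \<Rightarrow> nat" where
  "unit_entry i j = (if i = j then 1 else 0)"

text \<open>The inverse of \<open>1 - D\<close> with \<open>D\<close> divisible by \<open>p\<close> is the fixed point of the contraction
  $Y \mapsto 1 + DY$, iterated with \<open>D\<close> reduced modulo growing powers of \<open>p\<close>.\<close>

primrec neumann :: "(nat \<Rightarrow> nat \<Rightarrow> nat \<Rightarrow> int) \<Rightarrow> nat \<Rightarrow> nat \<Rightarrow> nat \<Rightarrow> nat \<Rightarrow> int" where
  "neumann D l 0 i j = 0"
| "neumann D l (Suc n) i j = int (unit_entry i j) + (\<Sum>m\<in>{1..l}. D (Suc n) i m * neumann D l n m j)"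

text \<open>The contraction estimate. Lowering the precision of \<open>D\<close> costs a multiple of
  \<open>p ^ (n + 1)\<close>; replacing an iterate by its predecessor costs a multiple of
  \<open>p ^ n\<close>, and this is multiplied by an entry of \<open>D\<close>, which contributes
  one more factor \<open>p\<close>.\<close>

lemma neumann_cong:
  fixes D :: "nat \<Rightarrow> nat \<Rightarrow> nat \<Rightarrow> int"
  assumes D: "\<And>n i m. i \<in> {1..l} \<Longrightarrow> m \<in> {1..l} \<Longrightarrow> [D (Suc n) i m = D n i m] (mod int p ^ n)"
    and Dp: "\<And>n i m. i \<in> {1..l} \<Longrightarrow> m \<in> {1..l} \<Longrightarrow> 0 < n \<Longrightarrow> int p dvd D n i m"
    and ij: "i \<in> {1..l}"
  shows "[neumann D l (Suc n) i j = neumann D l n i j] (mod int p ^ n)"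
  using ij
proof (induction n arbitrary: i)
  case 0 show ?case by (simp add: cong_def)
next
  case (Suc n)
  have "[D (Suc (Suc n)) i m * neumann D l (Suc n) m j = D (Suc n) i m * neumann D l n m j] (mod int p ^ Suc n)"
    if m: "m \<in> {1..l}" for m
  proof -
    have "[D (Suc (Suc n)) i m * neumann D l (Suc n) m j = D (Suc n) i m * neumann D l (Suc n) m j] (mod int p ^ Suc n)"
      by (rule cong_scalar_right[OF D[OF Suc.prems m]])
    moreover have "[D (Suc n) i m * neumann D l (Suc n) m j = D (Suc n) i m * neumann D l n m j] (mod int p ^ Suc n)"
    proof -
      have "int p * int p ^ n dvd D (Suc n) i m * (neumann D l (Suc n) m j - neumann D l n m j)"
        by (rule mult_dvd_mono[OF Dp[OF Suc.prems m]]) (use Suc.IH[OF m] in \<open>simp_all add: cong_iff_dvd_diff\<close>)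
      then show ?thesis by (simp add: cong_iff_dvd_diff right_diff_distrib)
    qed
    ultimately show ?thesis by (rule cong_trans)
  qed
  then have "[(\<Sum>m\<in>{1..l}. D (Suc (Suc n)) i m * neumann D l (Suc n) m j)
      = (\<Sum>m\<in>{1..l}. D (Suc n) i m * neumann D l n m j)] (mod int p ^ Suc n)"
    by (rule cong_sum)
  then show ?case
    unfolding neumann.simps(2)[of D l "Suc n"] neumann.simps(2)[of D l n] by (rule cong_add[OF cong_refl])
qed

text \<open>That the inverse is again the identity modulo \<open>p\<close> is recorded so that the
  lemma can be applied a second time, to the inverse itself.\<close>

lemma Zp_mat_right_inverse:
  assumes p: "0 < p"
    and M: "M \<in> Zp_mats p l" "\<And>i j. i \<in> {1..l} \<Longrightarrow> j \<in> {1..l} \<Longrightarrow> M i j 1 = unit_entry i j mod p"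
  obtains N where "N \<in> Zp_mats p l" "\<And>i j. i \<in> {1..l} \<Longrightarrow> j \<in> {1..l} \<Longrightarrow> N i j 1 = unit_entry i j mod p"
    "\<And>i j n. i \<in> {1..l} \<Longrightarrow> j \<in> {1..l} \<Longrightarrow>
        [(\<Sum>k\<in>{1..l}. int (M i k n) * int (N k j n)) = int (unit_entry i j)] (mod int p ^ n)"
proof -
  define D where "D = (\<lambda>n i j. int (unit_entry i j) - int (M i j n))"
  define Y where "Y = neumann D l"
  \<comment> \<open>The iterates can be negative integers, but their remainders modulo
    \<open>p ^ n\<close> are not, so \<open>nat\<close> loses nothing.\<close>
  define N where "N = (\<lambda>i j n. nat (Y n i j mod int p ^ n))"
  have MZ: "M i j \<in> padic_ints p" if "i \<in> {1..l}" "j \<in> {1..l}" for i j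
    using M(1) that by (simp add: Zp_mats_def)
  have D: "[D (Suc n) i m = D n i m] (mod int p ^ n)" if "i \<in> {1..l}" "m \<in> {1..l}" for n i m
  proof -
    have "[M i m (Suc n) = M i m n] (mod p ^ n)"
      using MZ[OF that] by (simp add: cong_def padic_ints_Suc padic_ints_mod)
    then have "[int (M i m (Suc n)) = int (M i m n)] (mod int p ^ n)"
      by (metis cong_int_iff of_nat_power)
    then show ?thesis unfolding D_def by (rule cong_diff[OF cong_refl])
  qed
  have Dp: "int p dvd D n i m" if "i \<in> {1..l}" "m \<in> {1..l}" "0 < n" for n i m
  proof -
    have "M i m n mod p = unit_entry i m mod p"
      using padic_ints_le[OF MZ[OF that(1,2)], of 1 n] that M(2)[OF that(1,2)] by simp
    then have "[int (unit_entry i m) = int (M i m n)] (mod int p)"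
      unfolding cong_int_iff by (simp add: cong_def)
    then show ?thesis by (simp add: D_def cong_iff_dvd_diff)
  qed
  have Yc: "[Y (Suc n) i j = Y n i j] (mod int p ^ n)" if "i \<in> {1..l}" for n i j
    unfolding Y_def by (rule neumann_cong[OF D Dp that])
  have intN: "int (N i j n) = Y n i j mod int p ^ n" for i j n
    using p by (simp add: N_def)
  have "N \<in> Zp_mats p l"
    unfolding Zp_mats_def
  proof (intro CollectI ballI)
    fix i j assume "i \<in> {1..l}" "j \<in> {1..l}"
    have "N i j (Suc n) mod p ^ n = N i j n" for n
    proof -
      have "int (N i j (Suc n) mod p ^ n) = (Y (Suc n) i j mod int p ^ Suc n) mod int p ^ n"
        by (simp add: zmod_int intN)
      also have "\<dots> = Y (Suc n) i j mod int p ^ n"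
        by (rule mod_mod_cancel) (simp add: le_imp_power_dvd)
      also have "\<dots> = int (N i j n)"
        using Yc[OF \<open>i \<in> {1..l}\<close>, of n j] by (simp add: intN cong_def)
      finally show ?thesis by linarith
    qed
    moreover have "N i j n < p ^ n" for n
    proof -
      have "int (N i j n) < int (p ^ n)" using p by (simp add: intN)
      then show ?thesis by linarith
    qed
    ultimately show "N i j \<in> carrier (Zp p)" by (simp add: padic_ints_def)
  qed
  moreover have "N i j 1 = unit_entry i j mod p" for i j
  proof -
    have "Y 1 i j = int (unit_entry i j)" by (simp add: Y_def)
    then have "int (N i j 1) = int (unit_entry i j mod p)" by (simp add: intN zmod_int)
    then show ?thesis by linarith
  qed
  moreover have "[(\<Sum>k\<in>{1..l}. int (M i k n) * int (N k j n)) = int (unit_entry i j)] (mod int p ^ n)"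
    if ij: "i \<in> {1..l}" "j \<in> {1..l}" for i j n
  proof -
    have "[(\<Sum>k\<in>{1..l}. int (M i k n) * int (N k j n)) = (\<Sum>k\<in>{1..l}. int (M i k n) * Y n k j)] (mod int p ^ n)"
      by (intro cong_sum cong_mult cong_refl) (simp add: intN cong_def)
    moreover have "(\<Sum>k\<in>{1..l}. int (M i k n) * Y n k j) = Y n i j - (\<Sum>k\<in>{1..l}. D n i k * Y n k j)"
    proof -
      have "(\<Sum>k\<in>{1..l}. int (M i k n) * Y n k j)
          = (\<Sum>k\<in>{1..l}. (if k = i then Y n k j else 0) - D n i k * Y n k j)"
        by (intro sum.cong) (auto simp: D_def unit_entry_def algebra_simps)
      then show ?thesis using ij by (simp add: sum_subtractf sum.delta)
    qed
    \<comment> \<open>Modulo \<open>p ^ n\<close> the indices of \<open>Y\<close> and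
      \<open>D\<close> may be raised by one; the result is the recursion of \<open>neumann\<close>
      solved for the unit entry.\<close>
    moreover have "[Y n i j - (\<Sum>k\<in>{1..l}. D n i k * Y n k j)
        = Y (Suc n) i j - (\<Sum>k\<in>{1..l}. D (Suc n) i k * Y n k j)] (mod int p ^ n)"
      by (intro cong_diff cong_sum cong_mult cong_refl cong_sym[OF Yc] cong_sym[OF D] ij)
    moreover have "Y (Suc n) i j - (\<Sum>k\<in>{1..l}. D (Suc n) i k * Y n k j) = int (unit_entry i j)"
      by (simp add: Y_def)
    ultimately show ?thesis by (simp only: cong_def)
  qed
  ultimately show thesis using that by blast
qed

text \<open>A right inverse \<open>N\<close> of \<open>M\<close> has itself a right inverse
  \<open>K\<close>, and \<open>M = M (N K) = (M N) K = K\<close> shows that \<open>N\<close> is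
  two-sided. The matrix \<open>X\<close> with \<open>M = 1 + p X\<close> consists of the entrywise
  shifts.\<close>

lemma Zp_GL_one_plus_p:
  assumes p: "1 < p"
    and M: "M \<in> Zp_mats p l" "\<And>i j. i \<in> {1..l} \<Longrightarrow> j \<in> {1..l} \<Longrightarrow> M i j 1 = unit_entry i j"
  shows "M \<in> Zp_GL p l"
    and "\<exists>N\<in>Zp_mats p l. \<forall>m\<in>{1..l}. \<forall>i\<in>{1..l}.
             M m i = (if m = i then \<one>\<^bsub>Zp p\<^esub> else \<zero>\<^bsub>Zp p\<^esub>) \<oplus>\<^bsub>Zp p\<^esub> ([p] \<cdot>\<^bsub>Zp p\<^esub> N m i)"
proof -
  have p0: "0 < p" using p by simp
  have u: "unit_entry i j mod p = unit_entry i j" for i j using p by (simp add: unit_entry_def)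
  obtain N where N: "N \<in> Zp_mats p l"
      "\<And>i j. i \<in> {1..l} \<Longrightarrow> j \<in> {1..l} \<Longrightarrow> N i j 1 = unit_entry i j mod p"
      "\<And>i j n. i \<in> {1..l} \<Longrightarrow> j \<in> {1..l} \<Longrightarrow>
        [(\<Sum>k\<in>{1..l}. int (M i k n) * int (N k j n)) = int (unit_entry i j)] (mod int p ^ n)"
    by (rule Zp_mat_right_inverse[OF p0 M(1)]) (use M(2) u in simp_all)
  obtain K where K: 
      "\<And>i j n. i \<in> {1..l} \<Longrightarrow> j \<in> {1..l} \<Longrightarrow>
        [(\<Sum>k\<in>{1..l}. int (N i k n) * int (K k j n)) = int (unit_entry i j)] (mod int p ^ n)"
    by (rule Zp_mat_right_inverse[OF p0 N(1,2)]) auto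
  have delta: "(\<Sum>k\<in>{1..l}. x k * int (unit_entry k j)) = x j"
      "(\<Sum>k\<in>{1..l}. int (unit_entry j k) * x k) = x j" if "j \<in> {1..l}" for x j
    using that by (simp_all add: unit_entry_def if_distrib if_distribR sum.delta sum.delta' cong: if_cong)
  have MK: "[int (M i j n) = int (K i j n)] (mod int p ^ n)" if ij: "i \<in> {1..l}" "j \<in> {1..l}" for i j n
  proof -
    let ?A = "\<Sum>k\<in>{1..l}. \<Sum>m\<in>{1..l}. int (M i m n) * (int (N m k n) * int (K k j n))"
    have "[?A = (\<Sum>k\<in>{1..l}. int (unit_entry i k) * int (K k j n))] (mod int p ^ n)"
    proof (rule cong_sum)
      fix k assume k: "k \<in> {1..l}"
      show "[(\<Sum>m\<in>{1..l}. int (M i m n) * (int (N m k n) * int (K k j n)))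
          = int (unit_entry i k) * int (K k j n)] (mod int p ^ n)"
        using cong_scalar_right[OF N(3)[OF ij(1) k, of n], of "int (K k j n)"]
        by (simp add: sum_distrib_right mult.assoc)
    qed
    then have 1: "[?A = int (K i j n)] (mod int p ^ n)" using delta(2)[OF ij(1)] by simp
    have "[(\<Sum>m\<in>{1..l}. \<Sum>k\<in>{1..l}. int (M i m n) * (int (N m k n) * int (K k j n)))
        = (\<Sum>m\<in>{1..l}. int (M i m n) * int (unit_entry m j))] (mod int p ^ n)"
    proof (rule cong_sum)
      fix m assume m: "m \<in> {1..l}"
      show "[(\<Sum>k\<in>{1..l}. int (M i m n) * (int (N m k n) * int (K k j n)))
          = int (M i m n) * int (unit_entry m j)] (mod int p ^ n)"
        using cong_scalar_left[OF K[OF m ij(2), of n], of "int (M i m n)"]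
        by (simp add: sum_distrib_left)
    qed
    then have "[?A = int (M i j n)] (mod int p ^ n)"
      using delta(1)[OF ij(2)] by (subst sum.swap) simp
    then show ?thesis using 1 cong_sym cong_trans by blast
  qed
  have NM: "[(\<Sum>k\<in>{1..l}. int (N i k n) * int (M k j n)) = int (unit_entry i j)] (mod int p ^ n)"
    if ij: "i \<in> {1..l}" "j \<in> {1..l}" for i j n
  proof -
    have "[(\<Sum>k\<in>{1..l}. int (N i k n) * int (M k j n)) = (\<Sum>k\<in>{1..l}. int (N i k n) * int (K k j n))] (mod int p ^ n)"
      by (intro cong_sum cong_mult cong_refl MK ij)
    then show ?thesis using K[OF ij] cong_trans by blast
  qed
  have conv: "(\<Oplus>\<^bsub>Zp p\<^esub>k\<in>{1..l}. A i k \<otimes>\<^bsub>Zp p\<^esub> B k j) = (if i = j then \<one>\<^bsub>Zp p\<^esub> else \<zero>\<^bsub>Zp p\<^esub>)"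
    if AB: "A \<in> Zp_mats p l" "B \<in> Zp_mats p l" and ij: "i \<in> {1..l}" "j \<in> {1..l}"
      and c: "\<And>n. [(\<Sum>k\<in>{1..l}. int (A i k n) * int (B k j n)) = int (unit_entry i j)] (mod int p ^ n)"
    for A B i j
  proof -
    have "(\<Oplus>\<^bsub>Zp p\<^esub>k\<in>{1..l}. A i k \<otimes>\<^bsub>Zp p\<^esub> B k j)
        = (\<lambda>n. (\<Sum>k\<in>{1..l}. (A i k n * B k j n) mod p ^ n) mod p ^ n)"
      unfolding Zp_simps using AB ij
      by (intro Zp_finsum[OF p0] Zp_mult_closed p0) (auto simp: Zp_mats_def)
    moreover have "[(\<Sum>k\<in>{1..l}. A i k n * B k j n) = unit_entry i j] (mod p ^ n)" for n
      using c[of n] unfolding cong_int_iff[symmetric] by simp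
    ultimately show ?thesis
      by (auto simp: fun_eq_iff mod_sum_eq cong_def unit_entry_def)
  qed
  show "M \<in> Zp_GL p l"
    unfolding Zp_GL_def
  proof (intro CollectI conjI bexI[OF _ N(1)] ballI)
    fix i j assume ij: "i \<in> {1..l}" "j \<in> {1..l}"
    show "(\<Oplus>\<^bsub>Zp p\<^esub>k\<in>{1..l}. M i k \<otimes>\<^bsub>Zp p\<^esub> N k j) = (if i = j then \<one>\<^bsub>Zp p\<^esub> else \<zero>\<^bsub>Zp p\<^esub>)"
      by (rule conv[OF M(1) N(1) ij N(3)[OF ij]])
    show "(\<Oplus>\<^bsub>Zp p\<^esub>k\<in>{1..l}. N i k \<otimes>\<^bsub>Zp p\<^esub> M k j) = (if i = j then \<one>\<^bsub>Zp p\<^esub> else \<zero>\<^bsub>Zp p\<^esub>)"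
      by (rule conv[OF N(1) M(1) ij NM[OF ij]])
  qed (rule M(1))
  show "\<exists>N\<in>Zp_mats p l. \<forall>m\<in>{1..l}. \<forall>i\<in>{1..l}.
             M m i = (if m = i then \<one>\<^bsub>Zp p\<^esub> else \<zero>\<^bsub>Zp p\<^esub>) \<oplus>\<^bsub>Zp p\<^esub> ([p] \<cdot>\<^bsub>Zp p\<^esub> N m i)"
  proof (intro bexI ballI)
    show "(\<lambda>m i. padic_shift p (M m i)) \<in> Zp_mats p l"
      using M(1) by (auto simp: Zp_mats_def intro: padic_shift_closed[OF p0])
    fix m i assume mi: "m \<in> {1..l}" "i \<in> {1..l}"
    then have MZ: "M m i \<in> padic_ints p" using M(1) by (simp add: Zp_mats_def)
    have "M m i n = (unit_entry m i + p * padic_shift p (M m i) n) mod p ^ n" for n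
      using padic_ints_Suc[OF MZ, of n] padic_shift_eq[OF p0 MZ, of n] M(2)[OF mi] by simp
    then show "M m i = (if m = i then \<one>\<^bsub>Zp p\<^esub> else \<zero>\<^bsub>Zp p\<^esub>)
        \<oplus>\<^bsub>Zp p\<^esub> ([p] \<cdot>\<^bsub>Zp p\<^esub> padic_shift p (M m i))"
      unfolding Zp_add_pow[OF p0 padic_shift_closed[OF p0 MZ]]
      by (auto simp: fun_eq_iff unit_entry_def mod_simps)
  qed
qed

section \<open>Automorphisms of finite order congruent to the identity\<close>

text \<open>In additive notation this is membership in \<open>k G\<close>; for \<open>k\<close>
  running through the powers of \<open>p\<close> it measures p-adic closeness to the
  identity.\<close>

definition is_power :: "('a, 'm) monoid_scheme \<Rightarrow> nat \<Rightarrow> 'a \<Rightarrow> bool" where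
  "is_power G k x \<longleftrightarrow> (\<exists>y\<in>carrier G. x = y [^]\<^bsub>G\<^esub> k)"

context comm_group
begin

lemma is_power_closed: "is_power G k x \<Longrightarrow> x \<in> carrier G"
  by (auto simp: is_power_def)

lemma is_power_mult: "is_power G k x \<Longrightarrow> is_power G k y \<Longrightarrow> is_power G k (x \<otimes> y)"
  unfolding is_power_def by (metis m_closed nat_pow_distrib)

lemma is_power_inv: "is_power G k x \<Longrightarrow> is_power G k (inv x)"
  unfolding is_power_def by (metis inv_closed nat_pow_inv)

lemma is_power_pow_mult: "is_power G k x \<Longrightarrow> is_power G (k * n) (x [^] (n::nat))"
  unfolding is_power_def by (metis nat_pow_pow)

lemma is_power_dvd: "is_power G k x \<Longrightarrow> m dvd k \<Longrightarrow> is_power G m x"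
  unfolding is_power_def by (metis dvd_def mult.commute nat_pow_closed nat_pow_pow)

lemma is_power_pow: "is_power G k x \<Longrightarrow> is_power G k (x [^] (n::nat))"
  using is_power_pow_mult is_power_dvd dvd_triv_left by blast

lemma is_power_hom: "\<alpha> \<in> hom G G \<Longrightarrow> is_power G k x \<Longrightarrow> is_power G k (\<alpha> x)"
  unfolding is_power_def by (metis hom_in_carrier hom_nat_pow is_group)

lemma is_power_one: "is_power G k \<one>"
  unfolding is_power_def by (metis nat_pow_one one_closed)

text \<open>Writing $\beta = 1 + \delta$, the relation $\beta^q = 1$ reads
  $q d + \binom q2 \delta d + \dots = 0$ for $d = \delta x$. Each application of \<open>\<delta>\<close> gains a factor
  \<open>p\<close>, so \<open>d\<close> is divisible by ever higher powers of \<open>p\<close>; for $q = p$ this needs that \<open>p\<close> divides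
  $\binom p2$.\<close>

lemma prime_order_trivial:
  fixes p q :: nat
  assumes p: "Factorial_Ring.prime p" "2 < p" and q: "Factorial_Ring.prime q"
    and tf: "\<And>x n. x \<in> carrier G \<Longrightarrow> 0 < (n::nat) \<Longrightarrow> x [^] n = \<one> \<Longrightarrow> x = \<one>"
    and sep: "\<And>x. x \<in> carrier G \<Longrightarrow> (\<And>r. is_power G (p ^ r) x) \<Longrightarrow> x = \<one>"
    and \<beta>: "\<beta> \<in> hom G G" "\<And>x. x \<in> carrier G \<Longrightarrow> \<exists>u. is_power G p u \<and> \<beta> x = x \<otimes> u"
    and ord: "\<And>x. x \<in> carrier G \<Longrightarrow> (\<beta> ^^ q) x = x"
    and x: "x \<in> carrier G"
  shows "\<beta> x = x"
proof -
  obtain d where d: "is_power G p d" "\<beta> x = x \<otimes> d" using \<beta>(2)[OF x] by blast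
  have dc: "d \<in> carrier G" using d is_power_closed by blast
  \<comment> \<open>As \<open>\<delta>\<close> is a homomorphism, it maps a \<open>p ^ r\<close>-th
    power of \<open>y\<close> to the \<open>p ^ r\<close>-th power of \<open>\<delta> y\<close>,
    which is a \<open>p\<close>-th power.\<close>
  have gain: "\<exists>u. is_power G (p ^ Suc r) u \<and> \<beta> z = z \<otimes> u" if z: "is_power G (p ^ r) z" for r z
  proof -
    obtain y where y: "y \<in> carrier G" "z = y [^] (p ^ r)" using z by (auto simp: is_power_def)
    obtain u where u: "is_power G p u" "\<beta> y = y \<otimes> u" using \<beta>(2)[OF y(1)] by blast
    have "\<beta> z = z \<otimes> u [^] (p ^ r)"
      using y u is_power_closed[OF u(1)] hom_nat_pow[OF \<beta>(1) _ is_group is_group] by (simp add: nat_pow_distrib)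
    then show ?thesis using is_power_pow_mult[OF u(1), of "p ^ r"] by auto
  qed
  have "is_power G (p ^ r) d" for r
  proof (induction r)
    case 0 show ?case using dc by (auto simp: is_power_def)
  next
    case (Suc r)
    \<comment> \<open>Everything is computed modulo \<open>?D\<close>: here
      \<open>u = \<delta> d\<close> is a \<open>p ^ (r + 1)\<close>-th power and
      \<open>\<delta> u\<close> lies in \<open>?D\<close>, so the binomial expansion of the iterates
      of \<open>\<beta>\<close> stops after the quadratic term.\<close>
    let ?D = "is_power G (p ^ Suc (Suc r))"
    obtain u where u: "is_power G (p ^ Suc r) u" "\<beta> d = d \<otimes> u" using gain[OF Suc] by blast
    have uc: "u \<in> carrier G" using u is_power_closed by blast
    have iter_d: "\<exists>v. ?D v \<and> (\<beta> ^^ i) d = d \<otimes> u [^] i \<otimes> v" for i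
    proof (induction i)
      case 0 show ?case using dc is_power_one by (auto intro!: exI[of _ \<one>])
    next
      case (Suc i)
      then obtain v where v: "?D v" "(\<beta> ^^ i) d = d \<otimes> u [^] i \<otimes> v" by blast
      obtain u' where u': "?D u'" "\<beta> u = u \<otimes> u'" using gain[OF u(1)] by blast
      have c: "v \<in> carrier G" "u' \<in> carrier G" "\<beta> v \<in> carrier G"
        using v(1) u'(1) is_power_closed is_power_hom[OF \<beta>(1)] by blast+
      have "(\<beta> ^^ Suc i) d = \<beta> d \<otimes> (\<beta> u) [^] i \<otimes> \<beta> v"
        using v(2) dc uc c by (simp add: hom_mult[OF \<beta>(1)] hom_nat_pow[OF \<beta>(1) _ is_group is_group])
      also have "\<dots> = d \<otimes> u [^] Suc i \<otimes> (u' [^] i \<otimes> \<beta> v)"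
        using u u' dc uc c by (simp add: nat_pow_distrib m_ac)
      finally show ?case using is_power_mult[OF is_power_pow[OF u'(1)] is_power_hom[OF \<beta>(1) v(1)]] by blast
    qed
    have "\<exists>v. ?D v \<and> (\<beta> ^^ k) x = x \<otimes> d [^] k \<otimes> u [^] (k choose 2) \<otimes> v" for k
    proof (induction k)
      case 0 show ?case using x is_power_one by (auto intro!: exI[of _ \<one>] simp: binomial_eq_0)
    next
      case (Suc k)
      then obtain v where v: "?D v" "(\<beta> ^^ k) x = x \<otimes> d [^] k \<otimes> u [^] (k choose 2) \<otimes> v" by blast
      obtain v' where v': "?D v'" "(\<beta> ^^ k) d = d \<otimes> u [^] k \<otimes> v'" using iter_d by blast
      have c: "v \<in> carrier G" "v' \<in> carrier G" using v(1) v'(1) is_power_closed by blast+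
      have hom: "(\<beta> ^^ k) (a \<otimes> b) = (\<beta> ^^ k) a \<otimes> (\<beta> ^^ k) b \<and> (\<beta> ^^ k) a \<in> carrier G \<and> (\<beta> ^^ k) b \<in> carrier G"
        if "a \<in> carrier G" "b \<in> carrier G" for a b
        using that by (induction k) (auto simp: hom_mult[OF \<beta>(1)] hom_in_carrier[OF \<beta>(1)] intro: hom_in_carrier[OF \<beta>(1)])
      \<comment> \<open>Taking off the innermost \<open>\<beta>\<close> requires only the iterates
        on \<open>d\<close>, which \<open>iter_d\<close> describes; the exponents of
        \<open>u\<close> then add up by Pascal's rule.\<close>
      have "(\<beta> ^^ Suc k) x = (\<beta> ^^ k) (x \<otimes> d)" using d(2) by (simp add: funpow_swap1)
      also have "\<dots> = (x \<otimes> d [^] k \<otimes> u [^] (k choose 2) \<otimes> v) \<otimes> (d \<otimes> u [^] k \<otimes> v')"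
        using hom[OF x dc] v v' by simp
      also have "\<dots> = x \<otimes> d [^] Suc k \<otimes> (u [^] (k choose 2) \<otimes> u [^] k) \<otimes> (v \<otimes> v')"
        using x dc uc c by (simp add: m_ac)
      also have "u [^] (k choose 2) \<otimes> u [^] k = u [^] (Suc k choose 2)"
        using uc by (simp add: nat_pow_mult numeral_2_eq_2 add.commute)
      finally show ?case using is_power_mult[OF v(1) v'(1)] by blast
    qed
    from this[of q] obtain v where v: "?D v" "x = x \<otimes> d [^] q \<otimes> u [^] (q choose 2) \<otimes> v"
      using ord[OF x] by auto
    have vc: "v \<in> carrier G" using v is_power_closed by blast
    have "x \<otimes> (d [^] q \<otimes> (u [^] (q choose 2) \<otimes> v)) = x \<otimes> \<one>"
      using v(2) x dc uc vc by (simp add: m_assoc)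
    then have "d [^] q \<otimes> (u [^] (q choose 2) \<otimes> v) = \<one>"
      using x dc uc vc by (simp del: r_one)
    then have dq: "d [^] q = inv (u [^] (q choose 2) \<otimes> v)"
      using dc uc vc by (simp add: inv_equality[symmetric])
    show ?case
    proof (cases "q = p")
      case True
      have "p dvd p choose 2" by (rule dvd_choose_prime) (use p in auto)
      then obtain m where m: "p choose 2 = p * m" by blast
      have "?D (u [^] (p choose 2))"
        using is_power_pow[OF is_power_pow_mult[OF u(1), of p], of m] uc by (simp add: m nat_pow_pow mult.commute)
      then have "?D (d [^] p)" using dq v(1) True is_power_inv is_power_mult by metis
      then obtain y where y: "y \<in> carrier G" "d [^] p = y [^] (p ^ Suc (Suc r))" by (auto simp: is_power_def)
      then have "d [^] p = (y [^] (p ^ Suc r)) [^] p" by (simp add: nat_pow_pow mult_ac)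
      \<comment> \<open>Torsion-freeness will cancel the common exponent \<open>p\<close>: of the
        \<open>p ^ (r + 2)\<close> available for \<open>d [^] p\<close>, a factor
        \<open>p ^ (r + 1)\<close> remains for \<open>d\<close>.\<close>
      then have "(d \<otimes> inv (y [^] (p ^ Suc r))) [^] p = \<one>"
        using dc y(1) by (simp add: nat_pow_distrib nat_pow_inv)
      then have "d \<otimes> inv (y [^] (p ^ Suc r)) = \<one>" using tf dc y(1) p by (metis inv_closed m_closed nat_pow_closed not_gr0 prime_gt_0_nat)
      then have "d = y [^] (p ^ Suc r)" using dc y(1) by (metis inv_closed inv_equality inv_inv nat_pow_closed)
      then show ?thesis using y(1) by (auto simp: is_power_def)
    next
      case False
      have P1: "is_power G (p ^ Suc r) (d [^] q)"
        unfolding dq by (intro is_power_inv is_power_mult is_power_pow u is_power_dvd[OF v(1)]) simp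
      have P2: "is_power G (p ^ Suc r) (d [^] p)" using is_power_pow_mult[OF Suc, of p] by (simp add: mult.commute)
      \<comment> \<open>Both \<open>d [^] q\<close> and \<open>d [^] p\<close> are
        \<open>p ^ (r + 1)\<close>-th powers, and a Bezout relation recovers \<open>d\<close> from
        them.\<close>
      have "gcd q p = 1" using False p q primes_coprime by (metis coprime_imp_gcd_eq_1)
      then obtain a b where ab: "q * a = p * b + 1" using bezout_nat[of q p] q by (metis not_prime_0)
      have "d [^] (p * b) \<otimes> d = d [^] (q * a)" unfolding ab using dc by simp
      then have "d = inv ((d [^] p) [^] b) \<otimes> (d [^] q) [^] a"
        using dc by (metis inv_solve_left nat_pow_closed nat_pow_pow)
      then show ?thesis using is_power_mult[OF is_power_inv[OF is_power_pow[OF P2]] is_power_pow[OF P1]] by metis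
    qed
  qed
  then show ?thesis using sep[OF dc] d x by simp
qed

text \<open>Strong induction on the exponent. If \<open>k = m * q\<close> with \<open>q\<close>
  prime, then the \<open>q\<close>-th iterate is again the identity modulo \<open>p\<close> and is
  killed by the smaller exponent \<open>m\<close>, so it is trivial, and the case of prime order
  applies to \<open>\<beta>\<close>.\<close>

lemma finite_order_trivial:
  fixes p k :: nat
  assumes p: "Factorial_Ring.prime p" "2 < p" and k: "0 < k"
    and tf: "\<And>x n. x \<in> carrier G \<Longrightarrow> 0 < (n::nat) \<Longrightarrow> x [^] n = \<one> \<Longrightarrow> x = \<one>"
    and sep: "\<And>x. x \<in> carrier G \<Longrightarrow> (\<And>r. is_power G (p ^ r) x) \<Longrightarrow> x = \<one>"
    and \<beta>: "\<beta> \<in> hom G G" "\<And>x. x \<in> carrier G \<Longrightarrow> \<exists>u. is_power G p u \<and> \<beta> x = x \<otimes> u"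
    and ord: "\<And>x. x \<in> carrier G \<Longrightarrow> (\<beta> ^^ k) x = x"
    and x: "x \<in> carrier G"
  shows "\<beta> x = x"
  using k \<beta> ord x
proof (induction k arbitrary: \<beta> x rule: less_induct)
  case (less k)
  show ?case
  proof (cases "k = 1")
    case True then show ?thesis using less by simp
  next
    case False
    then obtain q where q: "Factorial_Ring.prime q" "q dvd k" using prime_factor_nat by blast
    then obtain m where m: "k = m * q" by (metis dvd_def mult.commute)
    have m0: "0 < m" "m < k" using m less.prems(1) prime_gt_1_nat[OF q(1)] by auto
    have H: "(\<beta> ^^ i) \<in> hom G G" for i
      by (induction i) (auto simp: hom_def Pi_iff hom_mult[OF less.prems(2)] hom_in_carrier[OF less.prems(2)])
    have C: "\<exists>u. is_power G p u \<and> (\<beta> ^^ i) y = y \<otimes> u" if y: "y \<in> carrier G" for y i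
    proof (induction i)
      case 0 show ?case by (rule exI[of _ \<one>]) (use that is_power_one in simp)
    next
      case (Suc i)
      then obtain u where u: "is_power G p u" "(\<beta> ^^ i) y = y \<otimes> u" by blast
      obtain v where v: "is_power G p v" "\<beta> y = y \<otimes> v" using less.prems(3)[OF y] by blast
      have "(\<beta> ^^ Suc i) y = y \<otimes> (v \<otimes> \<beta> u)"
        using u v y is_power_closed is_power_hom[OF less.prems(2) u(1)]
        by (simp add: hom_mult[OF less.prems(2)] m_assoc)
      then show ?case using is_power_mult[OF v(1) is_power_hom[OF less.prems(2) u(1)]] by blast
    qed
    have fixq: "(\<beta> ^^ q) y = y" if "y \<in> carrier G" for y
      by (rule less.IH[OF m0(2,1) H C _ that]) (use less.prems(4) m in \<open>simp_all add: funpow_mult mult.commute\<close>)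
    show ?thesis by (rule prime_order_trivial[OF p q(1) tf sep less.prems(2,3) fixq less.prems(5)])
  qed
qed

end

section \<open>Compact groups and powers with p-adic exponents\<close>

locale compact_group = Group.group G for G :: "('g, 'm) monoid_scheme" (structure) +
  fixes T :: "'g topology"
  assumes top_group: "topological_group G T"
    and compact: "compact_space T"
    and Hausdorff: "Hausdorff_space T"
begin

lemma topspace_carrier [simp]: "topspace T = carrier G"
  using top_group by (simp add: topological_group_def)

lemma continuous_mult:
  assumes "continuous_map Y T f" "continuous_map Y T g"
  shows "continuous_map Y T (\<lambda>x. f x \<otimes> g x)"
proof -
  have "continuous_map Y (prod_topology T T) (\<lambda>x. (f x, g x))"
    using assms by (simp add: continuous_map_pairedI)
  then have "continuous_map Y T ((\<lambda>(x, y). x \<otimes> y) \<circ> (\<lambda>x. (f x, g x)))"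
    using top_group continuous_map_compose by (metis topological_group_def)
  then show ?thesis by (simp add: o_def)
qed

lemma continuous_const: "c \<in> carrier G \<Longrightarrow> continuous_map T T (\<lambda>x. c)"
  by simp

lemma continuous_pow: "continuous_map T T (\<lambda>x. x [^] (n::nat))"
  by (induction n) (auto intro: continuous_mult)

lemma open_normalD:
  assumes "N \<in> open_normals G T"
  shows "N \<lhd> G" "openin T N" "subgroup N G" "N \<subseteq> carrier G"
  using assms by (auto simp: open_normals_def normal_imp_subgroup subgroup.subset dest: subgroup.subset normal_imp_subgroup)

lemma open_rcoset:
  assumes "N \<in> open_normals G T" "x \<in> carrier G"
  shows "openin T (N #> x)"
proof -
  have "continuous_map T T (\<lambda>z. z \<otimes> inv x)"
    using assms by (intro continuous_mult continuous_const) auto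
  then have "openin T {z \<in> topspace T. z \<otimes> inv x \<in> N}"
    using open_normalD(2)[OF assms(1)] by (rule openin_continuous_map_preimage)
  moreover have "{z \<in> topspace T. z \<otimes> inv x \<in> N} = N #> x"
  proof -
    have "z \<in> N #> x" if "z \<in> carrier G" "z \<otimes> inv x \<in> N" for z
      using that assms(2) unfolding r_coset_def by (auto intro!: bexI[of _ "z \<otimes> inv x"] simp: m_assoc)
    moreover have "n \<otimes> x \<otimes> inv x \<in> N" if "n \<in> N" for n
      using that assms open_normalD(4)[OF assms(1)] by (simp add: m_assoc subset_iff)
    ultimately show ?thesis
      using assms open_normalD(4)[OF assms(1)] by (fastforce simp: r_coset_def)
  qed
  ultimately show ?thesis by simp
qed

text \<open>The cosets are an open cover by pairwise disjoint nonempty sets, so a finite subcover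
  contains all of them.\<close>

lemma finite_Mod:
  assumes N: "N \<in> open_normals G T"
  shows "finite (carrier (G Mod N))"
proof -
  have sub: "subgroup N G" by (rule open_normalD(3)[OF N])
  have "\<forall>U\<in>rcosets N. openin T U" using open_rcoset[OF N] by (auto simp: RCOSETS_def)
  moreover have "topspace T \<subseteq> \<Union>(rcosets N)" using rcosets_part_G[OF sub] by simp
  ultimately obtain \<F> where F: "finite \<F>" "\<F> \<subseteq> rcosets N" "carrier G \<subseteq> \<Union>\<F>"
    using compact unfolding compact_space_alt by (metis topspace_carrier)
  have "rcosets N \<subseteq> \<F>"
  proof
    fix C assume C: "C \<in> rcosets N"
    then obtain x where x: "x \<in> carrier G" "C = N #> x" by (auto simp: RCOSETS_def)
    then have "x \<in> C" using sub rcos_self by metis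
    obtain D where D: "D \<in> \<F>" "x \<in> D" using F x by blast
    have "C = D"
    proof (rule ccontr)
      assume "C \<noteq> D"
      then have "disjnt C D" using rcos_disjoint[OF sub] C D(1) F(2) by (metis pairwiseD subsetD)
      then show False using \<open>x \<in> C\<close> D(2) by (auto simp: disjnt_def)
    qed
    then show "C \<in> \<F>" using D by simp
  qed
  then show ?thesis using F(1) by (simp add: FactGroup_def finite_subset)
qed

lemma closed_subgroup_compact_group:
  assumes "subgroup K G" "closedin T K"
  shows "compact_group (G\<lparr>carrier := K\<rparr>) (subtopology T K)"
proof -
  interpret K: Group.group "G\<lparr>carrier := K\<rparr>" by (rule subgroup_imp_group[OF assms(1)])
  have KG: "K \<subseteq> carrier G" using assms(1) subgroup.subset by blast
  have "continuous_map (subtopology (prod_topology T T) (K \<times> K)) (subtopology T K) (\<lambda>(x, y). x \<otimes> y)"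
    using top_group subgroup.m_closed[OF assms(1)]
    by (auto simp: topological_group_def continuous_map_in_subtopology intro: continuous_map_from_subtopology)
  moreover have "continuous_map (subtopology T K) (subtopology T K) (\<lambda>x. inv\<^bsub>G\<lparr>carrier := K\<rparr>\<^esub> x)"
  proof (rule continuous_map_eq)
    show "continuous_map (subtopology T K) (subtopology T K) (\<lambda>x. inv x)"
      using top_group subgroup.m_inv_closed[OF assms(1)]
      by (auto simp: topological_group_def continuous_map_in_subtopology intro: continuous_map_from_subtopology)
  qed (use m_inv_consistent[OF assms(1)] in auto)
  ultimately have "topological_group (G\<lparr>carrier := K\<rparr>) (subtopology T K)"
    unfolding topological_group_def using K.is_group KG
    by (auto simp: subtopology_Times)
  moreover have "compact_space (subtopology T K)"
    using assms(2) compact by (simp add: closedin_compact_space compact_space_subtopology)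
  ultimately show ?thesis
    using Hausdorff by unfold_locales (auto simp: Hausdorff_space_subtopology)
qed

text \<open>The centre is an intersection of equalisers of continuous maps into a Hausdorff
  space.\<close>

lemma closed_center: "closedin T (group_center G)"
proof -
  have "closedin T {z \<in> topspace T. z \<otimes> x = x \<otimes> z}" if "x \<in> carrier G" for x
    using that by (intro closedin_continuous_maps_eq[OF Hausdorff] continuous_mult continuous_const) auto
  then have "closedin T (\<Inter>x\<in>carrier G. {z \<in> topspace T. z \<otimes> x = x \<otimes> z})"
    by (intro closedin_INT) auto
  moreover have "(\<Inter>x\<in>carrier G. {z \<in> topspace T. z \<otimes> x = x \<otimes> z}) = group_center G"
    unfolding group_center_def by auto
  ultimately show ?thesis by simp
qed

lemma subgroup_center: "subgroup (group_center G) G"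
proof (rule subgroupI)
  show "inv a \<in> group_center G" if "a \<in> group_center G" for a
    using that unfolding group_center_def
    by (auto simp: inv_solve_left' inv_solve_right' m_assoc)
  show "a \<otimes> b \<in> group_center G" if ab: "a \<in> group_center G" "b \<in> group_center G" for a b
  proof -
    have "a \<otimes> b \<otimes> x = x \<otimes> (a \<otimes> b)" if x: "x \<in> carrier G" for x
    proof -
      have c: "a \<in> carrier G" "b \<in> carrier G" and comm: "b \<otimes> x = x \<otimes> b" "a \<otimes> x = x \<otimes> a"
        using ab x unfolding group_center_def by blast+
      have "a \<otimes> b \<otimes> x = a \<otimes> x \<otimes> b" using c x comm(1) by (simp add: m_assoc)
      then show ?thesis using c x comm(2) by (simp add: m_assoc)
    qed
    moreover have "a \<otimes> b \<in> carrier G" using ab unfolding group_center_def by blast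
    ultimately show ?thesis unfolding group_center_def by blast
  qed
qed (auto simp: group_center_def)

end

locale p_valued_group = compact_group G T for G :: "('g, 'm) monoid_scheme" (structure) and T +
  fixes p :: nat and \<omega> :: "'g \<Rightarrow> ereal"
  assumes prime_p: "Factorial_Ring.prime p"
    and valuation: "p_valuation p G \<omega>"
    and topology: "induces_topology G T \<omega>"
begin

lemma p_pos: "0 < p" "1 < p" using prime_p prime_gt_1_nat by (auto intro: prime_gt_0_nat)

lemma val_one: "\<omega> \<one> = \<infinity>" using valuation unfolding p_valuation_def by blast

lemma val_pos: "x \<in> carrier G \<Longrightarrow> 0 < \<omega> x"
proof -
  assume "x \<in> carrier G"
  then have "ereal (1 / (real p - 1)) < \<omega> x" using valuation unfolding p_valuation_def by blast
  moreover have "0 < 1 / (real p - 1)" using p_pos by simp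
  ultimately show ?thesis by (metis ereal_less(2) less_trans)
qed

lemma val_inv_ge: "x \<in> carrier G \<Longrightarrow> \<omega> x \<le> \<omega> (inv x)"
proof -
  assume x: "x \<in> carrier G"
  have "min (\<omega> \<one>) (\<omega> x) \<le> \<omega> (\<one> \<otimes> inv x)" using x valuation unfolding p_valuation_def by blast
  then show ?thesis using x val_one by simp
qed

lemma val_inv: "x \<in> carrier G \<Longrightarrow> \<omega> (inv x) = \<omega> x"
  using val_inv_ge[of x] val_inv_ge[of "inv x"] by (auto intro: antisym)

lemma val_mult: "x \<in> carrier G \<Longrightarrow> y \<in> carrier G \<Longrightarrow> c \<le> \<omega> x \<Longrightarrow> c \<le> \<omega> y \<Longrightarrow> c \<le> \<omega> (x \<otimes> y)"
proof -
  assume *: "x \<in> carrier G" "y \<in> carrier G" "c \<le> \<omega> x" "c \<le> \<omega> y"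
  have "min (\<omega> x) (\<omega> (inv y)) \<le> \<omega> (x \<otimes> inv (inv y))"
    using * valuation unfolding p_valuation_def by blast
  then show ?thesis using * val_inv by (auto simp: min_def split: if_splits)
qed

lemma val_pow: "x \<in> carrier G \<Longrightarrow> c \<le> \<omega> x \<Longrightarrow> c \<le> \<omega> (x [^] (n::nat))"
  by (induction n) (auto simp: val_one intro: val_mult)

text \<open>Each \<open>p\<close>-th power raises the value by 1, and the start is positive. The
  bound does not depend on \<open>x\<close>, so that one exponent will serve for all elements of the
  group.\<close>

lemma val_p_pow: "x \<in> carrier G \<Longrightarrow> ereal (real n) \<le> \<omega> (x [^] (p ^ n))"
proof (induction n)
  case 0 then show ?case using val_pos[of x] by (simp add: zero_ereal_def[symmetric])
next
  case (Suc n)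
  have "\<omega> ((x [^] (p ^ n)) [^] p) = \<omega> (x [^] (p ^ n)) + 1"
    using Suc.prems valuation unfolding p_valuation_def by blast
  moreover have "(x [^] (p ^ n)) [^] p = x [^] (p ^ Suc n)"
    using Suc.prems by (simp add: nat_pow_pow mult.commute)
  ultimately have "\<omega> (x [^] (p ^ Suc n)) = \<omega> (x [^] (p ^ n)) + 1" by simp
  moreover have "ereal (real (Suc n)) = ereal (real n) + 1" by (simp add: one_ereal_def)
  ultimately show ?case using add_right_mono[OF Suc.IH[OF Suc.prems], of 1] by (simp only:)
qed

lemma val_dvd_pow: "x \<in> carrier G \<Longrightarrow> p ^ n dvd k \<Longrightarrow> ereal (real n) \<le> \<omega> (x [^] k)"
  using val_pow[OF _ val_p_pow] by (auto simp: nat_pow_pow[symmetric] elim!: dvdE)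

lemma val_ball_open:
  assumes "h \<in> carrier G"
  shows "openin T {z \<in> carrier G. ereal r \<le> \<omega> (inv h \<otimes> z)}"
proof -
  have "openin T {x \<in> carrier G. ereal r \<le> \<omega> x}" using topology unfolding induces_topology_def by blast
  moreover have "continuous_map T T (\<lambda>z. inv h \<otimes> z)"
    using assms by (intro continuous_mult continuous_const) auto
  ultimately have "openin T {z \<in> topspace T. inv h \<otimes> z \<in> {x \<in> carrier G. ereal r \<le> \<omega> x}}"
    by (rule openin_continuous_map_preimage[rotated])
  then show ?thesis using assms by (simp add: conj_commute cong: conj_cong)
qed

text \<open>With \<open>val_sym\<close> this makes \<open>\<omega> (inv x \<otimes> y)\<close> a
  left-invariant ultrametric, written on the logarithmic scale.\<close>

lemma val_trans:
  assumes "x \<in> carrier G" "y \<in> carrier G" "z \<in> carrier G"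
    and "c \<le> \<omega> (inv x \<otimes> y)" "c \<le> \<omega> (inv y \<otimes> z)"
  shows "c \<le> \<omega> (inv x \<otimes> z)"
proof -
  have "inv x \<otimes> z = (inv x \<otimes> y) \<otimes> (inv y \<otimes> z)"
    using assms by (metis inv_closed inv_solve_left m_assoc m_closed)
  then show ?thesis using assms val_mult by auto
qed

lemma val_sym:
  assumes "x \<in> carrier G" "y \<in> carrier G"
  shows "\<omega> (inv x \<otimes> y) = \<omega> (inv y \<otimes> x)"
  using val_inv[of "inv x \<otimes> y"] assms by (simp add: inv_mult_group)

text \<open>Two balls of the same radius are equal or disjoint, so the complement of a ball is a
  union of open balls.\<close>

lemma val_ball_closed:
  assumes "h \<in> carrier G"
  shows "closedin T {z \<in> carrier G. ereal r \<le> \<omega> (inv h \<otimes> z)}"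
proof -
  let ?B = "\<lambda>h. {z \<in> carrier G. ereal r \<le> \<omega> (inv h \<otimes> z)}"
  have "openin T (\<Union>x\<in>carrier G - ?B h. ?B x)" using val_ball_open by blast
  moreover have "(\<Union>x\<in>carrier G - ?B h. ?B x) = carrier G - ?B h"
  proof
    show "carrier G - ?B h \<subseteq> (\<Union>x\<in>carrier G - ?B h. ?B x)"
      using val_one by auto
    show "(\<Union>x\<in>carrier G - ?B h. ?B x) \<subseteq> carrier G - ?B h"
    proof
      fix z assume "z \<in> (\<Union>x\<in>carrier G - ?B h. ?B x)"
      then obtain x where xz: "x \<in> carrier G" "x \<notin> ?B h" "z \<in> carrier G" "ereal r \<le> \<omega> (inv x \<otimes> z)"
        by blast
      have "z \<notin> ?B h"
      proof
        assume "z \<in> ?B h"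
        then have "ereal r \<le> \<omega> (inv h \<otimes> x)"
          using val_trans[OF assms xz(3,1)] xz(4) val_sym[OF xz(1,3)] by simp
        then show False using xz by simp
      qed
      then show "z \<in> carrier G - ?B h" using xz by blast
    qed
  qed
  ultimately show ?thesis by (auto simp: closedin_def)
qed

text \<open>The hypothesis on the topology gives balls only around the identity; left translation
  moves them to \<open>x\<close>.\<close>

lemma open_contains_ball:
  assumes "openin T U" "x \<in> U"
  obtains r where "\<And>z. z \<in> carrier G \<Longrightarrow> ereal r \<le> \<omega> (inv x \<otimes> z) \<Longrightarrow> z \<in> U"
proof -
  have x: "x \<in> carrier G" using assms openin_subset by fastforce
  have "continuous_map T T (\<lambda>z. x \<otimes> z)" using x by (intro continuous_mult continuous_const) auto
  then have "openin T {z \<in> topspace T. x \<otimes> z \<in> U}" using assms(1) by (rule openin_continuous_map_preimage)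
  moreover have "\<one> \<in> {z \<in> topspace T. x \<otimes> z \<in> U}" using assms(2) x by simp
  ultimately obtain r where r: "{z \<in> carrier G. ereal r \<le> \<omega> z} \<subseteq> {z \<in> topspace T. x \<otimes> z \<in> U}"
    using topology unfolding induces_topology_def by blast
  have "z \<in> U" if z: "z \<in> carrier G" "ereal r \<le> \<omega> (inv x \<otimes> z)" for z
  proof -
    have "inv x \<otimes> z \<in> {z \<in> carrier G. ereal r \<le> \<omega> z}" using x z by simp
    then have "x \<otimes> (inv x \<otimes> z) \<in> U" using r by blast
    then show ?thesis using x z by (simp add: m_assoc[symmetric])
  qed
  then show thesis by (rule that)
qed

lemma closed_approx:
  assumes "closedin T K" "x \<in> carrier G"
    and "\<And>n. \<exists>k\<in>K. ereal (real n) \<le> \<omega> (inv k \<otimes> x)"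
  shows "x \<in> K"
proof (rule ccontr)
  assume "x \<notin> K"
  then have "openin T (carrier G - K)" "x \<in> carrier G - K" using assms by (auto simp: closedin_def)
  then obtain r where r: "\<And>z. z \<in> carrier G \<Longrightarrow> ereal r \<le> \<omega> (inv x \<otimes> z) \<Longrightarrow> z \<in> carrier G - K"
    using open_contains_ball by metis
  obtain n :: nat where n: "r \<le> real n" using real_arch_simple by blast
  obtain k where k: "k \<in> K" "ereal (real n) \<le> \<omega> (inv k \<otimes> x)" using assms(3) by blast
  have "k \<in> carrier G" using k assms(1) closedin_subset by fastforce
  moreover have "ereal r \<le> \<omega> (inv x \<otimes> k)"
    using k(2) n val_sym[OF \<open>k \<in> carrier G\<close> assms(2)] by (metis ereal_less_eq(3) order_trans)
  ultimately show False using r k(1) by blast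
qed

text \<open>Since \<open>a (n + 1)\<close> and \<open>a n\<close> agree modulo \<open>p ^ n\<close>,
  the closed balls of level \<open>n\<close> around \<open>g [^] a n\<close> are nested. Compactness
  gives a common point, and it is the limit. The second claim is the resulting rate of
  convergence.\<close>

lemma zp_pow_limit:
  assumes g: "g \<in> carrier G" and a: "a \<in> padic_ints p"
  shows "limitin T (\<lambda>n. g [^] a n) (zp_pow G T g a) sequentially"
    and "ereal (real n) \<le> \<omega> (inv (g [^] a n) \<otimes> zp_pow G T g a)"
proof -
  define C where "C = (\<lambda>n. {z \<in> carrier G. ereal (real n) \<le> \<omega> (inv (g [^] a n) \<otimes> z)})"
  have step: "ereal (real n) \<le> \<omega> (inv (g [^] a n) \<otimes> g [^] a (Suc n))" for n
  proof -
    have "a (Suc n) mod p ^ n = a n" using a by (rule padic_ints_Suc)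
    then obtain c where "a (Suc n) = a n + p ^ n * c" by (metis mod_div_mult_eq mult.commute)
    then have "inv (g [^] a n) \<otimes> g [^] a (Suc n) = g [^] (p ^ n * c)"
      using g by (simp add: nat_pow_mult[symmetric] m_assoc[symmetric])
    then show ?thesis using val_dvd_pow[OF g, of n "p ^ n * c"] by simp
  qed
  have "decseq C"
    unfolding decseq_Suc_iff
  proof (intro allI subsetI)
    fix n z assume z: "z \<in> C (Suc n)"
    then have "ereal (real n) \<le> \<omega> (inv (g [^] a (Suc n)) \<otimes> z)"
      unfolding C_def by (auto intro: order_trans[of _ "ereal (real (Suc n))"])
    then show "z \<in> C n" using val_trans[OF _ _ _ step] g z by (simp add: C_def)
  qed
  moreover have "closedin T (C n)" "C n \<noteq> {}" for n
    using val_ball_closed g val_one by (auto simp: C_def intro!: exI[of _ "g [^] a n"])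
  ultimately have "(\<Inter>n. C n) \<noteq> {}" using compact_space_imp_nest[OF compact] by blast
  then obtain z where z: "\<And>n. z \<in> C n" by blast
  have lim: "limitin T (\<lambda>n. g [^] a n) z sequentially"
    unfolding limitin_sequentially
  proof (intro conjI allI impI)
    show "z \<in> topspace T" using z by (simp add: C_def)
    fix U assume "openin T U \<and> z \<in> U"
    then obtain r where r: "\<And>x. x \<in> carrier G \<Longrightarrow> ereal r \<le> \<omega> (inv z \<otimes> x) \<Longrightarrow> x \<in> U"
      using open_contains_ball by metis
    obtain m :: nat where m: "r \<le> real m" using real_arch_simple by blast
    have "g [^] a n \<in> U" if "m \<le> n" for n
    proof (rule r)
      have "ereal (real n) \<le> \<omega> (inv z \<otimes> g [^] a n)"
        using z[of n] g val_sym[of z "g [^] a n"] by (simp add: C_def)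
      then show "ereal r \<le> \<omega> (inv z \<otimes> g [^] a n)" using m that by (auto intro: order_trans[of _ "ereal (real n)"])
    qed (use g in simp)
    then show "\<exists>m. \<forall>n\<ge>m. g [^] a n \<in> U" by blast
  qed
  then have "zp_pow G T g a = z"
    unfolding zp_pow_def
    by (intro the_equality) (auto intro: limitin_Hausdorff_unique[OF _ _ _ Hausdorff])
  then show "limitin T (\<lambda>n. g [^] a n) (zp_pow G T g a) sequentially"
    "ereal (real n) \<le> \<omega> (inv (g [^] a n) \<otimes> zp_pow G T g a)"
    using lim z[of n] by (simp_all add: C_def)
qed

lemma zp_pow_closed_subgroup:
  assumes K: "subgroup K G" "closedin T K" and g: "g \<in> K" and a: "a \<in> padic_ints p"
  shows "zp_pow G T g a \<in> K"
proof (rule limitin_closedin[OF zp_pow_limit(1) K(2)])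
  have "g [^] n \<in> K" for n :: nat
    using K(1) g by (induction n) (auto simp: subgroup.one_closed subgroup.m_closed)
  then show "\<forall>\<^sub>F n in sequentially. g [^] a n \<in> K" by simp
qed (use assms subgroup.mem_carrier in auto)

lemma zp_pow_closed: "g \<in> carrier G \<Longrightarrow> a \<in> padic_ints p \<Longrightarrow> zp_pow G T g a \<in> carrier G"
  using zp_pow_closed_subgroup[OF subgroup_self] by (metis closedin_topspace topspace_carrier)

text \<open>Splits off the residue of the exponent modulo \<open>p\<close>. The rest is a
  \<open>p\<close>-th power, so any homomorphism into an abelian group sees, modulo
  \<open>p\<close>-th powers, only this residue.\<close>

lemma zp_pow_shift:
  assumes g: "g \<in> carrier G" and a: "a \<in> padic_ints p"
  shows "zp_pow G T g a = g [^] a 1 \<otimes> (zp_pow G T g (padic_shift p a)) [^] p"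
proof -
  let ?h = "zp_pow G T g (padic_shift p a)"
  have s: "padic_shift p a \<in> padic_ints p" by (rule padic_shift_closed[OF p_pos(1) a])
  have cont: "continuous_map T T (\<lambda>z. g [^] a 1 \<otimes> z [^] p)"
    using g by (intro continuous_mult continuous_pow continuous_const) auto
  have "limitin T ((\<lambda>z. g [^] a 1 \<otimes> z [^] p) \<circ> (\<lambda>n. g [^] padic_shift p a n)) (g [^] a 1 \<otimes> ?h [^] p) sequentially"
    by (rule continuous_map_limit[OF cont zp_pow_limit(1)[OF g s]])
  moreover have "(\<lambda>z. g [^] a 1 \<otimes> z [^] p) \<circ> (\<lambda>n. g [^] padic_shift p a n) = (\<lambda>n. g [^] a (Suc n))"
  proof
    fix n
    have "g [^] a (Suc n) = g [^] (a 1 + p * padic_shift p a n)"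
      by (rule arg_cong[OF padic_shift_eq[OF p_pos(1) a]])
    also have "\<dots> = g [^] a 1 \<otimes> (g [^] padic_shift p a n) [^] p"
      using g by (simp add: nat_pow_mult[symmetric] nat_pow_pow mult.commute)
    finally show "((\<lambda>z. g [^] a 1 \<otimes> z [^] p) \<circ> (\<lambda>n. g [^] padic_shift p a n)) n = g [^] a (Suc n)" by simp
  qed
  moreover have "limitin T (\<lambda>n. g [^] a (Suc n)) (zp_pow G T g a) sequentially"
    using zp_pow_limit(1)[OF g a] by (rule limitin_sequentially_offset[where k = 1, simplified])
  ultimately show ?thesis
    using limitin_Hausdorff_unique[OF _ _ _ Hausdorff] trivial_limit_sequentially by metis
qed

lemma zp_prod_Nil [simp]: "zp_prod G T y [] a = \<one>"
  and zp_prod_Cons [simp]: "zp_prod G T y (i # xs) a = zp_pow G T (y i) (a i) \<otimes> zp_prod G T y xs a"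
  by (simp_all add: zp_prod_def)

lemma zp_prod_closed_subgroup:
  assumes "subgroup K G" "closedin T K" "y ` set xs \<subseteq> K" "a ` set xs \<subseteq> padic_ints p"
  shows "zp_prod G T y xs a \<in> K"
  using assms(3,4)
  by (induction xs) (auto simp: subgroup.one_closed[OF assms(1)] intro: subgroup.m_closed[OF assms(1)] zp_pow_closed_subgroup[OF assms(1,2)])

lemma zp_prod_closed:
  "y ` set xs \<subseteq> carrier G \<Longrightarrow> a ` set xs \<subseteq> padic_ints p \<Longrightarrow> zp_prod G T y xs a \<in> carrier G"
  using zp_prod_closed_subgroup[OF subgroup_self] by (metis closedin_topspace topspace_carrier)

lemma zp_prod_append:
  assumes "y ` set (xs @ zs) \<subseteq> carrier G" "a ` set (xs @ zs) \<subseteq> padic_ints p"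
  shows "zp_prod G T y (xs @ zs) a = zp_prod G T y xs a \<otimes> zp_prod G T y zs a"
  using assms by (induction xs) (simp_all add: zp_prod_closed zp_pow_closed m_assoc image_Un)

text \<open>An open subgroup contains a ball, and by \<open>val_p_pow\<close> all
  \<open>p ^ n\<close>-th powers lie in it. Positivity of \<open>n\<close> guarantees
  \<open>1 < p ^ n\<close> later on.\<close>

lemma open_normal_contains_powers:
  assumes "N \<in> open_normals G T"
  obtains n where "0 < n" "\<And>x. x \<in> carrier G \<Longrightarrow> ereal (real n) \<le> \<omega> x \<Longrightarrow> x \<in> N"
proof -
  have "openin T N" "\<one> \<in> N" using open_normalD[OF assms] subgroup.one_closed by auto
  then obtain r where r: "{x \<in> carrier G. ereal r \<le> \<omega> x} \<subseteq> N"
    using topology unfolding induces_topology_def by blast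
  obtain n :: nat where n: "r \<le> real n" using real_arch_simple by blast
  have "x \<in> N" if "x \<in> carrier G" "ereal (real (Suc n)) \<le> \<omega> x" for x
  proof -
    have "ereal r \<le> ereal (real (Suc n))" using n by simp
    then show ?thesis using r that order_trans by blast
  qed
  then show thesis using that by blast
qed

end

section \<open>Isolated subgroups and the quotient by an isolated subgroup\<close>

lemma (in Group.group) coset_eq_iff:
  assumes "N \<lhd> G" "x \<in> carrier G"
  shows "N #> x = N \<longleftrightarrow> x \<in> N"
  using assms coset_join1 coset_join2 normal_imp_subgroup by metis

lemma (in Group.group) comm_group_Mod:
  assumes N: "N \<lhd> G" and D: "derived G (carrier G) \<subseteq> N"
  shows "comm_group (G Mod N)"
proof (rule group.group_comm_groupI[OF normal.factorgroup_is_group[OF N]])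
  interpret N: normal N G by (rule N)
  fix A B assume "A \<in> carrier (G Mod N)" "B \<in> carrier (G Mod N)"
  then obtain x y where xy: "x \<in> carrier G" "y \<in> carrier G" "A = N #> x" "B = N #> y"
    by (auto simp: carrier_FactGroup)
  have "x \<otimes> y \<otimes> inv x \<otimes> inv y \<in> N"
    using D xy unfolding derived_def by (auto intro: generate.incl)
  moreover have "x \<otimes> y = (x \<otimes> y \<otimes> inv x \<otimes> inv y) \<otimes> (y \<otimes> x)"
  proof -
    have "inv x \<otimes> (inv y \<otimes> (y \<otimes> x)) = \<one>" using xy by (metis inv_closed inv_solve_left l_inv m_closed)
    then show ?thesis using xy by (simp add: m_assoc)
  qed
  ultimately have "x \<otimes> y \<in> N #> (y \<otimes> x)" unfolding r_coset_def by blast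
  then have "N #> (y \<otimes> x) = N #> (x \<otimes> y)"
    using repr_independence[OF _ _ N.subgroup_axioms] xy by simp
  then show "A \<otimes>\<^bsub>G Mod N\<^esub> B = B \<otimes>\<^bsub>G Mod N\<^esub> A" using xy by (simp add: N.rcos_sum)
qed

context compact_group
begin

lemma isolated_normal_iff:
  "isolated_normal G T N \<longleftrightarrow>
     N \<lhd> G \<and> closedin T N \<and> (\<forall>x\<in>carrier G. \<forall>n::nat. 0 < n \<longrightarrow> x [^] n \<in> N \<longrightarrow> x \<in> N)"
  (is "_ \<longleftrightarrow> _ \<and> _ \<and> ?tf")
proof (cases "N \<lhd> G")
  case True
  then interpret N: normal N G .
  have "(\<forall>C\<in>carrier (G Mod N). \<forall>n::nat. n > 0 \<longrightarrow> C [^]\<^bsub>G Mod N\<^esub> n = \<one>\<^bsub>G Mod N\<^esub> \<longrightarrow> C = \<one>\<^bsub>G Mod N\<^esub>) \<longleftrightarrow> ?tf"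
    by (auto simp: carrier_FactGroup N.FactGroup_pow coset_eq_iff[OF True])
  then show ?thesis using True by (simp add: isolated_normal_def)
qed (simp add: isolated_normal_def)

lemma isolated_normal_carrier: "isolated_normal G T (carrier G)"
  unfolding isolated_normal_iff normal_inv_iff using subgroup_self closedin_topspace[of T] by simp

lemma isolated_hull_superset: "A \<subseteq> isolated_hull G T A"
  by (auto simp: isolated_hull_def)

lemma isolated_hull_subset: "A \<subseteq> carrier G \<Longrightarrow> isolated_hull G T A \<subseteq> carrier G"
  using isolated_normal_carrier by (auto simp: isolated_hull_def)

lemma isolated_normal_hull:
  assumes "A \<subseteq> carrier G" shows "isolated_normal G T (isolated_hull G T A)"
  unfolding isolated_normal_iff
proof (intro conjI ballI allI impI)
  let ?F = "{N. isolated_normal G T N \<and> A \<subseteq> N}"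
  have F: "carrier G \<in> ?F" using isolated_normal_carrier assms by blast
  have N: "N \<lhd> G" "subgroup N G" "closedin T N" if "N \<in> ?F" for N
    using that by (auto simp: isolated_normal_iff normal_imp_subgroup)
  show "isolated_hull G T A \<lhd> G"
    unfolding normal_inv_iff isolated_hull_def
  proof (intro conjI ballI)
    show "subgroup (\<Inter>?F) G" using N F by (intro subgroups_Inter) auto
    fix x h assume "x \<in> carrier G" "h \<in> \<Inter>?F"
    then show "x \<otimes> h \<otimes> inv x \<in> \<Inter>?F" using N(1) normal_inv_iff by blast
  qed
  show "closedin T (isolated_hull G T A)"
    unfolding isolated_hull_def using N F by (intro closedin_Inter) auto
  show "x \<in> isolated_hull G T A" if "x \<in> carrier G" "0 < n" "x [^] n \<in> isolated_hull G T A" for x and n :: nat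
    using that unfolding isolated_hull_def isolated_normal_iff by blast
qed

text \<open>The preimage under \<open>\<alpha>\<close> of a closed isolated normal subgroup
  containing \<open>A\<close> is another one, hence contains the hull.\<close>

lemma isolated_hull_image_subset:
  assumes \<alpha>: "\<alpha> \<in> hom G G" "continuous_map T T \<alpha>" and A: "A \<subseteq> carrier G" "\<alpha> ` A \<subseteq> A"
  shows "\<alpha> ` isolated_hull G T A \<subseteq> isolated_hull G T A"
proof (clarsimp simp: isolated_hull_def)
  interpret \<alpha>: group_hom G G \<alpha> using \<alpha>(1) by unfold_locales
  fix x N assume x: "\<forall>N. isolated_normal G T N \<and> A \<subseteq> N \<longrightarrow> x \<in> N"
    and N: "isolated_normal G T N" "A \<subseteq> N"
  let ?M = "{z \<in> carrier G. \<alpha> z \<in> N}"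
  have Ns: "subgroup N G" using N(1) by (simp add: isolated_normal_iff normal_imp_subgroup)
  have "isolated_normal G T ?M"
    unfolding isolated_normal_iff normal_inv_iff
  proof (intro conjI ballI allI impI)
    show "subgroup ?M G"
      by (rule subgroupI) (auto simp: subgroup.one_closed[OF Ns] subgroup.m_closed[OF Ns] subgroup.m_inv_closed[OF Ns])
    show "x \<otimes> h \<otimes> inv x \<in> ?M" if "x \<in> carrier G" "h \<in> ?M" for x h
      using that N(1) by (auto simp: isolated_normal_iff normal_inv_iff)
    have "closedin T {z \<in> topspace T. \<alpha> z \<in> N}"
      using \<alpha>(2) N(1) by (intro closedin_continuous_map_preimage) (auto simp: isolated_normal_iff)
    then show "closedin T ?M" by simp
    show "z \<in> ?M" if "z \<in> carrier G" "0 < n" "z [^] n \<in> ?M" for z and n :: nat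
      using that N(1) by (auto simp: isolated_normal_iff \<alpha>.hom_nat_pow)
  qed
  moreover have "A \<subseteq> ?M" using A N(2) by blast
  ultimately show "\<alpha> x \<in> N" using x by blast
qed

lemma isolated_hull_image:
  assumes \<alpha>: "\<alpha> \<in> iso G G" "homeomorphic_map T T \<alpha>" and A: "A \<subseteq> carrier G" "\<alpha> ` A = A"
  shows "\<alpha> ` isolated_hull G T A = isolated_hull G T A"
proof
  show "\<alpha> ` isolated_hull G T A \<subseteq> isolated_hull G T A"
    using isolated_hull_image_subset \<alpha> A by (auto simp: iso_def homeomorphic_imp_continuous_map)
  let ?\<beta> = "inv_into (carrier G) \<alpha>"
  have bij: "bij_betw \<alpha> (carrier G) (carrier G)" using \<alpha>(1) by (simp add: iso_def)
  have inv: "?\<beta> (\<alpha> x) = x" "\<alpha> (?\<beta> x) = x" "?\<beta> x \<in> carrier G" if "x \<in> carrier G" for x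
    using that bij by (auto simp: bij_betw_def f_inv_into_f inv_into_into)
  have "?\<beta> \<in> hom G G" using iso_set_sym[OF \<alpha>(1)] by (simp add: iso_def)
  \<comment> \<open>The inverse supplied by the homeomorphism agrees with \<open>inv_into\<close> on
    the carrier, which transfers continuity to the latter.\<close>
  moreover have "continuous_map T T ?\<beta>"
  proof -
    obtain g where g: "homeomorphic_maps T T \<alpha> g" using \<alpha>(2) homeomorphic_map_maps by blast
    have "g x = ?\<beta> x" if x: "x \<in> topspace T" for x
    proof -
      have "\<alpha> (g x) = x" "g x \<in> carrier G"
        using g x unfolding homeomorphic_maps_def continuous_map_def by (auto simp: Pi_iff)
      then show ?thesis using inv(1) by force
    qed
    then show ?thesis using g continuous_map_eq unfolding homeomorphic_maps_def by blast
  qed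
  moreover have "?\<beta> ` A \<subseteq> A"
  proof (clarsimp)
    fix x assume "x \<in> A"
    then obtain z where "z \<in> A" "x = \<alpha> z" using A(2) by auto
    then show "?\<beta> x \<in> A" using inv(1) A(1) by auto
  qed
  ultimately have sub: "?\<beta> ` isolated_hull G T A \<subseteq> isolated_hull G T A"
    using A(1) by (intro isolated_hull_image_subset)
  show "isolated_hull G T A \<subseteq> \<alpha> ` isolated_hull G T A"
  proof
    fix x assume x: "x \<in> isolated_hull G T A"
    then have "x = \<alpha> (?\<beta> x)" using inv(2) isolated_hull_subset[OF A(1)] by auto
    then show "x \<in> \<alpha> ` isolated_hull G T A" using x sub by blast
  qed
qed

lemma center_image:
  assumes "\<alpha> \<in> iso G G" shows "\<alpha> ` group_center G = group_center G"
proof -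
  have hom: "\<alpha> \<in> hom G G" and bij: "bij_betw \<alpha> (carrier G) (carrier G)" using assms by (auto simp: iso_def)
  have im: "\<alpha> ` carrier G = carrier G" and inj: "inj_on \<alpha> (carrier G)"
    using bij by (auto simp: bij_betw_def)
  have iff: "\<alpha> z \<in> group_center G \<longleftrightarrow> z \<in> group_center G" if z: "z \<in> carrier G" for z
  proof -
    have "\<alpha> z \<otimes> \<alpha> x = \<alpha> x \<otimes> \<alpha> z \<longleftrightarrow> z \<otimes> x = x \<otimes> z" if "x \<in> carrier G" for x
      using z that inj by (simp add: hom_mult[OF hom, symmetric] inj_on_eq_iff)
    then have "(\<forall>x\<in>\<alpha> ` carrier G. \<alpha> z \<otimes> x = x \<otimes> \<alpha> z) \<longleftrightarrow> (\<forall>x\<in>carrier G. z \<otimes> x = x \<otimes> z)" by simp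
    then show ?thesis using z im hom_in_carrier[OF hom] by (simp add: group_center_def)
  qed
  have sub: "group_center G \<subseteq> carrier G" by (auto simp: group_center_def)
  show ?thesis
  proof
    show "\<alpha> ` group_center G \<subseteq> group_center G" using iff sub by blast
    show "group_center G \<subseteq> \<alpha> ` group_center G"
    proof
      fix x assume x: "x \<in> group_center G"
      then obtain z where "z \<in> carrier G" "x = \<alpha> z" using sub im by blast
      then show "x \<in> \<alpha> ` group_center G" using x iff by blast
    qed
  qed
qed

lemma derived_image:
  assumes "\<alpha> \<in> iso G G" shows "\<alpha> ` derived G (carrier G) = derived G (carrier G)"
proof -
  interpret \<alpha>: group_hom G G \<alpha> using assms by unfold_locales (simp add: iso_def)
  have "\<alpha> ` carrier G = carrier G" using assms by (simp add: iso_def bij_betw_def)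
  then show ?thesis using \<alpha>.derived_img[of "carrier G"] by simp
qed

lemma isolated_hull_derived_center:
  fixes L defines "L \<equiv> isolated_hull G T (isolated_hull G T (derived G (carrier G)) \<union> group_center G)"
  shows "isolated_normal G T L" "derived G (carrier G) \<subseteq> L"
    and "\<alpha> \<in> iso G G \<Longrightarrow> homeomorphic_map T T \<alpha> \<Longrightarrow> \<alpha> ` L = L"
proof -
  have D: "derived G (carrier G) \<subseteq> carrier G" using derived_in_carrier by blast
  have A: "isolated_hull G T (derived G (carrier G)) \<union> group_center G \<subseteq> carrier G"
    using isolated_hull_subset[OF D] by (auto simp: group_center_def)
  show "isolated_normal G T L" unfolding L_def by (rule isolated_normal_hull[OF A])
  show "derived G (carrier G) \<subseteq> L" unfolding L_def using isolated_hull_superset by blast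
  assume \<alpha>: "\<alpha> \<in> iso G G" "homeomorphic_map T T \<alpha>"
  show "\<alpha> ` L = L" unfolding L_def
    by (rule isolated_hull_image[OF \<alpha> A]) (simp add: image_Un isolated_hull_image[OF \<alpha> D derived_image[OF \<alpha>(1)]] center_image[OF \<alpha>(1)])
qed

lemma image_coset:
  assumes \<alpha>: "\<alpha> \<in> iso G G" and L: "L \<subseteq> carrier G" "\<alpha> ` L = L" and x: "x \<in> carrier G"
  shows "\<alpha> ` (L #> x) = L #> \<alpha> x"
proof -
  have hom: "\<alpha> \<in> hom G G" using \<alpha> by (simp add: iso_def)
  have "\<alpha> ` (L #> x) = (\<lambda>h. \<alpha> h \<otimes> \<alpha> x) ` L"
    using L(1) x by (auto simp: r_coset_def image_iff hom_mult[OF hom] subset_iff intro!: bexI)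
  also have "\<dots> = (\<lambda>h. h \<otimes> \<alpha> x) ` (\<alpha> ` L)" by (simp add: image_image)
  finally show ?thesis using L(2) by (auto simp: r_coset_def)
qed

end

context p_valued_group
begin

section \<open>Automorphisms that are the identity modulo \<open>p\<close> on the quotient by
  \<open>L\<close>\<close>

context
  fixes L l d y \<sigma> c
  assumes L: "isolated_normal G T L" "derived G (carrier G) \<subseteq> L"
    and \<sigma>: "\<sigma> \<in> iso G G" "\<sigma> ` L = L"
    and y: "y ` {1..d} \<subseteq> carrier G" "y ` {l<..d} \<subseteq> L" and ld: "l \<le> d"
    and gen: "\<And>x. x \<in> carrier G \<Longrightarrow> \<exists>a. a ` {1..d} \<subseteq> padic_ints p \<and> x = zp_prod G T y [1..<Suc d] a"
    and c: "\<And>i. i \<in> {1..l} \<Longrightarrow> c i ` {1..d} \<subseteq> padic_ints p"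
      "\<And>i. i \<in> {1..l} \<Longrightarrow> \<sigma> (y i) = zp_prod G T y [1..<Suc d] (c i)"
      "\<And>i m. i \<in> {1..l} \<Longrightarrow> m \<in> {1..l} \<Longrightarrow> c i m 1 = unit_entry m i"
begin

abbreviation "quotL \<equiv> G Mod L"
abbreviation "proj x \<equiv> L #> x"

lemma L_facts: "L \<lhd> G" "subgroup L G" "closedin T L" "L \<subseteq> carrier G"
  using L(1) normal_imp_subgroup subgroup.subset unfolding isolated_normal_iff by blast+

lemma \<sigma>_hom: "\<sigma> \<in> hom G G" using \<sigma>(1) by (simp add: iso_def)

lemma comm_quotL: "comm_group quotL" by (rule comm_group_Mod[OF L_facts(1) L(2)])

lemma proj_L: "x \<in> L \<Longrightarrow> proj x = \<one>\<^bsub>quotL\<^esub>"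
  using coset_eq_iff[OF L_facts(1)] L_facts(4) by auto

lemma proj_hom: "group_hom G quotL proj"
  by (intro group_hom.intro group_hom_axioms.intro is_group comm_group.axioms(2)[OF comm_quotL] normal.r_coset_hom_Mod[OF L_facts(1)])

text \<open>The factors with index above \<open>l\<close> form an element of the closed subgroup
  \<open>L\<close> and disappear in the quotient.\<close>

lemma image_coset_basis:
  assumes "i \<in> {1..l}"
  shows "\<sigma> ` proj (y i) = proj (zp_prod G T y [1..<Suc l] (c i))"
proof -
  interpret proj: group_hom G quotL proj by (rule proj_hom)
  have set: "set [1..<Suc l] = {1..l}" "set [1..<Suc d] = {1..d}" "set [Suc l..<Suc d] = {l<..d}" by auto
  have split: "[1..<Suc d] = [1..<Suc l] @ [Suc l..<Suc d]"
    using ld upt_add_eq_append[of 1 "Suc l" "d - l"] by simp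
  have yi: "y i \<in> carrier G" using assms y(1) ld by auto
  have cl: "zp_prod G T y [1..<Suc l] (c i) \<in> carrier G"
    by (rule zp_prod_closed) (use y(1) c(1)[OF assms] ld in \<open>auto simp: set simp del: upt_Suc\<close>)
  have cL: "zp_prod G T y [Suc l..<Suc d] (c i) \<in> L"
    by (rule zp_prod_closed_subgroup[OF L_facts(2,3)]) (use y(2) c(1)[OF assms] in \<open>auto simp: set simp del: upt_Suc\<close>)
  have "\<sigma> ` proj (y i) = proj (\<sigma> (y i))" by (rule image_coset[OF \<sigma>(1) L_facts(4) \<sigma>(2) yi])
  also have "\<sigma> (y i) = zp_prod G T y [1..<Suc l] (c i) \<otimes> zp_prod G T y [Suc l..<Suc d] (c i)"
    unfolding c(2)[OF assms] split
    by (rule zp_prod_append) (use y(1) c(1)[OF assms] in \<open>simp_all only: split[symmetric] set\<close>)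
  also have "proj \<dots> = proj (zp_prod G T y [1..<Suc l] (c i)) \<otimes>\<^bsub>quotL\<^esub> proj (zp_prod G T y [Suc l..<Suc d] (c i))"
    by (rule proj.hom_mult) (use cl cL L_facts(4) in auto)
  also have "proj (zp_prod G T y [Suc l..<Suc d] (c i)) = \<one>\<^bsub>quotL\<^esub>"
    by (rule proj_L[OF cL])
  finally show ?thesis using cl by (simp del: mult_FactGroup one_FactGroup)
qed

text \<open>By \<open>zp_pow_shift\<close> each factor counts modulo \<open>p\<close>-th powers only
  through the residue of its exponent, which is 1 for \<open>m = i\<close> and 0 for the other
  \<open>m \<le> l\<close>; the factors beyond \<open>l\<close> lie in \<open>L\<close>.\<close>

lemma proj_zp_prod:
  assumes i: "i \<in> {1..l}" and xs: "distinct xs" "set xs \<subseteq> {1..d}"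
  shows "\<exists>u. is_power quotL p u \<and> proj (zp_prod G T y xs (c i)) = (if i \<in> set xs then proj (y i) else \<one>\<^bsub>quotL\<^esub>) \<otimes>\<^bsub>quotL\<^esub> u"
  using xs
proof (induction xs)
  interpret quotL: comm_group quotL by (rule comm_quotL)
  interpret proj: group_hom G quotL proj by (rule proj_hom)
  case Nil
  show ?case by (rule exI[of _ "\<one>\<^bsub>quotL\<^esub>"]) (simp add: quotL.is_power_one del: one_FactGroup mult_FactGroup)
next
  interpret quotL: comm_group quotL by (rule comm_quotL)
  interpret proj: group_hom G quotL proj by (rule proj_hom)
  case (Cons m xs)
  then obtain u where u: "is_power quotL p u"
      "proj (zp_prod G T y xs (c i)) = (if i \<in> set xs then proj (y i) else \<one>\<^bsub>quotL\<^esub>) \<otimes>\<^bsub>quotL\<^esub> u" by auto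
  have m: "m \<in> {1..d}" "m \<notin> set xs" using Cons.prems by auto
  have ym: "y m \<in> carrier G" and cm: "c i m \<in> padic_ints p" using m y(1) c(1)[OF i] by auto
  have yi: "proj (y i) \<in> carrier quotL" using i ld y(1) by (intro proj.hom_closed) auto
  have pm: "\<exists>v. is_power quotL p v \<and> proj (zp_pow G T (y m) (c i m)) = (if m = i then proj (y i) else \<one>\<^bsub>quotL\<^esub>) \<otimes>\<^bsub>quotL\<^esub> v"
  proof (cases "m \<le> l")
    case True
    let ?h = "zp_pow G T (y m) (padic_shift p (c i m))"
    have h: "?h \<in> carrier G" by (rule zp_pow_closed[OF ym padic_shift_closed[OF p_pos(1) cm]])
    have "zp_pow G T (y m) (c i m) = y m [^] unit_entry m i \<otimes> ?h [^] p"
      using zp_pow_shift[OF ym cm] c(3)[OF i, of m] m True by simp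
    then have "proj (zp_pow G T (y m) (c i m)) = proj (y m [^] unit_entry m i) \<otimes>\<^bsub>quotL\<^esub> (proj ?h [^]\<^bsub>quotL\<^esub> p)"
      using ym h by (simp only: proj.hom_mult proj.hom_nat_pow nat_pow_closed)
    moreover have "proj (y m [^] unit_entry m i) = (if m = i then proj (y i) else \<one>\<^bsub>quotL\<^esub>)"
      using ym proj.hom_one by (auto simp: unit_entry_def simp del: one_FactGroup)
    moreover have "is_power quotL p (proj ?h [^]\<^bsub>quotL\<^esub> p)" using h proj.hom_closed by (auto simp: is_power_def)
    ultimately show ?thesis by auto
  next
    case False
    then have "zp_pow G T (y m) (c i m) \<in> L"
      using m y(2) cm by (intro zp_pow_closed_subgroup[OF L_facts(2,3)]) auto
    then have "proj (zp_pow G T (y m) (c i m)) = \<one>\<^bsub>quotL\<^esub>" by (rule proj_L)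
    moreover have "m \<noteq> i" using False i by auto
    ultimately show ?thesis using quotL.is_power_one
      by (intro exI[of _ "\<one>\<^bsub>quotL\<^esub>"]) (simp del: one_FactGroup mult_FactGroup)
  qed
  then obtain v where v: "is_power quotL p v"
      "proj (zp_pow G T (y m) (c i m)) = (if m = i then proj (y i) else \<one>\<^bsub>quotL\<^esub>) \<otimes>\<^bsub>quotL\<^esub> v" by blast
  have uv: "u \<in> carrier quotL" "v \<in> carrier quotL" using u v quotL.is_power_closed by blast+
  have "zp_prod G T y xs (c i) \<in> carrier G"
  proof (rule zp_prod_closed)
    have "set xs \<subseteq> {1..d}" using Cons.prems by simp
    then show "y ` set xs \<subseteq> carrier G" "c i ` set xs \<subseteq> padic_ints p" using y(1) c(1)[OF i] by blast+
  qed
  then have "proj (zp_prod G T y (m # xs) (c i)) = proj (zp_pow G T (y m) (c i m)) \<otimes>\<^bsub>quotL\<^esub> proj (zp_prod G T y xs (c i))"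
    using zp_pow_closed[OF ym cm] by (simp only: zp_prod_Cons proj.hom_mult)
  also have "\<dots> = (if i \<in> set (m # xs) then proj (y i) else \<one>\<^bsub>quotL\<^esub>) \<otimes>\<^bsub>quotL\<^esub> (v \<otimes>\<^bsub>quotL\<^esub> u)"
    unfolding u(2) v(2) using uv yi m(2) by (auto simp: quotL.m_ac simp del: one_FactGroup mult_FactGroup)
  finally show ?case using quotL.is_power_mult[OF v(1) u(1)] by blast
qed

text \<open>Because the quotient is abelian, \<open>\<kappa>\<close>, the quotient of
  \<open>\<sigma> x\<close> by \<open>x\<close> modulo \<open>L\<close>, is a homomorphism. It takes
  \<open>p\<close>-th powers as values on the basis; \<open>zp_pow_shift\<close> extends this to
  p-adic powers, and products of these exhaust the group.\<close>

lemma image_coset_cong: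
  assumes "x \<in> carrier G"
  shows "is_power quotL p (proj (\<sigma> x) \<otimes>\<^bsub>quotL\<^esub> inv\<^bsub>quotL\<^esub> proj x)"
proof -
  interpret quotL: comm_group quotL by (rule comm_quotL)
  interpret proj: group_hom G quotL proj by (rule proj_hom)
  define \<kappa> where "\<kappa> = (\<lambda>x. proj (\<sigma> x) \<otimes>\<^bsub>quotL\<^esub> inv\<^bsub>quotL\<^esub> proj x)"
  have hom: "\<kappa> \<in> hom G quotL"
  proof (rule homI)
    show "\<kappa> x \<in> carrier quotL" if "x \<in> carrier G" for x
      using that hom_in_carrier[OF \<sigma>_hom that] unfolding \<kappa>_def by (intro quotL.m_closed quotL.inv_closed proj.hom_closed)
    show "\<kappa> (x \<otimes> z) = \<kappa> x \<otimes>\<^bsub>quotL\<^esub> \<kappa> z" if xz: "x \<in> carrier G" "z \<in> carrier G" for x z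
    proof -
      have "proj (\<sigma> x) \<in> carrier quotL" "proj (\<sigma> z) \<in> carrier quotL" "proj x \<in> carrier quotL" "proj z \<in> carrier quotL"
        using xz hom_in_carrier[OF \<sigma>_hom] by (auto intro!: proj.hom_closed)
      then show ?thesis
        unfolding \<kappa>_def hom_mult[OF \<sigma>_hom xz] using xz hom_in_carrier[OF \<sigma>_hom]
        by (simp only: proj.hom_mult quotL.inv_mult_group quotL.m_ac quotL.m_closed quotL.inv_closed)
    qed
  qed
  interpret \<kappa>: group_hom G quotL \<kappa> using hom by unfold_locales
  have one: "is_power quotL p (\<kappa> x)" if x: "x \<in> L" for x
  proof -
    have "x \<in> carrier G" "\<sigma> x \<in> L" using x L_facts(4) \<sigma>(2) by auto
    then have "proj x = \<one>\<^bsub>quotL\<^esub>" "proj (\<sigma> x) = \<one>\<^bsub>quotL\<^esub>"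
      using x by (simp_all only: proj_L)
    then have "\<kappa> x = \<one>\<^bsub>quotL\<^esub>" unfolding \<kappa>_def by (simp del: one_FactGroup mult_FactGroup)
    then show ?thesis using quotL.is_power_one by simp
  qed
  have basis: "is_power quotL p (\<kappa> (y i))" if i: "i \<in> {1..d}" for i
  proof (cases "i \<le> l")
    case True
    then have il: "i \<in> {1..l}" using i by simp
    have "\<exists>u. is_power quotL p u \<and> proj (\<sigma> (y i)) = proj (y i) \<otimes>\<^bsub>quotL\<^esub> u"
      using proj_zp_prod[OF il, of "[1..<Suc d]"] i c(2)[OF il]
      by (simp add: atLeastLessThanSuc_atLeastAtMost del: one_FactGroup mult_FactGroup upt_Suc)
    then obtain u where u: "is_power quotL p u" "proj (\<sigma> (y i)) = proj (y i) \<otimes>\<^bsub>quotL\<^esub> u" by blast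
    have "proj (y i) \<in> carrier quotL" using i y(1) by (auto intro!: proj.hom_closed)
    then have "\<kappa> (y i) = u" unfolding \<kappa>_def u(2) using quotL.is_power_closed[OF u(1)]
      by (metis quotL.inv_solve_right quotL.m_closed quotL.m_comm)
    then show ?thesis using u by simp
  next
    case False
    then have "i \<in> {l<..d}" using i by simp
    then show ?thesis using one y(2) by blast
  qed
  have pow: "is_power quotL p (\<kappa> (zp_pow G T g a))"
    if g: "g \<in> carrier G" "is_power quotL p (\<kappa> g)" and a: "a \<in> padic_ints p" for g a
  proof -
    let ?h = "zp_pow G T g (padic_shift p a)"
    have h: "?h \<in> carrier G" by (rule zp_pow_closed[OF g(1) padic_shift_closed[OF p_pos(1) a]])
    have "\<kappa> (zp_pow G T g a) = \<kappa> g [^]\<^bsub>quotL\<^esub> a 1 \<otimes>\<^bsub>quotL\<^esub> \<kappa> ?h [^]\<^bsub>quotL\<^esub> p"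
      unfolding zp_pow_shift[OF g(1) a] using g(1) h by (simp only: \<kappa>.hom_mult \<kappa>.hom_nat_pow nat_pow_closed)
    moreover have "is_power quotL p (\<kappa> ?h [^]\<^bsub>quotL\<^esub> p)" using h \<kappa>.hom_closed by (auto simp: is_power_def)
    ultimately show ?thesis using quotL.is_power_mult[OF quotL.is_power_pow[OF g(2)]] by simp
  qed
  have prod: "is_power quotL p (\<kappa> (zp_prod G T y xs a))"
    if "set xs \<subseteq> {1..d}" "a ` {1..d} \<subseteq> padic_ints p" for xs a
    using that(1)
  proof (induction xs)
    case Nil then show ?case using \<kappa>.hom_one quotL.is_power_one by (simp del: one_FactGroup)
  next
    case (Cons m xs)
    have xs: "set xs \<subseteq> {1..d}" "m \<in> {1..d}" using Cons.prems by simp_all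
    have ym: "y m \<in> carrier G" "a m \<in> padic_ints p" using xs y(1) that(2) by blast+
    have "zp_prod G T y xs a \<in> carrier G"
      by (rule zp_prod_closed) (use xs y(1) that(2) in blast)+
    moreover have "zp_pow G T (y m) (a m) \<in> carrier G" by (rule zp_pow_closed[OF ym])
    ultimately have "\<kappa> (zp_prod G T y (m # xs) a) = \<kappa> (zp_pow G T (y m) (a m)) \<otimes>\<^bsub>quotL\<^esub> \<kappa> (zp_prod G T y xs a)"
      by (simp only: zp_prod_Cons \<kappa>.hom_mult)
    then show ?case using quotL.is_power_mult[OF pow[OF ym(1) basis[OF xs(2)] ym(2)] Cons.IH[OF xs(1)]] by simp
  qed
  obtain a where "a ` {1..d} \<subseteq> padic_ints p" "x = zp_prod G T y [1..<Suc d] a" using gen[OF assms] by blast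
  then have "is_power quotL p (\<kappa> x)" using prod[of "[1..<Suc d]" a] by (simp add: atLeastLessThanSuc_atLeastAtMost del: upt_Suc)
  then show ?thesis by (simp only: \<kappa>_def)
qed

text \<open>If the class of \<open>x\<close> is a \<open>p ^ r\<close>-th power, then
  \<open>x\<close> equals a \<open>p ^ r\<close>-th power up to a factor in \<open>L\<close>, so it
  has distance level at least \<open>r\<close> from \<open>L\<close>. For all \<open>r\<close>
  together this puts \<open>x\<close> into the closed set \<open>L\<close>.\<close>

lemma quotient_separated:
  assumes "C \<in> carrier quotL" "\<And>r. is_power quotL (p ^ r) C"
  shows "C = \<one>\<^bsub>quotL\<^esub>"
proof -
  interpret proj: group_hom G quotL proj by (rule proj_hom)
  obtain x where x: "x \<in> carrier G" "C = proj x" using assms(1) by (auto simp: carrier_FactGroup)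
  have "\<exists>k\<in>L. ereal (real r) \<le> \<omega> (inv k \<otimes> x)" for r
  proof -
    obtain h where h: "h \<in> carrier G" "proj x = proj h [^]\<^bsub>quotL\<^esub> (p ^ r)"
      using assms(2)[of r] x by (auto simp: is_power_def carrier_FactGroup)
    then have "proj x = proj (h [^] (p ^ r))" by (simp only: proj.hom_nat_pow)
    then have "x \<in> proj (h [^] (p ^ r))" using rcos_self[OF x(1) L_facts(2)] by simp
    then obtain k where k: "k \<in> L" "x = k \<otimes> h [^] (p ^ r)" by (auto simp: r_coset_def)
    then have "inv k \<otimes> x = h [^] (p ^ r)" using h L_facts(4) by (auto simp: m_assoc[symmetric])
    then show ?thesis using k(1) val_p_pow[OF h(1)] by metis
  qed
  then have "x \<in> L" using closed_approx[OF L_facts(3) x(1)] by blast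
  then show ?thesis using x coset_eq_iff[OF L_facts(1)] by simp
qed

lemma quotient_finite_order:
  assumes "2 < p"
  shows "(\<exists>n>0. \<forall>C\<in>carrier quotL. ((`) \<sigma> ^^ n) C = C) \<longleftrightarrow> (\<forall>C\<in>carrier quotL. \<sigma> ` C = C)"
proof
  assume "\<forall>C\<in>carrier quotL. \<sigma> ` C = C"
  then show "\<exists>n>0. \<forall>C\<in>carrier quotL. ((`) \<sigma> ^^ n) C = C" by (intro exI[of _ 1]) simp
next
  interpret quotL: comm_group quotL by (rule comm_quotL)
  interpret proj: group_hom G quotL proj by (rule proj_hom)
  assume "\<exists>n>0. \<forall>C\<in>carrier quotL. ((`) \<sigma> ^^ n) C = C"
  then obtain n where n: "0 < n" "\<And>C. C \<in> carrier quotL \<Longrightarrow> ((`) \<sigma> ^^ n) C = C" by blast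
  note im = image_coset[OF \<sigma>(1) L_facts(4) \<sigma>(2)]
  have hom: "(`) \<sigma> \<in> hom quotL quotL"
  proof (rule homI)
    show "\<sigma> ` C \<in> carrier quotL" if "C \<in> carrier quotL" for C
      using that hom_in_carrier[OF \<sigma>_hom] by (auto simp: carrier_FactGroup im)
    show "\<sigma> ` (C \<otimes>\<^bsub>quotL\<^esub> D) = \<sigma> ` C \<otimes>\<^bsub>quotL\<^esub> \<sigma> ` D" if CD: "C \<in> carrier quotL" "D \<in> carrier quotL" for C D
    proof -
      obtain x z where xz: "x \<in> carrier G" "z \<in> carrier G" "C = proj x" "D = proj z"
        using CD by (auto simp: carrier_FactGroup)
      then show ?thesis
        using hom_in_carrier[OF \<sigma>_hom] by (simp only: proj.hom_mult[symmetric] im m_closed hom_mult[OF \<sigma>_hom])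
    qed
  qed
  have tf: "C = \<one>\<^bsub>quotL\<^esub>" if "C \<in> carrier quotL" "0 < n" "C [^]\<^bsub>quotL\<^esub> n = \<one>\<^bsub>quotL\<^esub>" for C and n :: nat
    using L(1) that unfolding isolated_normal_def by blast
  have cong: "\<exists>u. is_power quotL p u \<and> \<sigma> ` C = C \<otimes>\<^bsub>quotL\<^esub> u" if C: "C \<in> carrier quotL" for C
  proof -
    obtain x where x: "x \<in> carrier G" "C = proj x" using C by (auto simp: carrier_FactGroup)
    have "C \<otimes>\<^bsub>quotL\<^esub> (proj (\<sigma> x) \<otimes>\<^bsub>quotL\<^esub> inv\<^bsub>quotL\<^esub> proj x) = proj (\<sigma> x)"
      unfolding x(2) using proj.hom_closed[OF x(1)] proj.hom_closed[OF hom_in_carrier[OF \<sigma>_hom x(1)]]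
      by (metis quotL.inv_closed quotL.inv_solve_right quotL.m_closed quotL.m_comm)
    then show ?thesis using image_coset_cong[OF x(1)] x im by metis
  qed
  show "\<forall>C\<in>carrier quotL. \<sigma> ` C = C"
  proof
    fix C assume C: "C \<in> carrier quotL"
    show "\<sigma> ` C = C"
      by (rule quotL.finite_order_trivial[OF prime_p assms n(1) tf quotient_separated hom cong n(2) C])
  qed
qed

end

end

section \<open>Completed group rings\<close>

text \<open>The ring record of the completed group ring has no scalar multiplication; this supplies
  the \<open>k\<close>-linear combinations.\<close>

definition cgr_lin :: "'k::field \<Rightarrow> ('g, 'k) cgr \<Rightarrow> 'k \<Rightarrow> ('g, 'k) cgr \<Rightarrow> ('g, 'k) cgr" where
  "cgr_lin s \<mu> s' \<nu> = (\<lambda>N C. s * \<mu> N C + s' * \<nu> N C)"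

context compact_group
begin

abbreviation cgr_ring :: "('g, 'k::field) cgr ring" where
  "cgr_ring \<equiv> completed_group_ring G T"

lemma open_normal_group: "N \<in> open_normals G T \<Longrightarrow> Group.group (G Mod N)"
  using open_normalD(1) normal.factorgroup_is_group by blast

lemma cgr_add: "\<mu> \<oplus>\<^bsub>cgr_ring\<^esub> \<nu> = (\<lambda>N C. \<mu> N C + \<nu> N C)"
  by (simp add: completed_group_ring_def)

lemma cgr_zero: "\<zero>\<^bsub>cgr_ring\<^esub> = (\<lambda>N C. 0)"
  by (simp add: completed_group_ring_def)

lemma cgr_mult:
  "(\<mu> \<otimes>\<^bsub>cgr_ring\<^esub> \<nu>) N C = (if N \<in> open_normals G T \<and> C \<in> carrier (G Mod N)
     then \<Sum>B\<in>carrier (G Mod N). \<mu> N B * \<nu> N (inv\<^bsub>G Mod N\<^esub> B \<otimes>\<^bsub>G Mod N\<^esub> C) else 0)"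
  by (simp add: completed_group_ring_def finite_group_algebra_def)

lemma cgr_mult_cong:
  "\<mu> N = \<mu>' N \<Longrightarrow> \<nu> N = \<nu>' N \<Longrightarrow> (\<mu> \<otimes>\<^bsub>cgr_ring\<^esub> \<nu>) N = (\<mu>' \<otimes>\<^bsub>cgr_ring\<^esub> \<nu>') N"
  by (simp add: fun_eq_iff cgr_mult)

text \<open>The sum is required only in the component at \<open>N\<close>: the expansions to be
  multiplied are finite there, though infinite in the ring.\<close>

lemma cgr_mult_sum_left:
  fixes \<mu> \<nu> :: "('g, 'k::field) cgr"
  shows "(\<And>C. \<mu> N C = (\<Sum>i\<in>I. s i * f i N C)) \<Longrightarrow>
     (\<mu> \<otimes>\<^bsub>cgr_ring\<^esub> \<nu>) N C = (\<Sum>i\<in>I. s i * (f i \<otimes>\<^bsub>cgr_ring\<^esub> \<nu>) N C)"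
proof (cases "N \<in> open_normals G T \<and> C \<in> carrier (G Mod N)")
  case False
  then have "(a \<otimes>\<^bsub>cgr_ring\<^esub> b) N C = 0" for a b :: "('g, 'k) cgr"
    unfolding cgr_mult by (rule if_not_P)
  then show ?thesis by (simp only: mult_zero_right sum.neutral_const)
qed (simp add: cgr_mult sum_distrib_right sum_distrib_left mult_ac sum.swap[of _ I])

lemma cgr_mult_sum_right:
  fixes \<mu> \<nu> :: "('g, 'k::field) cgr"
  shows "(\<And>C. \<nu> N C = (\<Sum>i\<in>I. s i * f i N C)) \<Longrightarrow>
     (\<mu> \<otimes>\<^bsub>cgr_ring\<^esub> \<nu>) N C = (\<Sum>i\<in>I. s i * (\<mu> \<otimes>\<^bsub>cgr_ring\<^esub> f i) N C)"
proof (cases "N \<in> open_normals G T \<and> C \<in> carrier (G Mod N)")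
  case False
  then have "(a \<otimes>\<^bsub>cgr_ring\<^esub> b) N C = 0" for a b :: "('g, 'k) cgr"
    unfolding cgr_mult by (rule if_not_P)
  then show ?thesis by (simp only: mult_zero_right sum.neutral_const)
qed (simp add: cgr_mult sum_distrib_right sum_distrib_left mult_ac sum.swap[of _ I])

lemma cgr_mult_lin_left:
  "cgr_lin s \<mu> s' \<mu>' \<otimes>\<^bsub>cgr_ring\<^esub> \<nu> = cgr_lin s (\<mu> \<otimes>\<^bsub>cgr_ring\<^esub> \<nu>) s' (\<mu>' \<otimes>\<^bsub>cgr_ring\<^esub> \<nu>)"
  by (simp add: fun_eq_iff cgr_mult cgr_lin_def sum.distrib sum_distrib_left algebra_simps)

lemma cgr_mult_zero_right: "\<nu> N = (\<lambda>_. 0) \<Longrightarrow> (\<mu> \<otimes>\<^bsub>cgr_ring\<^esub> \<nu>) N = (\<lambda>_. 0)"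
  and cgr_mult_zero_left: "\<mu> N = (\<lambda>_. 0) \<Longrightarrow> (\<mu> \<otimes>\<^bsub>cgr_ring\<^esub> \<nu>) N = (\<lambda>_. 0)"
  by (simp_all add: fun_eq_iff cgr_mult)

lemma cgr_carrier:
  "\<mu> \<in> carrier cgr_ring \<longleftrightarrow> (\<forall>N. N \<notin> open_normals G T \<longrightarrow> \<mu> N = (\<lambda>_. 0))
        \<and> (\<forall>N\<in>open_normals G T. \<forall>C. C \<notin> carrier (G Mod N) \<longrightarrow> \<mu> N C = 0)
        \<and> (\<forall>N\<in>open_normals G T. \<forall>M\<in>open_normals G T. N \<subseteq> M \<longrightarrow>
             (\<forall>C\<in>carrier (G Mod M). \<mu> M C = (\<Sum>D | D \<in> carrier (G Mod N) \<and> D \<subseteq> C. \<mu> N D)))"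
  by (simp add: completed_group_ring_def finite_group_algebra_def)

lemma cgr_compat:
  assumes "\<mu> \<in> carrier cgr_ring" "N \<in> open_normals G T" "M \<in> open_normals G T" "N \<subseteq> M" "C \<in> carrier (G Mod M)"
  shows "\<mu> M C = (\<Sum>D | D \<in> carrier (G Mod N) \<and> D \<subseteq> C. \<mu> N D)"
  using assms(1)[unfolded cgr_carrier, THEN conjunct2, THEN conjunct2] assms(2-) by fast

lemma cgr_support:
  assumes "\<mu> \<in> carrier cgr_ring"
  shows "N \<notin> open_normals G T \<Longrightarrow> \<mu> N = (\<lambda>_. 0)"
    and "N \<in> open_normals G T \<Longrightarrow> C \<notin> carrier (G Mod N) \<Longrightarrow> \<mu> N C = 0"
  using assms[unfolded cgr_carrier, THEN conjunct1] assms[unfolded cgr_carrier, THEN conjunct2, THEN conjunct1] by fast+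

lemma cgr_lin_closed:
  assumes "\<mu> \<in> carrier cgr_ring" "\<nu> \<in> carrier cgr_ring"
  shows "cgr_lin s \<mu> s' \<nu> \<in> carrier cgr_ring"
  unfolding cgr_carrier
proof (intro conjI allI ballI impI)
  fix N M C assume NM: "N \<in> open_normals G T" "M \<in> open_normals G T" "N \<subseteq> M" "C \<in> carrier (G Mod M)"
  then show "cgr_lin s \<mu> s' \<nu> M C = (\<Sum>D | D \<in> carrier (G Mod N) \<and> D \<subseteq> C. cgr_lin s \<mu> s' \<nu> N D)"
    by (simp only: cgr_lin_def sum.distrib sum_distrib_left cgr_compat[OF assms(1) NM] cgr_compat[OF assms(2) NM])
qed (simp_all add: cgr_lin_def cgr_support[OF assms(1)] cgr_support[OF assms(2)])

lemma coset_subset_iff: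
  assumes "N \<in> open_normals G T" "M \<in> open_normals G T" "N \<subseteq> M" "g \<in> carrier G" "C \<in> carrier (G Mod M)"
  shows "N #> g \<subseteq> C \<longleftrightarrow> C = M #> g"
proof
  assume "N #> g \<subseteq> C"
  then have "g \<in> C" using rcos_self[OF assms(4) open_normalD(3)[OF assms(1)]] by blast
  moreover obtain x where "x \<in> carrier G" "C = M #> x" using assms(5) by (auto simp: carrier_FactGroup)
  ultimately show "C = M #> g" using repr_independence open_normalD(3)[OF assms(2)] by blast
qed (use assms(3) in \<open>auto simp: r_coset_def\<close>)

lemma coset_in_Mod: "g \<in> carrier G \<Longrightarrow> N #> g \<in> carrier (G Mod N)"
  by (auto simp: carrier_FactGroup)

lemma cgr_of_closed:
  assumes "g \<in> carrier G" shows "cgr_of G T g \<in> carrier (cgr_ring :: ('g, 'k::field) cgr ring)"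
  unfolding cgr_carrier
proof (intro conjI allI ballI impI)
  fix N M C assume NM: "N \<in> open_normals G T" "M \<in> open_normals G T" "N \<subseteq> M" and C: "C \<in> carrier (G Mod M)"
  have fin: "finite {D. D \<in> carrier (G Mod N) \<and> D \<subseteq> C}" using finite_Mod[OF NM(1)] by simp
  have "(\<Sum>D | D \<in> carrier (G Mod N) \<and> D \<subseteq> C. cgr_of G T g N D :: 'k)
      = (\<Sum>D | D \<in> carrier (G Mod N) \<and> D \<subseteq> C. if D = N #> g then 1 else 0)"
    using NM by (intro sum.cong) (auto simp: cgr_of_def)
  also have "\<dots> = (if N #> g \<subseteq> C then 1 else 0)"
    using fin coset_in_Mod[OF assms] by (simp add: sum.delta')
  finally show "cgr_of G T g M C = (\<Sum>D | D \<in> carrier (G Mod N) \<and> D \<subseteq> C. cgr_of G T g N D :: 'k)"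
    using coset_subset_iff[OF NM assms C] NM(2) by (simp add: cgr_of_def)
qed (auto simp: cgr_of_def coset_in_Mod[OF assms])

lemma cgr_of_one: "cgr_of G T \<one> = \<one>\<^bsub>cgr_ring\<^esub>"
  using open_normalD(4) by (auto simp: cgr_of_def completed_group_ring_def finite_group_algebra_def fun_eq_iff)

lemma cgr_of_mult:
  assumes "g \<in> carrier G" "h \<in> carrier G"
  shows "cgr_of G T g \<otimes>\<^bsub>cgr_ring\<^esub> cgr_of G T h = (cgr_of G T (g \<otimes> h) :: ('g, 'k::field) cgr)"
proof (intro ext)
  fix N C
  show "(cgr_of G T g \<otimes>\<^bsub>cgr_ring\<^esub> cgr_of G T h) N C = (cgr_of G T (g \<otimes> h) N C :: 'k)"
  proof (cases "N \<in> open_normals G T \<and> C \<in> carrier (G Mod N)")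
    case True
    then have N: "N \<in> open_normals G T" and C: "C \<in> carrier (G Mod N)" by auto
    interpret Mod: Group.group "G Mod N" by (rule open_normal_group[OF N])
    interpret N: normal N G by (rule open_normalD(1)[OF N])
    have "(cgr_of G T g \<otimes>\<^bsub>cgr_ring\<^esub> cgr_of G T h) N C
        = (\<Sum>B\<in>carrier (G Mod N). if B = N #> g then cgr_of G T h N (inv\<^bsub>G Mod N\<^esub> B \<otimes>\<^bsub>G Mod N\<^esub> C) else (0::'k))"
      unfolding cgr_mult using N C by (auto intro!: sum.cong simp: cgr_of_def)
    also have "\<dots> = cgr_of G T h N (inv\<^bsub>G Mod N\<^esub> (N #> g) \<otimes>\<^bsub>G Mod N\<^esub> C)"
      using finite_Mod[OF N] coset_in_Mod[OF assms(1)] by (simp add: sum.delta)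
    also have "inv\<^bsub>G Mod N\<^esub> (N #> g) \<otimes>\<^bsub>G Mod N\<^esub> C = N #> h \<longleftrightarrow> C = (N #> g) \<otimes>\<^bsub>G Mod N\<^esub> (N #> h)"
      using Mod.inv_solve_left' coset_in_Mod assms C by (metis Mod.inv_solve_left)
    then have "cgr_of G T h N (inv\<^bsub>G Mod N\<^esub> (N #> g) \<otimes>\<^bsub>G Mod N\<^esub> C) = (cgr_of G T (g \<otimes> h) N C :: 'k)"
      using N assms by (simp add: cgr_of_def N.rcos_sum)
    finally show ?thesis .
  next
    case False
    then show ?thesis using coset_in_Mod[of "g \<otimes> h"] assms by (auto simp: cgr_mult cgr_of_def)
  qed
qed

lemma cgr_a_inv:
  assumes "ring (cgr_ring :: ('g, 'k::field) cgr ring)" "\<mu> \<in> carrier (cgr_ring :: ('g, 'k) cgr ring)"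
  shows "\<ominus>\<^bsub>cgr_ring\<^esub> \<mu> = (\<lambda>N C. - \<mu> N C)"
proof -
  interpret R: ring "cgr_ring :: ('g, 'k) cgr ring" by (rule assms(1))
  have "(\<lambda>N C. - \<mu> N C) = cgr_lin (-1) \<mu> 0 \<mu>" by (simp add: cgr_lin_def)
  then have "(\<lambda>N C. - \<mu> N C) \<in> carrier cgr_ring" using cgr_lin_closed[OF assms(2,2)] by simp
  then show ?thesis
    using assms(2) by (intro R.minus_equality) (simp_all add: cgr_add cgr_zero)
qed

lemma cgr_minus:
  assumes "ring (cgr_ring :: ('g, 'k::field) cgr ring)" "\<nu> \<in> carrier (cgr_ring :: ('g, 'k) cgr ring)"
  shows "\<mu> \<ominus>\<^bsub>cgr_ring\<^esub> \<nu> = (\<lambda>N C. \<mu> N C - \<nu> N C)"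
  unfolding a_minus_def cgr_a_inv[OF assms] cgr_add by simp

end

lemma cgr_map_lin:
  "cgr_map A B TB \<phi> (cgr_lin s \<mu> s' \<nu>) = cgr_lin s (cgr_map A B TB \<phi> \<mu>) s' (cgr_map A B TB \<phi> \<nu>)"
  by (simp add: cgr_map_def cgr_lin_def fun_eq_iff Let_def sum.distrib sum_distrib_left)

text \<open>The preimage \<open>K\<close> of \<open>N\<close> is open and normal, and among its
  cosets only that of \<open>a\<close> carries a coefficient; it maps into the coset of
  \<open>\<phi> a\<close>.\<close>

lemma cgr_map_of:
  assumes A: "compact_group A TA" and B: "compact_group B TB"
    and \<phi>: "\<phi> \<in> hom A B" "continuous_map TA TB \<phi>" and a: "a \<in> carrier A"
  shows "cgr_map A B TB \<phi> (cgr_of A TA a) = (cgr_of B TB (\<phi> a) :: ('b, 'k::field) cgr)"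
proof (intro ext)
  fix N C
  interpret A: compact_group A TA by (rule A)
  interpret B: compact_group B TB by (rule B)
  interpret \<phi>: group_hom A B \<phi> using \<phi>(1) by unfold_locales
  show "cgr_map A B TB \<phi> (cgr_of A TA a) N C = (cgr_of B TB (\<phi> a) N C :: 'k)"
  proof (cases "N \<in> open_normals B TB \<and> C \<in> carrier (B Mod N)")
    case True
    then have N: "N \<in> open_normals B TB" and C: "C \<in> carrier (B Mod N)" by auto
    define K where "K = {x \<in> carrier A. \<phi> x \<in> N}"
    have Ns: "subgroup N B" by (rule B.open_normalD(3)[OF N])
    have "K \<lhd> A"
      unfolding A.normal_inv_iff
    proof (intro conjI ballI)
      show "subgroup K A"
        unfolding K_def by (rule A.subgroupI) (auto simp: subgroup.one_closed[OF Ns] subgroup.m_closed[OF Ns] subgroup.m_inv_closed[OF Ns])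
      show "x \<otimes>\<^bsub>A\<^esub> h \<otimes>\<^bsub>A\<^esub> inv\<^bsub>A\<^esub> x \<in> K" if "x \<in> carrier A" "h \<in> K" for x h
        using that B.open_normalD(1)[OF N] by (auto simp: K_def B.normal_inv_iff)
    qed
    moreover have "openin TA K"
      using openin_continuous_map_preimage[OF \<phi>(2) B.open_normalD(2)[OF N]] by (simp add: K_def)
    ultimately have K: "K \<in> open_normals A TA" by (simp add: open_normals_def)
    have "cgr_map A B TB \<phi> (cgr_of A TA a) N C
        = (\<Sum>D | D \<in> carrier (A Mod K) \<and> \<phi> ` D \<subseteq> C. if D = K #>\<^bsub>A\<^esub> a then 1 else (0::'k))"
      using N C K by (auto simp: cgr_map_def cgr_of_def K_def[symmetric] intro!: sum.cong)
    also have "\<dots> = (if \<phi> ` (K #>\<^bsub>A\<^esub> a) \<subseteq> C then 1 else 0)"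
      using A.finite_Mod[OF K] A.coset_in_Mod[OF a] by (simp add: sum.delta')
    also have "\<phi> ` (K #>\<^bsub>A\<^esub> a) \<subseteq> C \<longleftrightarrow> C = N #>\<^bsub>B\<^esub> \<phi> a"
    proof
      assume "\<phi> ` (K #>\<^bsub>A\<^esub> a) \<subseteq> C"
      then have "\<phi> a \<in> C" using A.rcos_self[OF a A.open_normalD(3)[OF K]] by blast
      moreover obtain x where "x \<in> carrier B" "C = N #>\<^bsub>B\<^esub> x" using C by (auto simp: carrier_FactGroup)
      ultimately show "C = N #>\<^bsub>B\<^esub> \<phi> a" using B.repr_independence Ns by blast
    qed (use a in \<open>auto simp: r_coset_def K_def\<close>)
    finally show ?thesis using N by (simp add: cgr_of_def)
  next
    case False
    then show ?thesis using B.coset_in_Mod[of "\<phi> a"] \<phi>.hom_closed[OF a] by (auto simp: cgr_map_def cgr_of_def)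
  qed
qed

section \<open>Expansion of group elements in the completed group ring\<close>

text \<open>The absorption identity shows that \<open>p ^ n\<close> divides \<open>k\<close> times
  the binomial coefficient. Were the latter prime to \<open>p\<close>, then \<open>p ^ n\<close>
  would divide the smaller number \<open>k\<close>.\<close>

lemma prime_power_dvd_choose:
  fixes p :: nat
  assumes p: "Factorial_Ring.prime p" and k: "0 < k" "k < p ^ n"
  shows "p dvd (p ^ n * t choose k)"
proof (rule ccontr)
  assume "\<not> p dvd (p ^ n * t choose k)"
  then have "coprime (p ^ n) (p ^ n * t choose k)" using p by (simp add: prime_imp_coprime)
  moreover have "k * (p ^ n * t choose k) = p ^ n * t * (p ^ n * t - 1 choose (k - 1))"
    using k(1) by (simp add: times_binomial_minus1_eq)
  then have "p ^ n dvd k * (p ^ n * t choose k)" by simp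
  ultimately have "p ^ n dvd k" by (simp add: coprime_dvd_mult_left_iff)
  then show False using k by (simp add: dvd_imp_le leD)
qed

text \<open>In the Vandermonde sum for an upper entry split as a multiple of \<open>p ^ n\<close>
  plus its remainder, all terms but the first are divisible by \<open>p\<close>. This gives binomial
  coefficients of p-adic integers a meaning in characteristic \<open>p\<close>.\<close>

lemma of_nat_choose_cong:
  fixes u v k n :: nat
  assumes p: "Factorial_Ring.prime CHAR('k::comm_ring_1)" and uv: "u mod CHAR('k) ^ n = v mod CHAR('k) ^ n"
    and k: "k < CHAR('k) ^ n"
  shows "(of_nat (u choose k) :: 'k) = of_nat (v choose k)"
proof -
  define r where "r = v mod CHAR('k) ^ n"
  have *: "(of_nat (w choose k) :: 'k) = of_nat (r choose k)" if w: "w mod CHAR('k) ^ n = r" for w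
  proof -
    obtain t where t: "w = CHAR('k) ^ n * t + r" using w by (metis mult_div_mod_eq)
    have "(of_nat (w choose k) :: 'k) = (\<Sum>i\<le>k. of_nat (CHAR('k) ^ n * t choose i) * of_nat (r choose (k - i)))"
      unfolding t vandermonde[symmetric] by simp
    also have "\<dots> = (\<Sum>i\<in>{0}. of_nat (CHAR('k) ^ n * t choose i) * of_nat (r choose (k - i)))"
    proof (rule sum.mono_neutral_right)
      show "\<forall>i\<in>{..k} - {0}. (of_nat (CHAR('k) ^ n * t choose i) * of_nat (r choose (k - i)) :: 'k) = 0"
      proof
        fix i assume "i \<in> {..k} - {0}"
        then have "CHAR('k) dvd (CHAR('k) ^ n * t choose i)"
          using k by (intro prime_power_dvd_choose[OF p]) auto
        then show "(of_nat (CHAR('k) ^ n * t choose i) * of_nat (r choose (k - i)) :: 'k) = 0"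
          by (metis mult_zero_left of_nat_eq_0_iff_char_dvd)
      qed
    qed auto
    finally show ?thesis by simp
  qed
  show ?thesis using *[of u] *[of v] uv by (simp add: r_def)
qed

text \<open>With \<open>q = p ^ n\<close> these are the exponents of the monomials that can be
  nonzero in the component at \<open>N\<close>.\<close>

definition box :: "nat set \<Rightarrow> nat \<Rightarrow> (nat \<Rightarrow> nat) set" where
  "box I q = {\<gamma> \<in> multi_idx I. \<forall>i\<in>I. \<gamma> i < q}"

lemma box_empty: "box {} q = {\<lambda>_. 0}"
  by (auto simp: box_def multi_idx_def)

lemma box_insert:
  assumes "m \<notin> I"
  shows "bij_betw (\<lambda>(j, \<gamma>). \<gamma>(m := j)) ({..<q} \<times> box I q) (box (insert m I) q)"
proof (rule bij_betwI[where g = "\<lambda>\<gamma>. (\<gamma> m, \<gamma>(m := 0))"])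
  show "(\<lambda>(j, \<gamma>). \<gamma>(m := j)) \<in> {..<q} \<times> box I q \<rightarrow> box (insert m I) q"
    using assms by (auto simp: box_def multi_idx_def)
  show "(\<lambda>\<gamma>. (\<gamma> m, \<gamma>(m := 0))) \<in> box (insert m I) q \<rightarrow> {..<q} \<times> box I q"
    using assms by (auto simp: box_def multi_idx_def)
qed (use assms in \<open>auto simp: box_def multi_idx_def fun_eq_iff\<close>)

lemma finite_box: "finite I \<Longrightarrow> finite (box I q)"
proof (induction I rule: finite_induct)
  case (insert m I)
  have "finite ({..<q} \<times> box I q)" using insert by simp
  then show ?case using bij_betw_finite[OF box_insert[OF insert(2)]] by simp
qed (simp add: box_empty)

text \<open>Modulo \<open>p\<close> the binomial coefficients of a $p$-adic integer \<open>a i\<close> are determined by its residue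
  modulo $p^{\gamma_i}$, as $\gamma_i < p^{\gamma_i}$.\<close>

definition binom_coeff :: "(nat \<Rightarrow> nat \<Rightarrow> nat) \<Rightarrow> nat list \<Rightarrow> (nat \<Rightarrow> nat) \<Rightarrow> nat" where
  "binom_coeff a xs \<gamma> = (\<Prod>i\<in>set xs. a i (\<gamma> i) choose \<gamma> i)"

text \<open>The ring axioms for the completed group ring are a hypothesis here; in the theorem they
  come from \<open>P\<close> being an ideal of it.\<close>

locale p_valued_cgr = p_valued_group G T p \<omega> + R: ring R
  for G :: "('g, 'm) monoid_scheme" (structure) and T p \<omega> and R :: "('g, 'k::field) cgr ring" +
  assumes R_eq: "R = completed_group_ring G T" and char: "CHAR('k) = p"
begin

abbreviation elem :: "'g \<Rightarrow> ('g, 'k) cgr" where "elem \<equiv> cgr_of G T"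

definition aug :: "'g \<Rightarrow> ('g, 'k) cgr" where "aug g = elem g \<ominus>\<^bsub>R\<^esub> \<one>\<^bsub>R\<^esub>"

lemma elem_closed: "g \<in> carrier G \<Longrightarrow> elem g \<in> carrier R"
  by (simp add: R_eq cgr_of_closed)

lemma elem_mult: "g \<in> carrier G \<Longrightarrow> h \<in> carrier G \<Longrightarrow> elem g \<otimes>\<^bsub>R\<^esub> elem h = elem (g \<otimes> h)"
  by (simp add: R_eq cgr_of_mult)

lemma elem_one: "elem \<one> = \<one>\<^bsub>R\<^esub>"
  by (simp add: R_eq cgr_of_one)

lemma R_add: "\<mu> \<oplus>\<^bsub>R\<^esub> \<nu> = (\<lambda>N C. \<mu> N C + \<nu> N C)"
  by (simp add: R_eq cgr_add)

lemma R_minus: "\<nu> \<in> carrier R \<Longrightarrow> \<mu> \<ominus>\<^bsub>R\<^esub> \<nu> = (\<lambda>N C. \<mu> N C - \<nu> N C)"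
  using cgr_minus R.ring_axioms by (simp add: R_eq)

lemma R_mult_cong: "\<mu> N = \<mu>' N \<Longrightarrow> \<nu> N = \<nu>' N \<Longrightarrow> (\<mu> \<otimes>\<^bsub>R\<^esub> \<nu>) N = (\<mu>' \<otimes>\<^bsub>R\<^esub> \<nu>') N"
  unfolding R_eq by (rule cgr_mult_cong)

lemma R_mult_zero_left: "\<mu> N = (\<lambda>_. 0) \<Longrightarrow> (\<mu> \<otimes>\<^bsub>R\<^esub> \<nu>) N = (\<lambda>_. 0)"
  and R_mult_zero_right: "\<nu> N = (\<lambda>_. 0) \<Longrightarrow> (\<mu> \<otimes>\<^bsub>R\<^esub> \<nu>) N = (\<lambda>_. 0)"
  unfolding R_eq by (rule cgr_mult_zero_left, assumption, rule cgr_mult_zero_right, assumption)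

lemma R_mult_sum_left:
  "(\<And>C. \<mu> N C = (\<Sum>i\<in>I. s i * f i N C)) \<Longrightarrow> (\<mu> \<otimes>\<^bsub>R\<^esub> \<nu>) N C = (\<Sum>i\<in>I. s i * (f i \<otimes>\<^bsub>R\<^esub> \<nu>) N C)"
  unfolding R_eq by (rule cgr_mult_sum_left)

lemma R_mult_sum_right:
  "(\<And>C. \<nu> N C = (\<Sum>i\<in>I. s i * f i N C)) \<Longrightarrow> (\<mu> \<otimes>\<^bsub>R\<^esub> \<nu>) N C = (\<Sum>i\<in>I. s i * (\<mu> \<otimes>\<^bsub>R\<^esub> f i) N C)"
  unfolding R_eq by (rule cgr_mult_sum_right)

lemma R_mult_lin_left:
  "cgr_lin s \<mu> s' \<mu>' \<otimes>\<^bsub>R\<^esub> \<nu> = cgr_lin s (\<mu> \<otimes>\<^bsub>R\<^esub> \<nu>) s' (\<mu>' \<otimes>\<^bsub>R\<^esub> \<nu>)"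
  unfolding R_eq by (rule cgr_mult_lin_left)

lemma aug_closed: "g \<in> carrier G \<Longrightarrow> aug g \<in> carrier R"
  by (simp add: aug_def elem_closed)

lemma elem_eq_aug: "g \<in> carrier G \<Longrightarrow> elem g = aug g \<oplus>\<^bsub>R\<^esub> \<one>\<^bsub>R\<^esub>"
  by (simp add: R_add aug_def R_minus)

lemma elem_pow_expand:
  assumes g: "g \<in> carrier G"
  shows "elem (g [^] (a::nat)) N C = (\<Sum>j\<le>a. of_nat (a choose j) * (aug g [^]\<^bsub>R\<^esub> j) N C)"
proof (induction a arbitrary: C)
  case 0 show ?case by (simp add: elem_one)
next
  case (Suc a)
  let ?f = "\<lambda>j::nat. (aug g [^]\<^bsub>R\<^esub> j) N C"
  have "elem (g [^] Suc a) = elem (g [^] a) \<otimes>\<^bsub>R\<^esub> (aug g \<oplus>\<^bsub>R\<^esub> \<one>\<^bsub>R\<^esub>)"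
    using g by (simp add: elem_mult elem_eq_aug[symmetric])
  also have "\<dots> = (elem (g [^] a) \<otimes>\<^bsub>R\<^esub> aug g) \<oplus>\<^bsub>R\<^esub> elem (g [^] a)"
    using g by (simp add: R.r_distr elem_closed aug_closed)
  finally have "elem (g [^] Suc a) N C = (elem (g [^] a) \<otimes>\<^bsub>R\<^esub> aug g) N C + elem (g [^] a) N C"
    by (simp add: R_add)
  also have "(elem (g [^] a) \<otimes>\<^bsub>R\<^esub> aug g) N C = (\<Sum>j\<le>a. of_nat (a choose j) * ?f (Suc j))"
    unfolding R.nat_pow_Suc by (rule R_mult_sum_left) (rule Suc.IH)
  also have "elem (g [^] a) N C = (\<Sum>j\<le>Suc a. of_nat (a choose j) * ?f j)"
    using Suc.IH by (simp add: binomial_eq_0)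
  also have "\<dots> = ?f 0 + (\<Sum>j\<le>a. of_nat (a choose Suc j) * ?f (Suc j))"
    by (subst sum.atMost_Suc_shift) simp
  also have "(\<Sum>j\<le>a. of_nat (a choose j) * ?f (Suc j)) + (?f 0 + (\<Sum>j\<le>a. of_nat (a choose Suc j) * ?f (Suc j)))
      = (\<Sum>j\<le>Suc a. of_nat (Suc a choose j) * ?f j)"
    by (subst sum.atMost_Suc_shift) (simp add: sum.distrib distrib_right)
  finally show ?case .
qed

lemma elem_cong: "N #> g = N #> h \<Longrightarrow> elem g N = elem h N"
  by (simp add: cgr_of_def)

text \<open>In characteristic \<open>p\<close> the \<open>p ^ n\<close>-th power of
  \<open>g - 1\<close> is \<open>g [^] (p ^ n) - 1\<close>, because the inner binomial coefficients
  vanish, and this is zero in \<open>k[G/N]\<close>.\<close>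

lemma aug_pow_zero:
  assumes g: "g \<in> carrier G" and N: "N \<in> open_normals G T" "g [^] (p ^ n) \<in> N" and j: "p ^ n \<le> j"
  shows "(aug g [^]\<^bsub>R\<^esub> j) N = (\<lambda>_. 0)"
proof -
  let ?q = "p ^ n"
  have q: "0 < ?q" using p_pos by simp
  have "(aug g [^]\<^bsub>R\<^esub> ?q) N C = 0" for C
  proof -
    let ?f = "\<lambda>j::nat. (aug g [^]\<^bsub>R\<^esub> j) N C"
    have "N #> g [^] ?q = N #> \<one>"
      using coset_join2[OF _ open_normalD(3)[OF N(1)]] g N(2) subgroup.one_closed[OF open_normalD(3)[OF N(1)]] by simp
    then have "elem (g [^] ?q) N C = ?f 0" using elem_cong[of N "g [^] ?q" \<one>] by (simp add: elem_one)
    moreover have "elem (g [^] ?q) N C = (\<Sum>j\<in>{0, ?q}. of_nat (?q choose j) * ?f j)"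
      unfolding elem_pow_expand[OF g]
    proof (rule sum.mono_neutral_right)
      show "\<forall>j\<in>{..?q} - {0, ?q}. of_nat (?q choose j) * ?f j = 0"
      proof
        fix j assume "j \<in> {..?q} - {0, ?q}"
        then have "p dvd (?q choose j)" using prime_power_dvd_choose[OF prime_p, of j n 1] by auto
        then show "of_nat (?q choose j) * ?f j = 0" using char of_nat_eq_0_iff_char_dvd by auto
      qed
    qed auto
    ultimately show ?thesis using q by simp
  qed
  then have "(aug g [^]\<^bsub>R\<^esub> ?q) N = (\<lambda>_. 0)" by blast
  then have "(aug g [^]\<^bsub>R\<^esub> ?q \<otimes>\<^bsub>R\<^esub> aug g [^]\<^bsub>R\<^esub> (j - ?q)) N = (\<lambda>_. 0)"
    by (rule R_mult_zero_left)
  then show ?thesis using j by (simp add: R.nat_pow_mult aug_closed[OF g])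
qed

text \<open>The range of summation now depends on \<open>N\<close> and no longer on the exponent, as
  the passage to p-adic exponents demands.\<close>

lemma elem_pow_expand_truncated:
  assumes g: "g \<in> carrier G" and N: "N \<in> open_normals G T" "g [^] (p ^ n) \<in> N"
  shows "elem (g [^] (a::nat)) N C = (\<Sum>j<p ^ n. of_nat (a choose j) * (aug g [^]\<^bsub>R\<^esub> j) N C)"
proof -
  let ?t = "\<lambda>j. of_nat (a choose j) * (aug g [^]\<^bsub>R\<^esub> j) N C"
  have "(\<Sum>j\<le>a. ?t j) = (\<Sum>j\<le>a + p ^ n. ?t j)"
    by (rule sum.mono_neutral_left) (auto simp: binomial_eq_0)
  also have "\<dots> = (\<Sum>j<p ^ n. ?t j)"
    by (rule sum.mono_neutral_right) (auto simp: aug_pow_zero[OF g N])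
  finally show ?thesis unfolding elem_pow_expand[OF g] .
qed

lemma monom_prod_Nil: "monom_prod R b [] \<gamma> = \<one>\<^bsub>R\<^esub>"
  and monom_prod_Cons: "monom_prod R b (m # xs) \<gamma> = b m [^]\<^bsub>R\<^esub> \<gamma> m \<otimes>\<^bsub>R\<^esub> monom_prod R b xs \<gamma>"
  by (simp_all add: monom_prod_def)

lemma monom_prod_cong: "(\<And>i. i \<in> set xs \<Longrightarrow> \<gamma> i = \<delta> i) \<Longrightarrow> monom_prod R b xs \<gamma> = monom_prod R b xs \<delta>"
  by (induction xs) (simp_all add: monom_prod_Nil monom_prod_Cons)

lemma monom_prod_closed: "b ` set xs \<subseteq> carrier R \<Longrightarrow> monom_prod R b xs \<gamma> \<in> carrier R"
  by (induction xs) (simp_all add: monom_prod_Nil monom_prod_Cons)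

lemma monom_prod_zero: "(\<And>i. i \<in> set xs \<Longrightarrow> \<gamma> i = 0) \<Longrightarrow> monom_prod R b xs \<gamma> = \<one>\<^bsub>R\<^esub>"
  by (induction xs) (simp_all add: monom_prod_Nil monom_prod_Cons)

lemma monom_prod_append_zero:
  "(\<And>i. i \<in> set zs \<Longrightarrow> \<gamma> i = 0) \<Longrightarrow> b ` set xs \<subseteq> carrier R \<Longrightarrow>
     monom_prod R b (xs @ zs) \<gamma> = monom_prod R b xs \<gamma>"
  by (induction xs) (simp_all add: monom_prod_Nil monom_prod_Cons monom_prod_zero)

lemma monom_prod_single:
  "b ` set xs \<subseteq> carrier R \<Longrightarrow> distinct xs \<Longrightarrow> i \<in> set xs \<Longrightarrow> monom_prod R b xs ((\<lambda>_. 0)(i := 1)) = b i"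
proof (induction xs)
  case (Cons m xs)
  then show ?case
  proof (cases "m = i")
    case True
    then have "monom_prod R b xs ((\<lambda>_. 0)(i := 1)) = \<one>\<^bsub>R\<^esub>" using Cons.prems by (intro monom_prod_zero) auto
    then show ?thesis using True Cons.prems by (simp add: monom_prod_Cons del: fun_upd_apply) simp
  next
    case False
    then show ?thesis using Cons by (auto simp: monom_prod_Cons)
  qed
qed simp

context
  fixes y :: "nat \<Rightarrow> 'g" and N n
  assumes N: "N \<in> open_normals G T" and n: "\<And>x. x \<in> carrier G \<Longrightarrow> ereal (real n) \<le> \<omega> x \<Longrightarrow> x \<in> N"
begin

lemma power_in_N: "g \<in> carrier G \<Longrightarrow> g [^] (p ^ n) \<in> N"
  using n val_p_pow by simp

lemma monom_prod_eq_zero: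
  assumes "y ` set xs \<subseteq> carrier G" "i \<in> set xs" "p ^ n \<le> \<gamma> i"
  shows "monom_prod R (\<lambda>i. aug (y i)) xs \<gamma> N = (\<lambda>_. 0)"
  using assms(1,2)
proof (induction xs)
  case (Cons m xs)
  show ?case
  proof (cases "i = m")
    case True
    then have "(aug (y m) [^]\<^bsub>R\<^esub> \<gamma> m) N = (\<lambda>_. 0)"
      using Cons.prems assms(3) by (intro aug_pow_zero[OF _ N power_in_N]) auto
    then show ?thesis unfolding monom_prod_Cons by (rule R_mult_zero_left)
  next
    case False
    then have "monom_prod R (\<lambda>i. aug (y i)) xs \<gamma> N = (\<lambda>_. 0)" using Cons by simp
    then show ?thesis unfolding monom_prod_Cons by (rule R_mult_zero_right)
  qed
qed simp

text \<open>The \<open>n\<close>-th ordinary power is within level \<open>n\<close> of the limit,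
  and \<open>N\<close> contains the ball of that level around the identity.\<close>

lemma coset_zp_pow:
  assumes "g \<in> carrier G" "a \<in> padic_ints p"
  shows "N #> zp_pow G T g a = N #> g [^] a n"
proof -
  let ?z = "zp_pow G T g a" and ?x = "g [^] a n"
  have z: "?z \<in> carrier G" "?x \<in> carrier G" using zp_pow_closed assms by auto
  have "ereal (real n) \<le> \<omega> (inv ?z \<otimes> ?x)" using zp_pow_limit(2)[OF assms, of n] val_sym[OF z] by simp
  then have "inv ?z \<otimes> ?x \<in> N" using n z by simp
  then have "?z \<otimes> (inv ?z \<otimes> ?x) \<otimes> inv ?z \<in> N" using open_normalD(1)[OF N] z by (simp add: normal_inv_iff)
  then have "?x \<otimes> inv ?z \<in> N" using z by (simp add: m_assoc[symmetric])
  then have "?x \<in> N #> ?z" using z by (auto simp: r_coset_def m_assoc intro!: bexI[of _ "?x \<otimes> inv ?z"])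
  then show ?thesis using repr_independence z open_normalD(3)[OF N] by blast
qed

text \<open>The product of the truncated binomial expansions of the factors, multiplied out in the
  order of the list; \<open>box_insert\<close> merges the exponent of the new factor with the
  others.\<close>

lemma elem_zp_prod_expand:
  assumes "y ` set xs \<subseteq> carrier G" "a ` set xs \<subseteq> padic_ints p" "distinct xs"
  shows "elem (zp_prod G T y xs a) N C
    = (\<Sum>\<gamma>\<in>box (set xs) (p ^ n). of_nat (\<Prod>i\<in>set xs. a i n choose \<gamma> i) * monom_prod R (\<lambda>i. aug (y i)) xs \<gamma> N C)"
  using assms
proof (induction xs arbitrary: C)
  case Nil show ?case by (simp add: box_empty elem_one monom_prod_Nil)
next
  case (Cons m xs)
  let ?b = "\<lambda>i. aug (y i)" and ?q = "p ^ n"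
  let ?s = "\<lambda>\<gamma>. of_nat (\<Prod>i\<in>set xs. a i n choose \<gamma> i) :: 'k"
  have ym: "y m \<in> carrier G" "a m \<in> padic_ints p" using Cons.prems by auto
  have xs: "zp_prod G T y xs a \<in> carrier G" by (rule zp_prod_closed) (use Cons.prems in auto)
  have IH: "elem (zp_prod G T y xs a) N C = (\<Sum>\<gamma>\<in>box (set xs) ?q. ?s \<gamma> * monom_prod R ?b xs \<gamma> N C)" for C
    using Cons by simp
  have "elem (zp_prod G T y (m # xs) a) N = (elem (zp_pow G T (y m) (a m)) \<otimes>\<^bsub>R\<^esub> elem (zp_prod G T y xs a)) N"
    using zp_pow_closed[OF ym] xs by (simp add: elem_mult)
  \<comment> \<open>In the component at \<open>N\<close> the p-adic power may be replaced by an
    ordinary one.\<close>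
  also have "\<dots> = (elem (y m [^] a m n) \<otimes>\<^bsub>R\<^esub> elem (zp_prod G T y xs a)) N"
    by (intro R_mult_cong elem_cong coset_zp_pow ym refl)
  finally have "elem (zp_prod G T y (m # xs) a) N C = (elem (y m [^] a m n) \<otimes>\<^bsub>R\<^esub> elem (zp_prod G T y xs a)) N C"
    by simp
  also have "\<dots> = (\<Sum>j<?q. of_nat (a m n choose j) * (?b m [^]\<^bsub>R\<^esub> j \<otimes>\<^bsub>R\<^esub> elem (zp_prod G T y xs a)) N C)"
    by (rule R_mult_sum_left) (rule elem_pow_expand_truncated[OF ym(1) N power_in_N[OF ym(1)]])
  also have "\<dots> = (\<Sum>j<?q. \<Sum>\<gamma>\<in>box (set xs) ?q. of_nat (a m n choose j) * (?s \<gamma> * (?b m [^]\<^bsub>R\<^esub> j \<otimes>\<^bsub>R\<^esub> monom_prod R ?b xs \<gamma>) N C))"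
    unfolding sum_distrib_left[symmetric]
    by (intro sum.cong refl arg_cong2[of _ _ _ _ "(*)"] R_mult_sum_right IH)
  also have "\<dots> = (\<Sum>(j, \<gamma>)\<in>{..<?q} \<times> box (set xs) ?q.
      of_nat (\<Prod>i\<in>set (m # xs). a i n choose (\<gamma>(m := j)) i) * monom_prod R ?b (m # xs) (\<gamma>(m := j)) N C)"
    unfolding sum.cartesian_product
  proof (intro sum.cong refl, clarify)
    fix j \<gamma>
    have "(\<Prod>i\<in>set xs. a i n choose (\<gamma>(m := j)) i) = (\<Prod>i\<in>set xs. a i n choose \<gamma> i)"
      using Cons.prems by (intro prod.cong) auto
    moreover have "monom_prod R ?b xs (\<gamma>(m := j)) = monom_prod R ?b xs \<gamma>"
      using Cons.prems by (intro monom_prod_cong) auto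
    ultimately show "of_nat (a m n choose j) * (?s \<gamma> * (?b m [^]\<^bsub>R\<^esub> j \<otimes>\<^bsub>R\<^esub> monom_prod R ?b xs \<gamma>) N C)
        = of_nat (\<Prod>i\<in>set (m # xs). a i n choose (\<gamma>(m := j)) i) * monom_prod R ?b (m # xs) (\<gamma>(m := j)) N C"
      using Cons.prems by (simp add: monom_prod_Cons mult.assoc)
  qed
  also have "\<dots> = (\<Sum>\<gamma>\<in>box (set (m # xs)) ?q.
      of_nat (\<Prod>i\<in>set (m # xs). a i n choose \<gamma> i) * monom_prod R ?b (m # xs) \<gamma> N C)"
    using sum.reindex_bij_betw[OF box_insert[of m "set xs" ?q], of
        "\<lambda>\<gamma>. of_nat (\<Prod>i\<in>set (m # xs). a i n choose \<gamma> i) * monom_prod R ?b (m # xs) \<gamma> N C"] Cons.prems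
    by (simp add: case_prod_unfold)
  finally show ?case .
qed

end

text \<open>\<open>binom_coeff\<close> reads \<open>a i\<close> modulo
  \<open>p ^ \<gamma> i\<close>, the expansion reads it modulo \<open>p ^ n\<close>. Both moduli
  exceed \<open>\<gamma> i\<close>, so the smaller of them already determines the coefficient. This
  makes the coefficients independent of \<open>N\<close>.\<close>

lemma binom_coeff_cong:
  assumes a: "a ` set xs \<subseteq> padic_ints p" and \<gamma>: "\<gamma> \<in> box (set xs) (p ^ n)"
  shows "of_nat (binom_coeff a xs \<gamma>) = (of_nat (\<Prod>i\<in>set xs. a i n choose \<gamma> i) :: 'k)"
  unfolding binom_coeff_def of_nat_prod
proof (rule prod.cong[OF refl])
  fix i assume i: "i \<in> set xs"
  then have ai: "a i \<in> padic_ints p" using a by auto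
  have lt: "\<gamma> i < p ^ n" "\<gamma> i < p ^ \<gamma> i" using i \<gamma> p_pos by (auto simp: box_def power_gt_expt)
  have "a i (\<gamma> i) mod p ^ min (\<gamma> i) n = a i n mod p ^ min (\<gamma> i) n"
    using padic_ints_le[OF ai, of "min (\<gamma> i) n"] by simp
  then show "of_nat (a i (\<gamma> i) choose \<gamma> i) = (of_nat (a i n choose \<gamma> i) :: 'k)"
    using prime_p lt by (intro of_nat_choose_cong[where n = "min (\<gamma> i) n"]) (auto simp: char min_def)
qed

text \<open>With \<open>P\<close> the p-adic product, the element is \<open>P z - 1 - b i\<close>.
  Since \<open>z\<close> is central, it can stand to the left of the monomials of \<open>P\<close>;
  the correction \<open>r\<close> subtracts the constant monomial and the monomial
  \<open>b i\<close>.\<close>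

lemma elem_expansion:
  fixes y a z xs i
  defines "b \<equiv> \<lambda>i. aug (y i)"
  assumes y: "y ` set xs \<subseteq> carrier G" "a ` set xs \<subseteq> padic_ints p" "distinct xs"
    and z: "z \<in> group_center G" and i: "i \<in> set xs"
  defines "r \<equiv> \<lambda>\<gamma>. - of_bool (\<gamma> = (\<lambda>_. 0) \<or> \<gamma> = (\<lambda>_. 0)(i := 1)) :: 'k"
  shows "cgr_has_sum G T (multi_idx (set xs))
    (\<lambda>\<gamma>. cgr_lin (of_nat (binom_coeff a xs \<gamma>)) (elem z) (r \<gamma>) (elem \<one>) \<otimes>\<^bsub>R\<^esub> monom_prod R b xs \<gamma>)
    (aug (zp_prod G T y xs a \<otimes> z) \<ominus>\<^bsub>R\<^esub> aug (y i))"
  unfolding cgr_has_sum_def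
proof (intro conjI ballI)
  let ?P = "zp_prod G T y xs a"
  have zc: "z \<in> carrier G" "?P \<in> carrier G" "y i \<in> carrier G"
    using z i y zp_prod_closed[OF y(1,2)] by (auto simp: group_center_def)
  then have comm: "z \<otimes> ?P = ?P \<otimes> z" using z unfolding group_center_def by blast
  have bc: "b ` set xs \<subseteq> carrier R" using y(1) aug_closed by (auto simp: b_def)
  show "aug (?P \<otimes> z) \<ominus>\<^bsub>R\<^esub> aug (y i) \<in> carrier (completed_group_ring G T)"
    using zc aug_closed by (simp add: R_eq[symmetric])
  let ?F = "\<lambda>\<gamma>. cgr_lin (of_nat (binom_coeff a xs \<gamma>)) (elem z) (r \<gamma>) (elem \<one>) \<otimes>\<^bsub>R\<^esub> monom_prod R b xs \<gamma>"
  fix N assume N: "N \<in> open_normals G T"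
  obtain n where n: "0 < n" "\<And>x. x \<in> carrier G \<Longrightarrow> ereal (real n) \<le> \<omega> x \<Longrightarrow> x \<in> N"
    using open_normal_contains_powers[OF N] by blast
  let ?q = "p ^ n" and ?box = "box (set xs) (p ^ n)"
  let ?D = "{\<gamma> \<in> multi_idx (set xs). ?F \<gamma> N \<noteq> (\<lambda>_. 0)}"
  have D: "?D \<subseteq> ?box"
  proof
    fix \<gamma> assume \<gamma>: "\<gamma> \<in> ?D"
    have "\<gamma> m < ?q" if m: "m \<in> set xs" for m
    proof (rule ccontr)
      assume "\<not> \<gamma> m < ?q"
      then have "monom_prod R b xs \<gamma> N = (\<lambda>_. 0)"
        unfolding b_def by (intro monom_prod_eq_zero[OF N n(2) y(1) m]) auto
      then have "?F \<gamma> N = (\<lambda>_. 0)" by (rule R_mult_zero_right)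
      then show False using \<gamma> by simp
    qed
    then show "\<gamma> \<in> ?box" using \<gamma> by (simp add: box_def)
  qed
  then show "finite ?D" using finite_box finite_subset by blast
  show "\<forall>C. (aug (?P \<otimes> z) \<ominus>\<^bsub>R\<^esub> aug (y i)) N C = (\<Sum>\<gamma>\<in>?D. ?F \<gamma> N C)"
  proof
    fix C
    let ?m = "\<lambda>\<gamma>. monom_prod R b xs \<gamma> N C"
    \<comment> \<open>Here \<open>0 < n\<close> is used: the box must contain the multi-index
      \<open>?e\<close>, whose entry at \<open>i\<close> is 1.\<close>
    have q: "1 < ?q" by (rule one_less_power[OF p_pos(2) n(1)])
    let ?z = "(\<lambda>_. 0) :: nat \<Rightarrow> nat" and ?e = "(\<lambda>_. 0)(i := 1) :: nat \<Rightarrow> nat"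
    have ze: "?z \<in> ?box" "?e \<in> ?box" "?z \<noteq> ?e"
      using q i p_pos by (auto simp: box_def multi_idx_def fun_eq_iff)
    have F: "?F \<gamma> N C = of_nat (binom_coeff a xs \<gamma>) * (elem z \<otimes>\<^bsub>R\<^esub> monom_prod R b xs \<gamma>) N C + r \<gamma> * ?m \<gamma>" for \<gamma>
    proof -
      have "?F \<gamma> = cgr_lin (of_nat (binom_coeff a xs \<gamma>)) (elem z \<otimes>\<^bsub>R\<^esub> monom_prod R b xs \<gamma>) (r \<gamma>)
          (elem \<one> \<otimes>\<^bsub>R\<^esub> monom_prod R b xs \<gamma>)"
        by (rule R_mult_lin_left)
      also have "elem \<one> \<otimes>\<^bsub>R\<^esub> monom_prod R b xs \<gamma> = monom_prod R b xs \<gamma>"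
        using monom_prod_closed[OF bc] by (simp add: elem_one)
      finally show ?thesis by (simp add: cgr_lin_def)
    qed
    have "(\<Sum>\<gamma>\<in>?D. ?F \<gamma> N C) = (\<Sum>\<gamma>\<in>?box. ?F \<gamma> N C)"
    proof (rule sum.mono_neutral_left[OF finite_box D])
      show "\<forall>\<gamma>\<in>?box - ?D. ?F \<gamma> N C = 0"
      proof
        fix \<gamma> assume "\<gamma> \<in> ?box - ?D"
        then have "?F \<gamma> N = (\<lambda>_. 0)" by (auto simp: box_def)
        then show "?F \<gamma> N C = 0" by simp
      qed
    qed simp
    also have "\<dots> = (\<Sum>\<gamma>\<in>?box. of_nat (binom_coeff a xs \<gamma>) * (elem z \<otimes>\<^bsub>R\<^esub> monom_prod R b xs \<gamma>) N C)
        + (\<Sum>\<gamma>\<in>?box. r \<gamma> * ?m \<gamma>)"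
      unfolding F by (rule sum.distrib)
    also have "(\<Sum>\<gamma>\<in>?box. of_nat (binom_coeff a xs \<gamma>) * (elem z \<otimes>\<^bsub>R\<^esub> monom_prod R b xs \<gamma>) N C)
        = (\<Sum>\<gamma>\<in>?box. of_nat (\<Prod>i\<in>set xs. a i n choose \<gamma> i) * (elem z \<otimes>\<^bsub>R\<^esub> monom_prod R b xs \<gamma>) N C)"
      using binom_coeff_cong[OF y(2)] by (intro sum.cong) auto
    also have "\<dots> = (elem z \<otimes>\<^bsub>R\<^esub> elem ?P) N C"
      by (rule R_mult_sum_right[symmetric]) (unfold b_def, rule elem_zp_prod_expand[OF N n(2) y])
    also have "\<dots> = elem (?P \<otimes> z) N C" using zc comm by (simp add: elem_mult)
    also have "(\<Sum>\<gamma>\<in>?box. r \<gamma> * ?m \<gamma>) = (\<Sum>\<gamma>\<in>{?z, ?e}. r \<gamma> * ?m \<gamma>)"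
      using ze by (intro sum.mono_neutral_right finite_box) (auto simp: r_def)
    also have "\<dots> = - \<one>\<^bsub>R\<^esub> N C - b i N C"
      using ze(3) monom_prod_single[OF bc y(3) i] monom_prod_zero[of xs ?z b] by (simp add: r_def)
    also have "elem (?P \<otimes> z) N C + (- \<one>\<^bsub>R\<^esub> N C - b i N C) = (aug (?P \<otimes> z) \<ominus>\<^bsub>R\<^esub> aug (y i)) N C"
      using zc by (simp add: R_minus aug_closed b_def) (simp add: aug_def R_minus)
    finally show "(aug (?P \<otimes> z) \<ominus>\<^bsub>R\<^esub> aug (y i)) N C = (\<Sum>\<gamma>\<in>?D. ?F \<gamma> N C)" by simp
  qed
qed

end

section \<open>Valuations and filtrations\<close>

text \<open>The hypotheses do not say that \<open>I\<close> is an ideal; that the product of two cosets is a coset comes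
  from the quotient being a ring.\<close>

lemma (in compact_group) cgr_coset_mult:
  fixes I :: "('g, 'k::field) cgr set"
  assumes char: "0 < CHAR('k)" and "I \<noteq> {}" and add: "\<And>h h'. h \<in> I \<Longrightarrow> h' \<in> I \<Longrightarrow> h \<oplus>\<^bsub>cgr_ring\<^esub> h' \<in> I"
    and ring: "ring (cgr_ring Quot I)"
    and xy: "x \<in> carrier cgr_ring" "y \<in> carrier cgr_ring"
  shows "(I +>\<^bsub>cgr_ring\<^esub> x) \<otimes>\<^bsub>cgr_ring Quot I\<^esub> (I +>\<^bsub>cgr_ring\<^esub> y) = I +>\<^bsub>cgr_ring\<^esub> (x \<otimes>\<^bsub>cgr_ring\<^esub> y)"
proof -
  interpret Quot: ring "(cgr_ring :: ('g, 'k) cgr ring) Quot I" by (rule ring)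
  \<comment> \<open>A set closed under addition is closed under positive multiples; in
    characteristic \<open>p\<close> these include zero as \<open>p h\<close> and the negative as
    \<open>(p - 1) h\<close>.\<close>
  have multiple: "(\<lambda>N C. of_nat (Suc n) * h N C) \<in> I" if h: "h \<in> I" for h n
  proof (induction n)
    case (Suc n)
    show ?case using add[OF Suc h] by (simp add: cgr_add algebra_simps)
  qed (use h in simp)
  have zero: "(\<lambda>N C. 0) \<in> I"
  proof -
    obtain h where "h \<in> I" using assms(2) by blast
    then show ?thesis using multiple[of h "CHAR('k) - 1"] char by simp
  qed
  have neg: "(\<lambda>N C. - h N C) \<in> I" if "h \<in> I" for h
  proof (cases "CHAR('k) = 1")
    case True
    then show ?thesis by simp
  next
    case False
    then have "CHAR('k) = Suc (Suc (CHAR('k) - 2))" using char by linarith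
    then have "(of_nat (Suc (Suc (CHAR('k) - 2))) :: 'k) = 0" by (metis of_nat_CHAR)
    then have "(of_nat (Suc (CHAR('k) - 2)) :: 'k) = - 1"
      unfolding of_nat_Suc[of "Suc (CHAR('k) - 2)"] by (metis add.commute eq_neg_iff_add_eq_0)
    then show ?thesis using multiple[OF that, of "CHAR('k) - 2"] by (simp del: of_nat_Suc)
  qed
  have mem: "q \<in> I +>\<^bsub>cgr_ring\<^esub> c \<longleftrightarrow> (\<lambda>N C. q N C - c N C) \<in> I" for q c
  proof
    assume "q \<in> I +>\<^bsub>cgr_ring\<^esub> c"
    then obtain h where "h \<in> I" "q = (\<lambda>N C. h N C + c N C)" by (auto simp: a_r_coset_def' cgr_add)
    then show "(\<lambda>N C. q N C - c N C) \<in> I" by simp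
  next
    assume "(\<lambda>N C. q N C - c N C) \<in> I"
    moreover have "q = (\<lambda>N C. q N C - c N C) \<oplus>\<^bsub>cgr_ring\<^esub> c" by (simp add: cgr_add)
    ultimately show "q \<in> I +>\<^bsub>cgr_ring\<^esub> c" unfolding a_r_coset_def' by blast
  qed
  have self: "z \<in> I +>\<^bsub>cgr_ring\<^esub> z" for z
    using zero by (simp add: mem)
  have eq: "I +>\<^bsub>cgr_ring\<^esub> z = I +>\<^bsub>cgr_ring\<^esub> c" if z: "z \<in> I +>\<^bsub>cgr_ring\<^esub> c" for z c
  proof (intro equalityI subsetI)
    have zc: "(\<lambda>N C. z N C - c N C) \<in> I" using z by (simp add: mem)
    fix q
    show "q \<in> I +>\<^bsub>cgr_ring\<^esub> c" if "q \<in> I +>\<^bsub>cgr_ring\<^esub> z"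
      using add[OF that[unfolded mem] zc] by (simp add: mem cgr_add)
    show "q \<in> I +>\<^bsub>cgr_ring\<^esub> z" if "q \<in> I +>\<^bsub>cgr_ring\<^esub> c"
      using add[OF that[unfolded mem] neg[OF zc]] by (simp add: mem cgr_add)
  qed
  let ?A = "I +>\<^bsub>cgr_ring\<^esub> x" and ?B = "I +>\<^bsub>cgr_ring\<^esub> y"
  have "?A \<in> carrier (cgr_ring Quot I)" "?B \<in> carrier (cgr_ring Quot I)"
    using xy by (auto simp: FactRing_def A_RCOSETS_def')
  then have "?A \<otimes>\<^bsub>cgr_ring Quot I\<^esub> ?B \<in> carrier (cgr_ring Quot I)" by (rule Quot.m_closed)
  then obtain c where c: "?A \<otimes>\<^bsub>cgr_ring Quot I\<^esub> ?B = I +>\<^bsub>cgr_ring\<^esub> c" by (auto simp: FactRing_def A_RCOSETS_def')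
  \<comment> \<open>A coset is determined by any of its members, so exhibiting this one identifies
    the product.\<close>
  have "x \<otimes>\<^bsub>cgr_ring\<^esub> y \<in> ?A \<otimes>\<^bsub>cgr_ring Quot I\<^esub> ?B"
    using self by (auto simp: FactRing_def rcoset_mult_def intro!: bexI)
  then show ?thesis using eq c by auto
qed

text \<open>Elements of the prime field are sums of ones, so their values are nonnegative; the inverse of a
  nonzero one is again a sum of ones, so the values of both are \<open>0\<close>.\<close>

lemma valuation_residue:
  fixes sc :: "'k::field \<Rightarrow> 's" and B :: "('s, 'n) ring_scheme"
  assumes v: "ring_valuation B v" and char: "Factorial_Ring.prime CHAR('k)"
    and sc: "\<And>s. sc s \<in> carrier B" "sc 0 = \<zero>\<^bsub>B\<^esub>" "sc 1 = \<one>\<^bsub>B\<^esub>"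
      "\<And>s s'. sc (s + s') = sc s \<oplus>\<^bsub>B\<^esub> sc s'" "\<And>s s'. sc (s * s') = sc s \<otimes>\<^bsub>B\<^esub> sc s'"
    and x: "x \<in> carrier B" "0 < v x" and z: "z \<in> carrier B" "0 < v z" "sc (- of_nat n) \<otimes>\<^bsub>B\<^esub> z \<in> carrier B"
    and eq: "sc (of_nat n - of_nat m) = x \<oplus>\<^bsub>B\<^esub> (sc (- of_nat n) \<otimes>\<^bsub>B\<^esub> z)"
  shows "(of_nat n :: 'k) = of_nat m"
proof (rule ccontr)
  assume ne: "(of_nat n :: 'k) \<noteq> of_nat m"
  let ?p = "CHAR('k)"
  have min: "min (v a) (v b) \<le> v (a \<oplus>\<^bsub>B\<^esub> b)" and mult: "v (a \<otimes>\<^bsub>B\<^esub> b) = v a + v b"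
    if "a \<in> carrier B" "b \<in> carrier B" for a b
    using v that unfolding ring_valuation_def ring_filtration_def by blast+
  have v0: "v \<zero>\<^bsub>B\<^esub> = \<infinity>" and v1: "v \<one>\<^bsub>B\<^esub> = 0"
    using v unfolding ring_valuation_def ring_filtration_def by blast+
  have nonneg: "0 \<le> v (sc (of_nat i))" for i
  proof (induction i)
    case (Suc i)
    have "min (v (sc (of_nat i))) (v (sc 1)) \<le> v (sc (of_nat i + 1))" unfolding sc(4) by (intro min sc(1))
    then show ?case using Suc v1 by (auto simp: sc(3) min_def add.commute split: if_splits)
  qed (simp add: sc(2) v0)
  \<comment> \<open>Here \<open>p - 1\<close> stands for -1, so that negative integers are sums of
    ones as well and \<open>nonneg\<close> applies to them.\<close>
  have minus: "- of_nat i = (of_nat (i * (?p - 1)) :: 'k)" for i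
  proof -
    have "(of_nat (i * (?p - 1)) :: 'k) + of_nat i = of_nat (i * ?p)"
      using prime_gt_0_nat[OF char] by (simp add: of_nat_add[symmetric] del: of_nat_add of_nat_mult) (simp add: algebra_simps)
    then have "(of_nat (i * (?p - 1)) :: 'k) + of_nat i = 0" by simp
    then show ?thesis by (simp add: eq_neg_iff_add_eq_0 add.commute neg_eq_iff_add_eq_0)
  qed
  define c where "c = n + m * (?p - 1)"
  have c: "(of_nat c :: 'k) = of_nat n - of_nat m"
    using minus[of m] by (simp add: c_def del: of_nat_mult)
  have "\<not> ?p dvd c" using ne c of_nat_eq_0_iff_char_dvd[where 'a = 'k, of c] by auto
  then have "coprime c ?p" using char by (metis coprime_commute prime_imp_coprime)
  then obtain u where u: "[c * u = 1] (mod ?p)" using cong_solve_coprime_nat by auto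
  have "(of_nat (c * u) :: 'k) = of_nat 1" using of_nat_eq_iff_cong_CHAR u by blast
  then have "(of_nat c * of_nat u :: 'k) = 1" by simp
  then have "v (sc (of_nat c)) + v (sc (of_nat u)) = 0"
    using mult[OF sc(1) sc(1), of "of_nat c" "of_nat u"] sc(5)[of "of_nat c" "of_nat u"] sc(3) v1 by simp
  then have "v (sc (of_nat c)) = 0"
    using nonneg[of c] nonneg[of u] by (metis add_nonneg_eq_0_iff)
  \<comment> \<open>The value of the scalar is nonnegative and those of \<open>x\<close> and
    \<open>z\<close> are positive, so the right side of \<open>eq\<close> has positive value,
    against the value 0 of the left side.\<close>
  moreover have "0 < v (x \<oplus>\<^bsub>B\<^esub> (sc (- of_nat n) \<otimes>\<^bsub>B\<^esub> z))"
  proof -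
    have "0 < v (sc (- of_nat n)) + v z"
      using nonneg[of "n * (?p - 1)"] z(2) unfolding minus by (rule add_nonneg_pos)
    then have "0 < v (sc (- of_nat n) \<otimes>\<^bsub>B\<^esub> z)" using mult[OF sc(1) z(1)] by simp
    then show ?thesis using min[OF x(1) z(3)] x(2) by (auto simp: min_def split: if_splits)
  qed
  ultimately show False using eq c by simp
qed

text \<open>\<open>w\<close> and \<open>fv\<close> are known only through expansions; this evaluates
  them on zero, on monomials and on the elements \<open>c i\<close>.\<close>

lemma (in p_valued_cgr) cgr_has_sum_single:
  assumes "\<mu> \<in> carrier R" "i \<in> I" "F i = \<mu>" "\<And>i'. i' \<in> I \<Longrightarrow> i' \<noteq> i \<Longrightarrow> F i' = (\<lambda>N C. 0)"
  shows "cgr_has_sum G T I F \<mu>"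
  unfolding cgr_has_sum_def
proof (intro conjI ballI allI)
  show "\<mu> \<in> carrier (completed_group_ring G T)" using assms(1) by (simp add: R_eq)
  fix N C
  have sub: "{j \<in> I. F j N \<noteq> (\<lambda>_. 0)} \<subseteq> {i}" using assms(4) by auto
  then show "finite {j \<in> I. F j N \<noteq> (\<lambda>_. 0)}" using finite_subset by blast
  have "(\<Sum>j\<in>{j \<in> I. F j N \<noteq> (\<lambda>_. 0)}. F j N C) = (\<Sum>j\<in>{i}. F j N C)"
    using sub assms(2) by (intro sum.mono_neutral_left) auto
  then show "\<mu> N C = (\<Sum>j | j \<in> I \<and> F j N \<noteq> (\<lambda>_. 0). F j N C)" using assms(3) by simp
qed

theorem theoremD:
  fixes p l e d :: nat and t :: real
    and G :: "'g monoid" and T :: "'g topology" and H Z L :: "'g set"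
    and \<omega> :: "'g \<Rightarrow> ereal" and y :: "nat \<Rightarrow> 'g"
    and P \<pp> :: "('g, 'k::field) cgr set" and w :: "('g, 'k) cgr \<Rightarrow> ereal"
    and S :: "'s ring" and Q :: "'s set"
    and \<iota> :: "('g, 'k) cgr set \<Rightarrow> 's" and \<theta> :: "('g, 'k) cgr set \<Rightarrow> 's"
    and bar :: "'g set \<Rightarrow> ('g, 'k) cgr set"
    and v1 :: "'s \<Rightarrow> ereal" and fv :: "('s \<Rightarrow> ereal) \<Rightarrow> 's \<Rightarrow> ereal" and f fhat :: "'s \<Rightarrow> ereal"
    and \<sigma> :: "'g \<Rightarrow> 'g" and \<sigma>Q :: "'s \<Rightarrow> 's" and \<tau> :: "(real \<Rightarrow> 's set) \<Rightarrow> real \<Rightarrow> 's set"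

  assumes p: "Factorial_Ring.prime p" and k: "CHAR('k) = p"
    and G: "compact_padic_analytic_group p G T" "nilpotent_by_finite G" "delta_plus G = {\<one>\<^bsub>G\<^esub>}"
    and H: "is_FNp p G T H"
  defines "GH \<equiv> G\<lparr>carrier := H\<rparr>" and "TH \<equiv> subtopology T H"
  assumes nonab: "\<not> comm_group GH"
    and Z: "Z = group_center GH"
    and L: "L = isolated_hull GH TH (isolated_hull GH TH (derived GH H) \<union> Z)"
  defines "GZ \<equiv> G\<lparr>carrier := Z\<rparr>" and "TZ \<equiv> subtopology T Z"
    and "GL \<equiv> G\<lparr>carrier := L\<rparr>" and "TL \<equiv> subtopology T L"

  assumes \<omega>: "p_valuation p GH \<omega>" "induces_topology GH TH \<omega>"
      "\<forall>g\<in>carrier G. \<forall>x\<in>H. \<omega> (inv\<^bsub>G\<^esub> g \<otimes>\<^bsub>G\<^esub> x \<otimes>\<^bsub>G\<^esub> g) = \<omega> x"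
    and led: "0 < l" "l \<le> e" "e < d"
    and bases: "ordered_basis p GZ TZ \<omega> y [Suc e..<Suc d]"
      "ordered_basis p GL TL \<omega> y [Suc l..<Suc d]"
      "ordered_basis p GH TH \<omega> y [1..<Suc d]"
    and t: "\<forall>i\<in>{1..l}. \<omega> (y i) = ereal t" "\<forall>x\<in>L. ereal t < \<omega> x"

  defines "kG \<equiv> completed_group_ring G T :: ('g, 'k) cgr ring"
    and "kH \<equiv> completed_group_ring GH TH :: ('g, 'k) cgr ring"
    and "kZ \<equiv> completed_group_ring GZ TZ :: ('g, 'k) cgr ring"
    and "inZH \<equiv> cgr_map GZ GH TH (\<lambda>z. z) :: ('g, 'k) cgr \<Rightarrow> ('g, 'k) cgr"
    and "inHG \<equiv> cgr_map GH G T (\<lambda>x. x) :: ('g, 'k) cgr \<Rightarrow> ('g, 'k) cgr"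
  assumes P: "nc_prime_ideal P kH"
      "\<forall>x\<in>H. cgr_of GH TH x \<ominus>\<^bsub>kH\<^esub> \<one>\<^bsub>kH\<^esub> \<in> P \<longrightarrow> x = \<one>\<^bsub>G\<^esub>"
      "\<forall>g\<in>carrier G. cgr_map GH GH TH (\<lambda>x. inv\<^bsub>G\<^esub> g \<otimes>\<^bsub>G\<^esub> x \<otimes>\<^bsub>G\<^esub> g) ` P = P"
    and \<pp>: "primeideal \<pp> kZ" "P = (inZH ` \<pp>) \<cdot>\<^bsub>kH\<^esub> carrier kH"

  defines "b \<equiv> \<lambda>i. cgr_of GH TH (y i) \<ominus>\<^bsub>kH\<^esub> \<one>\<^bsub>kH\<^esub>"
  assumes w: "\<And>x a. cgr_has_sum GH TH (multi_idx {1..d})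
        (\<lambda>\<alpha> N C. a \<alpha> * monom_prod kH b [1..<Suc d] \<alpha> N C) x
      \<Longrightarrow> w x = (INF \<alpha>\<in>{\<alpha> \<in> multi_idx {1..d}. a \<alpha> \<noteq> 0}. \<Sum>i=1..d. ereal (real (\<alpha> i)) * \<omega> (y i))"

  defines "F \<equiv> G Mod H"
    and "PkG \<equiv> (inHG ` P) \<cdot>\<^bsub>kG\<^esub> carrier kG"
  defines "toGP \<equiv> \<lambda>x. PkG +>\<^bsub>kG\<^esub> x"
    and "SQ \<equiv> S\<lparr>carrier := Q\<rparr>"
    and "j \<equiv> \<lambda>x. \<iota> (P +>\<^bsub>kH\<^esub> x)"
  defines "Q' \<equiv> {j (inZH z) \<otimes>\<^bsub>S\<^esub> inv\<^bsub>SQ\<^esub> (j (inZH s)) | z s.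
             z \<in> carrier kZ \<and> s \<in> carrier kZ - \<pp>}"
  assumes Q: "is_localisation (kH Quot P) {P +>\<^bsub>kH\<^esub> inZH s | s. s \<in> carrier kZ - \<pp>} SQ \<iota>"
    and cross: "crossed_product (kG Quot PkG) (toGP ` inHG ` carrier kH) F bar"
      "\<forall>C\<in>carrier F. \<forall>g\<in>C. bar C <#\<^bsub>kG Quot PkG\<^esub> (toGP ` inHG ` carrier kH)
          = toGP (cgr_of G T g) <#\<^bsub>kG Quot PkG\<^esub> (toGP ` inHG ` carrier kH)"
    and \<theta>: "\<theta> \<in> ring_hom (kG Quot PkG) S" "\<forall>x\<in>carrier kH. \<theta> (toGP (inHG x)) = j x"
    and S: "crossed_product S Q F (\<theta> \<circ> bar)"

  \<comment> \<open>the meaning of $q = \sum_\gamma r_\gamma c^\gamma$ in $Q = Q' \otimes_{kZ} kH$: the $r_\gamma$ have a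
    common denominator $s$, and the infinite sum of the numerators is taken in $kH$\<close>
  defines "expands \<equiv> \<lambda>q r. \<exists>s\<in>carrier kZ - \<pp>. \<exists>\<zeta> x. (\<forall>\<gamma>\<in>multi_idx {1..e}. \<zeta> \<gamma> \<in> carrier kZ)
      \<and> cgr_has_sum GH TH (multi_idx {1..e})
           (\<lambda>\<gamma>. inZH (\<zeta> \<gamma>) \<otimes>\<^bsub>kH\<^esub> monom_prod kH b [1..<Suc e] \<gamma>) x
      \<and> q = j x \<otimes>\<^bsub>S\<^esub> inv\<^bsub>SQ\<^esub> (j (inZH s))
      \<and> (\<forall>\<gamma>\<in>multi_idx {1..e}. r \<gamma> = j (inZH (\<zeta> \<gamma>)) \<otimes>\<^bsub>S\<^esub> inv\<^bsub>SQ\<^esub> (j (inZH s)))"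
  defines "c \<equiv> \<lambda>i. j (b i)"
  assumes fv: "\<And>u q r. expands q r \<Longrightarrow>
      fv u q = (INF \<gamma>\<in>multi_idx {1..e}. u (r \<gamma>) + w (monom_prod kH b [1..<Suc e] \<gamma>))"

  defines "A \<equiv> S\<lparr>carrier := j ` carrier kH\<rparr>" and "B \<equiv> S\<lparr>carrier := j ` inZH ` carrier kZ\<rparr>"
  assumes v1: "ring_valuation (S\<lparr>carrier := Q'\<rparr>) v1"
      "\<forall>x\<in>carrier kZ. w (inZH x) \<le> v1 (j (inZH x))"
      "ring_valuation SQ (fv v1)"
      "domain (gr A (fv v1))"
      "\<exists>\<phi>\<in>ring_iso (mpoly_ring (gr B v1) {1..e}) (gr A (fv v1)).
         (\<forall>r\<in>carrier B. \<phi> (mpoly_const (gr B v1) (principal_symbol B v1 r)) = principal_symbol A (fv v1) r)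
         \<and> (\<forall>i\<in>{1..e}. \<phi> (mpoly_var (gr B v1) i) = principal_symbol A (fv v1) (c i))"

  defines "V \<equiv> {\<lambda>x. v1 (inv\<^bsub>S\<^esub> (\<theta> (toGP (cgr_of G T g))) \<otimes>\<^bsub>S\<^esub> x \<otimes>\<^bsub>S\<^esub> \<theta> (toGP (cgr_of G T g))) | g.
             g \<in> carrier G}"
  assumes f: "\<forall>q\<in>Q. f q = (INF u\<in>V. fv u q)"
    and fhat: "\<And>x. x \<in> carrier F \<rightarrow> Q \<Longrightarrow> finite {C \<in> carrier F. x C \<noteq> \<zero>\<^bsub>S\<^esub>} \<Longrightarrow>
      fhat (\<Oplus>\<^bsub>S\<^esub>C\<in>{C \<in> carrier F. x C \<noteq> \<zero>\<^bsub>S\<^esub>}. \<theta> (bar C) \<otimes>\<^bsub>S\<^esub> x C) = (INF C\<in>carrier F. f (x C))"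

  assumes \<sigma>: "\<sigma> \<in> iso GH GH" "homeomorphic_map TH TH \<sigma>" "cgr_map GH GH TH \<sigma> ` P = P"
    and \<sigma>Q: "\<sigma>Q \<in> ring_iso SQ SQ" "\<forall>x\<in>carrier kH. \<sigma>Q (j x) = j (cgr_map GH GH TH \<sigma> x)"
    and \<tau>: "\<tau> \<in> ring_iso (gr_sub S fhat Q) (gr_sub S fhat Q)"
      "\<forall>q\<in>Q. \<forall>r::real. ereal r \<le> fhat q \<longrightarrow> \<tau> (gr_class S fhat r q) = gr_class S fhat r (\<sigma>Q q)"
    and fix_v: "\<forall>u\<in>V. \<forall>r\<in>Q'. u (\<sigma>Q r) = u r"
    and fix_Y: "\<forall>i\<in>{1..l}. \<tau> (principal_symbol S fhat (c i)) = principal_symbol S fhat (c i)"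

  shows "(\<exists>M\<in>Zp_GL p l.
        (\<forall>i\<in>{1..l}. \<sigma> ` (L #>\<^bsub>GH\<^esub> y i) = L #>\<^bsub>GH\<^esub> zp_prod GH TH y [1..<Suc l] (\<lambda>m. M m i))
        \<and> (\<exists>N\<in>Zp_mats p l. \<forall>m\<in>{1..l}. \<forall>i\<in>{1..l}.
             M m i = (if m = i then \<one>\<^bsub>Zp p\<^esub> else \<zero>\<^bsub>Zp p\<^esub>) \<oplus>\<^bsub>Zp p\<^esub> ([p] \<cdot>\<^bsub>Zp p\<^esub> N m i)))
    \<and> (p > 2 \<longrightarrow>
        (\<exists>n>0. \<forall>C\<in>carrier (GH Mod L). ((`) \<sigma> ^^ n) C = C) \<longleftrightarrow> (\<forall>C\<in>carrier (GH Mod L). \<sigma> ` C = C))"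
proof -

  \<comment> \<open>The compact groups \<open>H\<close> and \<open>Z\<close> and their completed
    group rings\<close>
  have [simp]: "carrier GH = H" "carrier GZ = Z" by (simp_all add: GH_def GZ_def)
  have "topological_group G T" "compact_space T" "Hausdorff_space T"
    using G(1) by (auto simp: compact_padic_analytic_group_def padic_analytic_group_def)
  then interpret G: compact_group G T
    by (intro compact_group.intro compact_group_axioms.intro) (simp_all add: topological_group_def)
  have HG: "subgroup H G" "closedin T H"
    using H normal_imp_subgroup unfolding is_FNp_def FNp_class_def by blast+
  have cH: "compact_group GH TH"
    unfolding GH_def TH_def by (rule G.closed_subgroup_compact_group[OF HG])
  have ringH: "ring kH" using P(1) unfolding nc_prime_ideal_def by (blast intro: ideal.axioms(2))
  interpret H: p_valued_cgr GH TH p \<omega> kH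
    by (intro p_valued_cgr.intro p_valued_group.intro p_valued_group_axioms.intro p_valued_cgr_axioms.intro
        cH p \<omega>(1,2) ringH k) (simp add: kH_def)
  have HGs: "H \<subseteq> carrier G" by (rule subgroup.subset[OF HG(1)])

  have Zs: "subgroup Z GH" "closedin TH Z" unfolding Z by (rule H.subgroup_center, rule H.closed_center)
  have ZH: "Z \<subseteq> H" using subgroup.subset[OF Zs(1)] by simp
  have GZ_eq: "GZ = GH\<lparr>carrier := Z\<rparr>" by (simp add: GZ_def GH_def)
  have TZ_eq: "TZ = subtopology TH Z"
    using ZH by (simp add: TZ_def TH_def subtopology_subtopology Int_absorb1)
  have cZ: "compact_group GZ TZ"
    unfolding GZ_eq TZ_eq by (rule H.closed_subgroup_compact_group[OF Zs])
  interpret Z: compact_group GZ TZ by (rule cZ)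
  interpret kZ: cring kZ using \<pp>(1) by (rule primeideal.axioms(2))
  have one_GZ: "\<one>\<^bsub>GZ\<^esub> = \<one>\<^bsub>GH\<^esub>" by (simp add: GZ_eq)

  \<comment> \<open>The subgroup \<open>L\<close> and the p-adic coordinates of the images of the
    basis\<close>
  have Lfacts: "isolated_normal GH TH L" "derived GH (carrier GH) \<subseteq> L" "\<sigma> ` L = L"
    using H.isolated_hull_derived_center \<sigma>(1,2) by (simp_all add: L Z)

  have sets: "set [1..<Suc d] = {1..d}" "set [1..<Suc e] = {1..e}"
      "set [Suc l..<Suc d] = {l<..d}" "set [Suc e..<Suc d] = {e<..d}"
    by auto
  have y: "y ` {1..d} \<subseteq> H" "y ` {l<..d} \<subseteq> L" "y ` {e<..d} \<subseteq> Z"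
    using bases unfolding ordered_basis_def sets by (auto simp: GL_def)
  have gen: "\<exists>a. a ` {1..d} \<subseteq> padic_ints p \<and> x = zp_prod GH TH y [1..<Suc d] a" if "x \<in> H" for x
  proof -
    have "\<forall>x\<in>H. \<exists>!a. a \<in> {1..d} \<rightarrow>\<^sub>E padic_ints p \<and> x = zp_prod GH TH y [1..<Suc d] a"
      using bases(3) unfolding ordered_basis_def sets by simp
    then obtain a where "a \<in> {1..d} \<rightarrow>\<^sub>E padic_ints p" "x = zp_prod GH TH y [1..<Suc d] a" using \<open>x \<in> H\<close> by blast
    then show ?thesis by (intro exI[of _ a]) auto
  qed
  have \<sigma>H: "\<sigma> x \<in> H" if "x \<in> H" for x using that \<sigma>(1) by (auto simp: iso_def hom_def)
  have "\<forall>i\<in>{1..l}. \<exists>a. a ` {1..d} \<subseteq> padic_ints p \<and> \<sigma> (y i) = zp_prod GH TH y [1..<Suc d] a"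
  proof
    fix i assume "i \<in> {1..l}"
    then have "y i \<in> H" using y(1) led by auto
    then show "\<exists>a. a ` {1..d} \<subseteq> padic_ints p \<and> \<sigma> (y i) = zp_prod GH TH y [1..<Suc d] a"
      using gen \<sigma>H by blast
  qed
  then obtain a where a: "\<And>i. i \<in> {1..l} \<Longrightarrow> a i ` {1..d} \<subseteq> padic_ints p"
      "\<And>i. i \<in> {1..l} \<Longrightarrow> \<sigma> (y i) = zp_prod GH TH y [1..<Suc d] (a i)"
    by metis
  have tpos: "0 < t"
  proof -
    have "y 1 \<in> carrier GH" using y(1) led by auto
    then have "0 < \<omega> (y 1)" by (rule H.val_pos)
    then show ?thesis using t(1) led by auto
  qed

  \<comment> \<open>The homomorphism \<open>j\<close> from \<open>kH\<close> into the
    localisation\<close>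
  interpret S: ring S using S unfolding crossed_product_def by blast
  have QS: "subring Q S" using S unfolding crossed_product_def by blast
  have Q_carr: "Q \<subseteq> carrier S" by (rule subringE(1)[OF QS])
  interpret SQ: ring SQ using Q unfolding is_localisation_def by blast
  have SQ_simps: "carrier SQ = Q" "\<one>\<^bsub>SQ\<^esub> = \<one>\<^bsub>S\<^esub>" "\<zero>\<^bsub>SQ\<^esub> = \<zero>\<^bsub>S\<^esub>" "monoid.mult SQ = monoid.mult S" "add SQ = add S"
    by (simp_all add: SQ_def)
  have jhom: "j \<in> ring_hom kH SQ"
  proof -
    have "(\<lambda>x. P +>\<^bsub>kH\<^esub> x) \<in> ring_hom kH (kH Quot P)"
      using P(1) unfolding nc_prime_ideal_def by (blast intro: ideal.rcos_ring_hom)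
    moreover have "\<iota> \<in> ring_hom (kH Quot P) SQ" using Q unfolding is_localisation_def by blast
    ultimately show ?thesis unfolding j_def using ring_hom_trans[of "\<lambda>x. P +>\<^bsub>kH\<^esub> x" kH "kH Quot P" \<iota> SQ]
      by (simp add: o_def)
  qed
  have jQ: "j x \<in> Q" if "x \<in> carrier kH" for x using ring_hom_closed[OF jhom that] by (simp add: SQ_simps)
  have j_add: "j (x \<oplus>\<^bsub>kH\<^esub> z) = j x \<oplus>\<^bsub>S\<^esub> j z" and j_mult: "j (x \<otimes>\<^bsub>kH\<^esub> z) = j x \<otimes>\<^bsub>S\<^esub> j z"
    if "x \<in> carrier kH" "z \<in> carrier kH" for x z
    using ring_hom_add[OF jhom that] ring_hom_mult[OF jhom that] by (simp_all add: SQ_simps)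
  have j_one: "j \<one>\<^bsub>kH\<^esub> = \<one>\<^bsub>S\<^esub>" using ring_hom_one[OF jhom] by (simp add: SQ_simps)
  have j_zero: "j \<zero>\<^bsub>kH\<^esub> = \<zero>\<^bsub>S\<^esub>" using ring_hom_zero[OF jhom ringH SQ.ring_axioms] by (simp add: SQ_simps)

  \<comment> \<open>Linear combinations of a central group element and the identity\<close>
  let ?lin = "\<lambda>s z s'. cgr_lin s (H.elem z) s' (H.elem \<one>\<^bsub>GH\<^esub>)"
  let ?linZ = "\<lambda>s z s'. cgr_lin s (cgr_of GZ TZ z) s' (cgr_of GZ TZ \<one>\<^bsub>GH\<^esub>) :: ('g, 'k) cgr"
  have oneZ: "\<one>\<^bsub>GH\<^esub> \<in> Z" using subgroup.one_closed[OF Zs(1)] .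
  have oneH: "\<one>\<^bsub>GH\<^esub> \<in> H" using oneZ ZH by blast
  have inZH_of: "inZH (cgr_of GZ TZ z) = H.elem z" if "z \<in> Z" for z
    unfolding inZH_def
  proof (rule cgr_map_of[OF cZ cH])
    show "(\<lambda>z. z) \<in> hom GZ GH" using ZH by (auto simp: hom_def GZ_eq)
    show "continuous_map TZ TH (\<lambda>z. z)" unfolding TZ_eq by (simp add: continuous_map_from_subtopology)
  qed (use that in simp)
  have inZH_lin: "inZH (?linZ s z s') = ?lin s z s'" if "z \<in> Z" for s z s'
    unfolding inZH_def cgr_map_lin by (simp only: inZH_def[symmetric] inZH_of that oneZ)
  have linZ: "?linZ s z s' \<in> carrier kZ" if "z \<in> Z" for s z s'
    unfolding kZ_def using that oneZ by (intro Z.cgr_lin_closed Z.cgr_of_closed) auto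
  have lin: "?lin s z s' \<in> carrier kH" if "z \<in> Z" for s z s'
    unfolding kH_def using that oneZ ZH by (intro H.cgr_lin_closed H.cgr_of_closed) auto
  have kZ_one: "\<one>\<^bsub>kZ\<^esub> = cgr_of GZ TZ \<one>\<^bsub>GH\<^esub>" unfolding kZ_def by (simp add: Z.cgr_of_one[symmetric] one_GZ)
  have inZH_one: "inZH \<one>\<^bsub>kZ\<^esub> = \<one>\<^bsub>kH\<^esub>" unfolding kZ_one by (simp add: inZH_of oneZ H.elem_one)
  have kH_zero: "\<zero>\<^bsub>kH\<^esub> = (\<lambda>N C. 0)" unfolding kH_def by (simp add: H.cgr_zero)
  have kZ_zero: "\<zero>\<^bsub>kZ\<^esub> = (\<lambda>N C. 0)" unfolding kZ_def by (simp add: Z.cgr_zero)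
  have inZH_zero: "inZH \<zero>\<^bsub>kZ\<^esub> = \<zero>\<^bsub>kH\<^esub>" unfolding kZ_zero kH_zero inZH_def by (simp add: cgr_map_def fun_eq_iff)
  \<comment> \<open>All expansions below use the common denominator 1, which is admissible because
    \<open>\<pp>\<close> is proper.\<close>
  have one_notin: "\<one>\<^bsub>kZ\<^esub> \<in> carrier kZ - \<pp>"
    using primeideal.I_notcarr[OF \<pp>(1)] ideal.one_imp_carrier[OF primeideal.axioms(1)[OF \<pp>(1)]] by auto
  have inv_one: "inv\<^bsub>SQ\<^esub> (j (inZH \<one>\<^bsub>kZ\<^esub>)) = \<one>\<^bsub>S\<^esub>"
    using SQ.inv_one by (simp add: inZH_one j_one SQ_simps)
  have j_frac: "j x \<otimes>\<^bsub>S\<^esub> inv\<^bsub>SQ\<^esub> (j (inZH \<one>\<^bsub>kZ\<^esub>)) = j x" if "x \<in> carrier kH" for x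
    using jQ[OF that] Q_carr by (auto simp: inv_one)
  have Q'I: "j (inZH \<zeta>) \<in> Q'" if "\<zeta> \<in> carrier kZ" "inZH \<zeta> \<in> carrier kH" for \<zeta>
    unfolding Q'_def
    by (rule CollectI, intro exI[of _ \<zeta>] exI[of _ "\<one>\<^bsub>kZ\<^esub>"]) (use that one_notin j_frac[OF that(2)] in simp)
  have j_lin: "j (?lin s z s') \<in> Q'" if "z \<in> Z" for s z s'
    using Q'I[OF linZ[OF that]] lin[OF that] by (simp add: inZH_lin[OF that])

  \<comment> \<open>Ordered monomials, their values and expansions with denominator 1\<close>
  have b: "b = (\<lambda>i. H.aug (y i))" by (simp add: b_def H.aug_def fun_eq_iff)
  have bH: "b i \<in> carrier kH" if "i \<in> {1..d}" for i
    unfolding b by (rule H.aug_closed) (use that y(1) in auto)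
  have bs: "b ` set [1..<Suc d] \<subseteq> carrier kH" "b ` set [1..<Suc e] \<subseteq> carrier kH"
    using bH led unfolding sets by auto
  let ?m = "monom_prod kH b [1..<Suc e]"
  have m_closed: "?m \<gamma> \<in> carrier kH" for \<gamma> by (rule H.monom_prod_closed[OF bs(2)])
  have expandsI: "expands (j x) (\<lambda>\<gamma>. j (inZH (\<zeta> \<gamma>)))"
    if "\<And>\<gamma>. \<gamma> \<in> multi_idx {1..e} \<Longrightarrow> \<zeta> \<gamma> \<in> carrier kZ \<and> inZH (\<zeta> \<gamma>) \<in> carrier kH"
      "cgr_has_sum GH TH (multi_idx {1..e}) (\<lambda>\<gamma>. inZH (\<zeta> \<gamma>) \<otimes>\<^bsub>kH\<^esub> ?m \<gamma>) x" "x \<in> carrier kH" for \<zeta> x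
    unfolding expands_def
    by (rule bexI[OF _ one_notin], intro exI[of _ \<zeta>] exI[of _ x]) (use that j_frac in auto)

  \<comment> \<open>A monomial in the first \<open>e\<close> variables is one in all
    \<open>d\<close> variables with the remaining exponents zero, so its power series has the single
    coefficient 1 at \<open>\<gamma>\<close>.\<close>
  have w_monom: "w (?m \<gamma>) = (\<Sum>i=1..d. ereal (real (\<gamma> i)) * \<omega> (y i))" if \<gamma>: "\<gamma> \<in> multi_idx {1..e}" for \<gamma>
  proof -
    have split: "[1..<Suc d] = [1..<Suc e] @ [Suc e..<Suc d]"
      using led upt_add_eq_append[of 1 "Suc e" "d - e"] by simp
    have md: "monom_prod kH b [1..<Suc d] \<gamma> = ?m \<gamma>"
      unfolding split
      by (rule H.monom_prod_append_zero[OF _ bs(2)]) (use \<gamma> in \<open>auto simp: multi_idx_def sets simp del: upt_Suc\<close>)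
    define a where "a = (\<lambda>\<alpha>. if \<alpha> = \<gamma> then 1 else (0 :: 'k))"
    have \<gamma>d: "\<gamma> \<in> multi_idx {1..d}" using \<gamma> led by (auto simp: multi_idx_def)
    have "cgr_has_sum GH TH (multi_idx {1..d}) (\<lambda>\<alpha> N C. a \<alpha> * monom_prod kH b [1..<Suc d] \<alpha> N C) (?m \<gamma>)"
      by (rule H.cgr_has_sum_single[OF m_closed \<gamma>d]) (simp_all add: a_def md[unfolded One_nat_def] del: upt_Suc)
    then have "w (?m \<gamma>) = (INF \<alpha>\<in>{\<alpha> \<in> multi_idx {1..d}. a \<alpha> \<noteq> 0}. \<Sum>i=1..d. ereal (real (\<alpha> i)) * \<omega> (y i))"
      by (rule w)
    also have "{\<alpha> \<in> multi_idx {1..d}. a \<alpha> \<noteq> 0} = {\<gamma>}" using \<gamma>d by (auto simp: a_def)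
    finally show ?thesis by simp
  qed
  have w_nonneg: "0 \<le> w (?m \<gamma>)" if "\<gamma> \<in> multi_idx {1..e}" for \<gamma>
    unfolding w_monom[OF that]
  proof (rule sum_nonneg)
    fix i assume "i \<in> {1..d}"
    then have "0 < \<omega> (y i)" using y(1) by (intro H.val_pos) auto
    then show "0 \<le> ereal (real (\<gamma> i)) * \<omega> (y i)" by simp
  qed
  let ?nul = "(\<lambda>_. 0) :: nat \<Rightarrow> nat" and ?idx = "\<lambda>i. (\<lambda>_. 0)(i := 1) :: nat \<Rightarrow> nat"
  have z_idx: "?nul \<in> multi_idx {1..e}" by (simp add: multi_idx_def)
  have e_idx: "?idx i \<in> multi_idx {1..e}" if "i \<in> {1..l}" for i using that led by (auto simp: multi_idx_def)
  have w_zero: "w (?m ?nul) = 0" unfolding w_monom[OF z_idx] by (simp add: zero_ereal_def[symmetric])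
  have w_e: "w (?m (?idx i)) = ereal t" if i: "i \<in> {1..l}" for i
  proof -
    have "w (?m (?idx i)) = (\<Sum>m=1..d. if m = i then \<omega> (y i) else 0)"
      unfolding w_monom[OF e_idx[OF i]] by (intro sum.cong) (auto simp: one_ereal_def[symmetric] zero_ereal_def[symmetric])
    also have "\<dots> = \<omega> (y i)" using i led by simp
    finally show ?thesis using t(1) i by simp
  qed

  \<comment> \<open>Group elements as units of \<open>S\<close>, and the orbit \<open>V\<close> of
    \<open>v1\<close>\<close>
  let ?\<theta> = "\<lambda>g. \<theta> (toGP (cgr_of G T g))"
  have charpos: "0 < CHAR('k)" using k p prime_gt_0_nat by simp
  have ringQ: "ring (kG Quot PkG)" using cross(1) unfolding crossed_product_def by blast
  have PkG_ne: "PkG \<noteq> {}"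
  proof -
    have "\<zero>\<^bsub>kH\<^esub> \<in> P" using P(1) unfolding nc_prime_ideal_def
      by (blast intro: additive_subgroup.zero_closed ideal.axioms(1))
    moreover have "cgr_of G T \<one>\<^bsub>G\<^esub> \<in> carrier kG" unfolding kG_def by (rule G.cgr_of_closed) simp
    ultimately have "inHG \<zero>\<^bsub>kH\<^esub> \<otimes>\<^bsub>kG\<^esub> cgr_of G T \<one>\<^bsub>G\<^esub> \<in> PkG"
      unfolding PkG_def by (blast intro: ideal_prod.prod)
    then show ?thesis by blast
  qed
  have PkG_add: "h \<oplus>\<^bsub>kG\<^esub> h' \<in> PkG" if "h \<in> PkG" "h' \<in> PkG" for h h'
    using that unfolding PkG_def by (rule ideal_prod.sum)
  have elem_kG: "cgr_of G T g \<in> carrier kG" if "g \<in> carrier G" for g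
    unfolding kG_def by (rule G.cgr_of_closed[OF that])
  have toGP_closed: "toGP x \<in> carrier (kG Quot PkG)" if "x \<in> carrier kG" for x
    using that by (auto simp: toGP_def FactRing_def A_RCOSETS_def')
  have \<theta>_closed: "?\<theta> g \<in> carrier S" if "g \<in> carrier G" for g
    by (rule ring_hom_closed[OF \<theta>(1) toGP_closed[OF elem_kG[OF that]]])
  \<comment> \<open>Multiplicativity on group elements makes their images units, with the images of
    the inverses as inverses; the conjugation defining \<open>V\<close> then behaves as expected on
    zero and one.\<close>
  have \<theta>_mult: "?\<theta> g \<otimes>\<^bsub>S\<^esub> ?\<theta> h = ?\<theta> (g \<otimes>\<^bsub>G\<^esub> h)" if gh: "g \<in> carrier G" "h \<in> carrier G" for g h
  proof -
    have "toGP (cgr_of G T g) \<otimes>\<^bsub>kG Quot PkG\<^esub> toGP (cgr_of G T h) = toGP (cgr_of G T g \<otimes>\<^bsub>kG\<^esub> cgr_of G T h)"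
      unfolding toGP_def kG_def
      by (rule G.cgr_coset_mult[OF charpos PkG_ne])
        (use PkG_add ringQ elem_kG gh in \<open>simp_all add: kG_def\<close>)
    also have "cgr_of G T g \<otimes>\<^bsub>kG\<^esub> cgr_of G T h = (cgr_of G T (g \<otimes>\<^bsub>G\<^esub> h) :: ('g, 'k) cgr)"
      unfolding kG_def by (rule G.cgr_of_mult[OF gh])
    finally show ?thesis
      using ring_hom_mult[OF \<theta>(1) toGP_closed[OF elem_kG[OF gh(1)]] toGP_closed[OF elem_kG[OF gh(2)]]] by simp
  qed
  have \<theta>_one: "?\<theta> \<one>\<^bsub>G\<^esub> = \<one>\<^bsub>S\<^esub>"
    using ring_hom_one[OF \<theta>(1)] by (simp add: toGP_def FactRing_def G.cgr_of_one[symmetric] kG_def)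
  have \<theta>_unit: "?\<theta> g \<in> Units S" if "g \<in> carrier G" for g
    using that \<theta>_closed \<theta>_mult[of g "inv\<^bsub>G\<^esub> g"] \<theta>_mult[of "inv\<^bsub>G\<^esub> g" g] \<theta>_one unfolding Units_def by auto
  have v1_zero: "v1 \<zero>\<^bsub>S\<^esub> = \<infinity>" and v1_one: "v1 \<one>\<^bsub>S\<^esub> = 0"
    using v1(1) by (simp_all add: ring_valuation_def ring_filtration_def)
  have V: "u \<zero>\<^bsub>S\<^esub> = \<infinity> \<and> u \<one>\<^bsub>S\<^esub> = 0" if uV: "u \<in> V" for u
  proof -
    obtain g where g: "g \<in> carrier G" "u = (\<lambda>x. v1 (inv\<^bsub>S\<^esub> (?\<theta> g) \<otimes>\<^bsub>S\<^esub> x \<otimes>\<^bsub>S\<^esub> ?\<theta> g))"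
      using uV unfolding V_def by blast
    show ?thesis using \<theta>_unit[OF g(1)] \<theta>_closed[OF g(1)] v1_zero v1_one by (simp add: g(2) S.Units_inv_closed)
  qed
  \<comment> \<open>Conjugation by the identity exhibits \<open>v1\<close> as a member of
    \<open>V\<close>, up to equality on \<open>carrier S\<close>.\<close>
  obtain u1 where u1: "u1 \<in> V" "\<And>x. x \<in> carrier S \<Longrightarrow> u1 x = v1 x"
  proof
    show "(\<lambda>x. v1 (inv\<^bsub>S\<^esub> (?\<theta> \<one>\<^bsub>G\<^esub>) \<otimes>\<^bsub>S\<^esub> x \<otimes>\<^bsub>S\<^esub> ?\<theta> \<one>\<^bsub>G\<^esub>)) \<in> V" unfolding V_def by blast
  qed (simp add: \<theta>_one)

  \<comment> \<open>The values of \<open>fv\<close>, \<open>f\<close> and \<open>fhat\<close> on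
    zero and on the \<open>c i\<close>\<close>
  have fv_zero: "fv u \<zero>\<^bsub>S\<^esub> = \<infinity>" if uV: "u \<in> V" for u
  proof -
    have "expands (j \<zero>\<^bsub>kH\<^esub>) (\<lambda>\<gamma>. j (inZH \<zero>\<^bsub>kZ\<^esub>))"
    proof (rule expandsI)
      show "cgr_has_sum GH TH (multi_idx {1..e}) (\<lambda>\<gamma>. inZH \<zero>\<^bsub>kZ\<^esub> \<otimes>\<^bsub>kH\<^esub> ?m \<gamma>) \<zero>\<^bsub>kH\<^esub>"
        by (rule H.cgr_has_sum_single[OF _ z_idx])
          (use m_closed in \<open>simp_all add: inZH_zero kH_zero[symmetric] del: upt_Suc\<close>)
    qed (simp_all add: inZH_zero)
    then have "fv u (j \<zero>\<^bsub>kH\<^esub>) = (INF \<gamma>\<in>multi_idx {1..e}. u (j (inZH \<zero>\<^bsub>kZ\<^esub>)) + w (?m \<gamma>))" by (rule fv)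
    also have "\<dots> = (INF \<gamma>\<in>multi_idx {1..e}. \<infinity>)"
      using V[OF uV] w_nonneg by (intro INF_cong) (auto simp: inZH_zero j_zero)
    also have "\<dots> = \<infinity>" using z_idx by (intro cINF_const) blast
    finally show ?thesis by (simp only: j_zero)
  qed
  \<comment> \<open>The only nonzero coefficient of \<open>c i\<close> is 1, to which every
    \<open>u\<close> in \<open>V\<close> gives the value 0; so all \<open>fv u\<close> agree on
    \<open>c i\<close>, with value \<open>w (b i) = t\<close>.\<close>
  have fv_c: "ereal t \<le> fv u (c i) \<and> fv u (c i) \<le> ereal t" if uV: "u \<in> V" and i: "i \<in> {1..l}" for u i
  proof -
    define \<zeta> where "\<zeta> = (\<lambda>\<gamma>. if \<gamma> = ?idx i then \<one>\<^bsub>kZ\<^esub> else \<zero>\<^bsub>kZ\<^esub>)"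
    have bi: "b i \<in> carrier kH" "i \<in> set [1..<Suc e]" using i led bH by auto
    have "expands (j (b i)) (\<lambda>\<gamma>. j (inZH (\<zeta> \<gamma>)))"
    proof (rule expandsI[OF _ _ bi(1)])
      show "cgr_has_sum GH TH (multi_idx {1..e}) (\<lambda>\<gamma>. inZH (\<zeta> \<gamma>) \<otimes>\<^bsub>kH\<^esub> ?m \<gamma>) (b i)"
      proof (rule H.cgr_has_sum_single[OF bi(1) e_idx[OF i]])
        show "inZH (\<zeta> (?idx i)) \<otimes>\<^bsub>kH\<^esub> ?m (?idx i) = b i"
          using H.monom_prod_single[OF bs(2) distinct_upt bi(2)] bi(1) by (simp add: \<zeta>_def inZH_one del: upt_Suc)
      qed (use m_closed in \<open>simp add: \<zeta>_def inZH_zero kH_zero[symmetric] del: upt_Suc\<close>)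
    qed (auto simp: \<zeta>_def inZH_zero inZH_one)
    then have fvc: "fv u (c i) = (INF \<gamma>\<in>multi_idx {1..e}. u (j (inZH (\<zeta> \<gamma>))) + w (?m \<gamma>))"
      unfolding c_def by (rule fv)
    have "fv u (c i) \<le> u (j (inZH (\<zeta> (?idx i)))) + w (?m (?idx i))"
      unfolding fvc by (rule INF_lower[OF e_idx[OF i]])
    also have "\<dots> = ereal t" using V[OF uV] w_e[OF i] by (simp add: \<zeta>_def inZH_one j_one del: upt_Suc)
    finally have "fv u (c i) \<le> ereal t" .
    moreover have "ereal t \<le> fv u (c i)"
      unfolding fvc
    proof (rule INF_greatest)
      fix \<gamma> assume \<gamma>: "\<gamma> \<in> multi_idx {1..e}"
      show "ereal t \<le> u (j (inZH (\<zeta> \<gamma>))) + w (?m \<gamma>)"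
      proof (cases "\<gamma> = ?idx i")
        case True
        then show ?thesis using V[OF uV] w_e[OF i] by (simp add: \<zeta>_def inZH_one j_one del: upt_Suc)
      next
        case False
        then have "u (j (inZH (\<zeta> \<gamma>))) = \<infinity>" using V[OF uV] by (simp add: \<zeta>_def inZH_zero j_zero)
        then show ?thesis using w_nonneg[OF \<gamma>] by (simp del: upt_Suc)
      qed
    qed
    ultimately show ?thesis by blast
  qed
  have f_zero: "f \<zero>\<^bsub>S\<^esub> = \<infinity>"
  proof -
    have "f \<zero>\<^bsub>S\<^esub> = (INF u\<in>V. fv u \<zero>\<^bsub>S\<^esub>)" using f subringE(2)[OF QS] by blast
    also have "\<dots> = (INF u\<in>V. \<infinity>)" by (rule INF_cong[OF refl fv_zero])
    also have "\<dots> = \<infinity>" using u1(1) by (intro cINF_const) blast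
    finally show ?thesis .
  qed
  \<comment> \<open>An element of \<open>Q\<close> is supported on the identity coset
    \<open>H\<close>. The infimum defining \<open>fhat\<close> runs over all cosets, and the others
    contribute \<open>f 0 = \<infinity>\<close>. For \<open>q = 0\<close> the support is
    empty.\<close>
  have fhat_f: "fhat q = f q" if q: "q \<in> Q" for q
  proof -
    define x where "x = (\<lambda>C. if C = H then q else \<zero>\<^bsub>S\<^esub>)"
    have HF: "H \<in> carrier F" using G.coset_in_Mod[of "\<one>\<^bsub>G\<^esub>" H] HGs by (simp add: F_def)
    have xQ: "x \<in> carrier F \<rightarrow> Q" using q subringE(2)[OF QS] by (auto simp: x_def)
    have fin: "finite {C \<in> carrier F. x C \<noteq> \<zero>\<^bsub>S\<^esub>}"
      by (rule finite_subset[of _ "{H}"]) (auto simp: x_def)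
    have bar1: "\<theta> (bar H) = \<one>\<^bsub>S\<^esub>" using S by (simp add: crossed_product_def F_def)
    have qS: "q \<in> carrier S" using q Q_carr by blast
    have "(\<Oplus>\<^bsub>S\<^esub>C\<in>{C \<in> carrier F. x C \<noteq> \<zero>\<^bsub>S\<^esub>}. \<theta> (bar C) \<otimes>\<^bsub>S\<^esub> x C) = q"
    proof (cases "q = \<zero>\<^bsub>S\<^esub>")
      case True
      then have "{C \<in> carrier F. x C \<noteq> \<zero>\<^bsub>S\<^esub>} = {}" by (auto simp: x_def)
      then show ?thesis using True by (simp only: S.finsum_empty)
    next
      case False
      then have "{C \<in> carrier F. x C \<noteq> \<zero>\<^bsub>S\<^esub>} = {H}" using HF by (auto simp: x_def)
      then show ?thesis using qS by (simp add: x_def bar1)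
    qed
    then have "fhat q = (INF C\<in>carrier F. f (x C))" using fhat[OF xQ fin] by simp
    also have "\<dots> = f q"
    proof (rule antisym)
      show "(INF C\<in>carrier F. f (x C)) \<le> f q" using INF_lower[OF HF, of "\<lambda>C. f (x C)"] by (simp add: x_def)
      show "f q \<le> (INF C\<in>carrier F. f (x C))" by (rule INF_greatest) (simp add: x_def f_zero)
    qed
    finally show ?thesis .
  qed
  have cQ: "c i \<in> Q" if "i \<in> {1..l}" for i unfolding c_def using bH jQ led that by auto
  have fhat_c: "fhat (c i) = ereal t" if i: "i \<in> {1..l}" for i
  proof -
    have "f (c i) = (INF u\<in>V. fv u (c i))" using f cQ[OF i] by blast
    also have "\<dots> = (INF u\<in>V. ereal t)"
      by (rule INF_cong[OF refl]) (use fv_c[OF _ i] in \<open>auto intro: antisym\<close>)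
    also have "\<dots> = ereal t" using u1(1) by (intro cINF_const) blast
    finally show ?thesis using fhat_f[OF cQ[OF i]] by simp
  qed

  \<comment> \<open>The coordinates of the images modulo \<open>p\<close>\<close>
  have unit: "a i m 1 = unit_entry m i" if i: "i \<in> {1..l}" and m: "m \<in> {1..l}" for i m
  proof -
    let ?tail = "zp_prod GH TH y [Suc e..<Suc d] (a i)" and ?P = "zp_prod GH TH y [1..<Suc e] (a i)"
    have z0: "?tail \<in> Z"
      by (rule H.zp_prod_closed_subgroup[OF Zs]) (use y(3) a(1)[OF i] in \<open>auto simp: sets simp del: upt_Suc\<close>)
    have yi: "y i \<in> H" "i \<in> set [1..<Suc e]" using i y(1) led by auto
    have \<sigma>yi: "\<sigma> (y i) = ?P \<otimes>\<^bsub>GH\<^esub> ?tail"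
    proof -
      have split: "[1..<Suc d] = [1..<Suc e] @ [Suc e..<Suc d]"
        using led upt_add_eq_append[of 1 "Suc e" "d - e"] by simp
      show ?thesis
        unfolding a(2)[OF i] split
        by (rule H.zp_prod_append) (use y(1) a(1)[OF i] in \<open>simp_all only: split[symmetric] sets \<open>carrier GH = H\<close>\<close>)
    qed
    \<comment> \<open>A lift to \<open>kH\<close> of \<open>\<sigma>Q (c i) - c i\<close>, available
      for expansion by \<open>elem_expansion\<close>.\<close>
    define x where "x = H.aug (\<sigma> (y i)) \<ominus>\<^bsub>kH\<^esub> b i"
    have bi: "b i \<in> carrier kH" "H.aug (\<sigma> (y i)) \<in> carrier kH"
      using yi bH[of i] i led \<sigma>H by (auto intro!: H.aug_closed)
    have xH: "x \<in> carrier kH" unfolding x_def using bi by simp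
    have xb: "x \<oplus>\<^bsub>kH\<^esub> b i = H.aug (\<sigma> (y i))"
      using bi unfolding x_def a_minus_def by (simp add: H.R.a_assoc H.R.l_neg)

    have "\<sigma>Q (c i) = j (cgr_map GH GH TH \<sigma> (b i))" using \<sigma>Q(2) bi(1) by (simp add: c_def)
    also have "cgr_map GH GH TH \<sigma> (b i) = H.aug (\<sigma> (y i))"
    proof -
      have hom: "\<sigma> \<in> hom GH GH" "continuous_map TH TH \<sigma>"
        using \<sigma>(1,2) by (auto simp: iso_def homeomorphic_imp_continuous_map)
      have aug: "H.aug g = cgr_lin 1 (H.elem g) (-1) (H.elem \<one>\<^bsub>GH\<^esub>)" for g
        using H.R.one_closed by (simp add: H.aug_def H.R_minus cgr_lin_def H.elem_one)
      have "cgr_map GH GH TH \<sigma> (H.elem g) = H.elem (\<sigma> g)" if "g \<in> H" for g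
        by (rule cgr_map_of[OF cH cH hom]) (use that in simp)
      then show ?thesis
        using yi oneH hom_one[OF hom(1) H.is_group H.is_group] by (simp add: b aug cgr_map_lin)
    qed
    finally have \<sigma>c: "\<sigma>Q (c i) = j x \<oplus>\<^bsub>S\<^esub> c i" using j_add[OF xH bi(1)] xb by (simp add: c_def)
    \<comment> \<open>As \<open>fhat (c i)\<close> is exactly \<open>t\<close>, the symbol of
      \<open>c i\<close> is its class in degree \<open>t\<close>, where \<open>\<tau>\<close> is
      described by \<open>\<sigma>Q\<close>.\<close>
    have "\<tau> (gr_class S fhat t (c i)) = gr_class S fhat t (\<sigma>Q (c i))"
      using \<tau>(2)[rule_format, OF cQ[OF i]] fhat_c[OF i] by simp
    moreover have "\<tau> (gr_class S fhat t (c i)) = gr_class S fhat t (c i)"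
      using bspec[OF fix_Y i] fhat_c[OF i] by (simp add: principal_symbol_def)
    ultimately have "gr_class S fhat t (\<sigma>Q (c i)) t = gr_class S fhat t (c i) t" by simp
    then have coset: "fil_plus S fhat t +>\<^bsub>S\<^esub> \<sigma>Q (c i) = fil_plus S fhat t +>\<^bsub>S\<^esub> c i" by (simp add: gr_class_def)
    have cS: "c i \<in> carrier S" "j x \<in> carrier S" "\<sigma>Q (c i) \<in> carrier S"
      using cQ[OF i] jQ[OF xH] Q_carr \<sigma>c by auto
    have "\<zero>\<^bsub>S\<^esub> \<in> fil_plus S fhat t"
      using fhat_f[OF subringE(2)[OF QS]] f_zero by (simp add: fil_plus_def)
    \<comment> \<open>Since zero lies in \<open>fil_plus\<close>, equality of the cosets yields an
      element \<open>h\<close> of value above \<open>t\<close> with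
      \<open>\<sigma>Q (c i) = h + c i\<close>; cancellation identifies it with
      \<open>j x\<close>.\<close>
    then have "\<sigma>Q (c i) \<in> fil_plus S fhat t +>\<^bsub>S\<^esub> \<sigma>Q (c i)"
      using cS(3) by (auto simp: a_r_coset_def' intro!: bexI[of _ "\<zero>\<^bsub>S\<^esub>"])
    then obtain h where h: "h \<in> fil_plus S fhat t" "\<sigma>Q (c i) = h \<oplus>\<^bsub>S\<^esub> c i"
      unfolding coset by (auto simp: a_r_coset_def')
    then have "h = j x" using \<sigma>c cS by (simp add: fil_plus_def)
    then have fx: "ereal t < f (j x)" using h(1) fhat_f[OF jQ[OF xH]] by (simp add: fil_plus_def)

    define r where "r = (\<lambda>\<gamma>. - of_bool (\<gamma> = ?nul \<or> \<gamma> = ?idx i) :: 'k)"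
    define \<zeta> where "\<zeta> = (\<lambda>\<gamma>. ?linZ (of_nat (binom_coeff (a i) [1..<Suc e] \<gamma>)) ?tail (r \<gamma>))"
    have "expands (j x) (\<lambda>\<gamma>. j (inZH (\<zeta> \<gamma>)))"
    proof (rule expandsI[OF _ _ xH])
      show "\<zeta> \<gamma> \<in> carrier kZ \<and> inZH (\<zeta> \<gamma>) \<in> carrier kH" for \<gamma>
        unfolding \<zeta>_def inZH_lin[OF z0] by (intro conjI linZ[OF z0] lin[OF z0])
      show "cgr_has_sum GH TH (multi_idx {1..e}) (\<lambda>\<gamma>. inZH (\<zeta> \<gamma>) \<otimes>\<^bsub>kH\<^esub> ?m \<gamma>) x"
        unfolding \<zeta>_def inZH_lin[OF z0] x_def \<sigma>yi b sets(2)[symmetric] r_def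
      proof (rule H.elem_expansion[where y = y and xs = "[1..<Suc e]" and a = "a i" and z = ?tail and i = i])
        show "y ` set [1..<Suc e] \<subseteq> carrier GH" "a i ` set [1..<Suc e] \<subseteq> padic_ints p"
          using y(1) a(1)[OF i] led unfolding sets by fastforce+
        show "?tail \<in> group_center GH" using z0 Z by simp
      qed (use yi in simp_all)
    qed
    then have "fv u1 (j x) = (INF \<gamma>\<in>multi_idx {1..e}. u1 (j (inZH (\<zeta> \<gamma>))) + w (?m \<gamma>))" by (rule fv)
    \<comment> \<open>The infimum over \<open>V\<close> is bounded by its member \<open>u1\<close>,
      which brings the estimate back to \<open>v1\<close>.\<close>
    moreover have "f (j x) \<le> fv u1 (j x)" using f jQ[OF xH] INF_lower[OF u1(1)] by simp
    ultimately have upper: "f (j x) \<le> u1 (j (inZH (\<zeta> \<gamma>))) + w (?m \<gamma>)" if "\<gamma> \<in> multi_idx {1..e}" for \<gamma>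
      using INF_lower[OF that, of "\<lambda>\<gamma>. u1 (j (inZH (\<zeta> \<gamma>))) + w (?m \<gamma>)"] by (metis order_trans)
    have coeff: "ereal t < v1 (j (inZH (\<zeta> \<gamma>))) + w (?m \<gamma>)" if "\<gamma> \<in> multi_idx {1..e}" for \<gamma>
    proof -
      have "j (inZH (\<zeta> \<gamma>)) \<in> carrier S"
        unfolding \<zeta>_def inZH_lin[OF z0] by (rule subsetD[OF Q_carr jQ[OF lin[OF z0]]])
      then show ?thesis using less_le_trans[OF fx upper[OF that]] by (simp only: u1(2))
    qed
    let ?n = "a i m 1"
    have aZ: "a i m' \<in> padic_ints p" if "m' \<in> {1..e}" for m' using a(1)[OF i] that led by auto
    \<comment> \<open>\<open>binom_coeff\<close> reads the exponent modulo
      \<open>p ^ \<gamma> m'\<close>. So an index with \<open>\<gamma> m' = 0\<close> contributes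
      \<open>0 choose 0 = 1\<close>, and one with \<open>\<gamma> m' = 1\<close> the residue modulo
      \<open>p\<close>.\<close>
    have a0: "a i m' 0 = 0" if "m' \<in> {1..e}" for m' using padic_ints_less[OF aZ[OF that], of 0] by simp
    have "binom_coeff (a i) [1..<Suc e] ?nul = 1"
      using a0 by (simp add: binom_coeff_def sets del: upt_Suc)
    then have "j (inZH (\<zeta> ?nul)) = j (?lin 1 ?tail (-1))" by (simp add: \<zeta>_def r_def inZH_lin[OF z0] del: upt_Suc)
    then have "ereal t < v1 (j (?lin 1 ?tail (-1)))"
      using coeff[OF z_idx] unfolding w_zero by (simp only: add_0_right)
    then have v_z: "0 < v1 (j (?lin 1 ?tail (-1)))"
      using tpos by (metis ereal_less(2) less_trans)
    have "binom_coeff (a i) [1..<Suc e] (?idx m) = (\<Prod>m'\<in>{1..e}. if m' = m then ?n else 1)"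
      unfolding binom_coeff_def sets using a0 by (intro prod.cong) auto
    then have bm: "binom_coeff (a i) [1..<Suc e] (?idx m) = ?n" using m led by (simp del: upt_Suc)
    have rm: "r (?idx m) = - of_nat (unit_entry m i)"
      by (auto simp: r_def unit_entry_def fun_eq_iff)
    have v_e: "0 < v1 (j (?lin (of_nat ?n) ?tail (- of_nat (unit_entry m i))))"
    proof -
      have "ereal t < v1 (j (?lin (of_nat ?n) ?tail (- of_nat (unit_entry m i)))) + ereal t"
        using coeff[OF e_idx[OF m]] unfolding w_e[OF m] \<zeta>_def inZH_lin[OF z0] bm rm .
      then show ?thesis
        by (cases "v1 (j (?lin (of_nat ?n) ?tail (- of_nat (unit_entry m i))))") (simp_all del: upt_Suc)
    qed
    have smul: "?lin s \<one>\<^bsub>GH\<^esub> 0 \<otimes>\<^bsub>kH\<^esub> D = (\<lambda>N C. s * D N C)" if "D \<in> carrier kH" for s D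
      unfolding H.R_mult_lin_left using that by (simp add: H.elem_one cgr_lin_def)
    \<comment> \<open>Scalars enter as multiples of the identity. With \<open>z\<close> for
      \<open>?tail\<close> and \<open>\<delta>\<close> for the unit entry, the equation used is
      \<open>n - \<delta> = (n z - \<delta>) + (-n) (z - 1)\<close>.\<close>
    have "(of_nat ?n :: 'k) = of_nat (unit_entry m i)"
    proof (intro valuation_residue[OF v1(1), where sc = "\<lambda>s. j (?lin s \<one>\<^bsub>GH\<^esub> 0)"
          and x = "j (?lin (of_nat ?n) ?tail (- of_nat (unit_entry m i)))" and z = "j (?lin 1 ?tail (-1))"])
      let ?l = "\<lambda>s. ?lin s \<one>\<^bsub>GH\<^esub> 0" and ?D = "?lin 1 ?tail (-1)"
      show "Factorial_Ring.prime CHAR('k)" using p k by simp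
      have "?l 0 = \<zero>\<^bsub>kH\<^esub>" by (simp add: cgr_lin_def kH_zero)
      then show "j (?l 0) = \<zero>\<^bsub>S\<lparr>carrier := Q'\<rparr>\<^esub>" by (simp add: j_zero)
      have "?l 1 = \<one>\<^bsub>kH\<^esub>" by (simp add: cgr_lin_def H.elem_one)
      then show "j (?l 1) = \<one>\<^bsub>S\<lparr>carrier := Q'\<rparr>\<^esub>" by (simp add: j_one)
      have "j (?l (s + s')) = j (?l s) \<oplus>\<^bsub>S\<^esub> j (?l s')" for s s'
        unfolding j_add[OF lin[OF oneZ] lin[OF oneZ], symmetric]
        by (simp add: H.R_add cgr_lin_def algebra_simps)
      then show "j (?l (s + s')) = j (?l s) \<oplus>\<^bsub>S\<lparr>carrier := Q'\<rparr>\<^esub> j (?l s')" for s s' by simp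
      have "j (?l (s * s')) = j (?l s) \<otimes>\<^bsub>S\<^esub> j (?l s')" for s s'
        unfolding j_mult[OF lin[OF oneZ] lin[OF oneZ], symmetric] smul[OF lin[OF oneZ]]
        by (simp add: cgr_lin_def mult.assoc)
      then show "j (?l (s * s')) = j (?l s) \<otimes>\<^bsub>S\<lparr>carrier := Q'\<rparr>\<^esub> j (?l s')" for s s' by simp
      \<comment> \<open>The product is again a combination of \<open>?tail\<close> and the identity,
        which gives its membership in \<open>Q'\<close> directly.\<close>
      have prod: "j (?l (- of_nat ?n)) \<otimes>\<^bsub>S\<^esub> j ?D = j (?lin (- of_nat ?n) ?tail (of_nat ?n))"
        unfolding j_mult[OF lin[OF oneZ] lin[OF z0], symmetric] smul[OF lin[OF z0]]
        by (simp add: cgr_lin_def algebra_simps)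
      then show "j (?l (- of_nat ?n)) \<otimes>\<^bsub>S\<lparr>carrier := Q'\<rparr>\<^esub> j ?D \<in> carrier (S\<lparr>carrier := Q'\<rparr>)"
        using j_lin[OF z0] by (simp del: upt_Suc)
      have "j (?l (of_nat ?n - of_nat (unit_entry m i)))
          = j (?lin (of_nat ?n) ?tail (- of_nat (unit_entry m i))) \<oplus>\<^bsub>S\<^esub> j (?lin (- of_nat ?n) ?tail (of_nat ?n))"
        unfolding j_add[OF lin[OF z0] lin[OF z0], symmetric]
        by (simp add: H.R_add cgr_lin_def algebra_simps)
      then show "j (?l (of_nat ?n - of_nat (unit_entry m i)))
          = j (?lin (of_nat ?n) ?tail (- of_nat (unit_entry m i)))
            \<oplus>\<^bsub>S\<lparr>carrier := Q'\<rparr>\<^esub> (j (?l (- of_nat ?n)) \<otimes>\<^bsub>S\<lparr>carrier := Q'\<rparr>\<^esub> j ?D)"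
        unfolding prod[symmetric] by (simp del: upt_Suc)
    qed (use j_lin[OF z0] j_lin[OF oneZ] v_z v_e in \<open>simp_all del: upt_Suc\<close>)
    then have "[?n = unit_entry m i] (mod p)" using of_nat_eq_iff_cong_CHAR k by blast
    moreover have "?n < p" using padic_ints_less[OF aZ, of m 1] m led by simp
    moreover have "unit_entry m i < p" using H.p_pos by (simp add: unit_entry_def)
    ultimately show ?thesis by (simp add: cong_def)
  qed

  \<comment> \<open>The matrix of the induced automorphism and its order\<close>
  define M where "M = (\<lambda>m i. a i m)"
  have MZ: "M \<in> Zp_mats p l" using a(1) led by (fastforce simp: M_def Zp_mats_def)
  \<comment> \<open>Column \<open>i\<close> of \<open>M\<close> holds the coordinates of the image
    of \<open>y i\<close>, hence the exchange of the two indices.\<close>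
  have M1: "M m i 1 = unit_entry m i" if "m \<in> {1..l}" "i \<in> {1..l}" for m i
    using unit[OF that(2,1)] by (simp add: M_def)
  have ld: "l \<le> d" using led by simp
  have yH: "y ` {1..d} \<subseteq> carrier GH" using y(1) by simp
  have genH: "\<exists>a. a ` {1..d} \<subseteq> padic_ints p \<and> x = zp_prod GH TH y [1..<Suc d] a" if "x \<in> carrier GH" for x
    using gen that by simp
  note facts = Lfacts(1,2) \<sigma>(1) Lfacts(3) yH y(2) ld genH a unit
  have images: "\<forall>i\<in>{1..l}. \<sigma> ` (L #>\<^bsub>GH\<^esub> y i) = L #>\<^bsub>GH\<^esub> zp_prod GH TH y [1..<Suc l] (\<lambda>m. M m i)"
    using H.image_coset_basis[OF facts] by (simp add: M_def del: upt_Suc)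
  have order: "2 < p \<longrightarrow> (\<exists>n>0. \<forall>C\<in>carrier (GH Mod L). ((`) \<sigma> ^^ n) C = C) \<longleftrightarrow> (\<forall>C\<in>carrier (GH Mod L). \<sigma> ` C = C)"
    using H.quotient_finite_order[OF facts] by (rule impI)
  show ?thesis
  proof (rule conjI[OF bexI[of _ M] order], rule conjI[OF images])
    show "\<exists>N\<in>Zp_mats p l. \<forall>m\<in>{1..l}. \<forall>i\<in>{1..l}.
             M m i = (if m = i then \<one>\<^bsub>Zp p\<^esub> else \<zero>\<^bsub>Zp p\<^esub>) \<oplus>\<^bsub>Zp p\<^esub> ([p] \<cdot>\<^bsub>Zp p\<^esub> N m i)"
      by (rule Zp_GL_one_plus_p(2)[OF H.p_pos(2) MZ M1])
    show "M \<in> Zp_GL p l" by (rule Zp_GL_one_plus_p(1)[OF H.p_pos(2) MZ M1])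
  qed
qed

end
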